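(* Let $\Omega\subset\mathbb{R}^n$ be open. If $f:\Omega\to\mathbb{R}^m$ is a locally Lipschitz map satisfying $\operatorname{rank} Df\leq 1$ almost everywhere in $\Omega$, then for every $x\in\Omega$ there is a ball $\mathbb{B}^n(x,\varepsilon)\subset\Omega$, $\varepsilon>0$, and there are $C^\infty$-smooth maps $f_i:\mathbb{B}^n(x,\varepsilon)\to\mathbb{R}^m$, $i=1,2,\ldots$, such that $\operatorname{rank} Df_i\leq 1$ everywhere in $\mathbb{B}^n(x,\varepsilon)$, and the maps $f_i$ converge uniformly to $f$ on $\mathbb{B}^n(x,\varepsilon)$ as $i\to\infty$.
   Context: $\mathbb{B}^n(x,\varepsilon)$ denotes the open Euclidean ball in $\mathbb{R}^n$ with center $x$ and radius $\varepsilon$. A map $f$ on an open set $\Omega\subset\mathbb{R}^n$ is locally Lipschitz if every $x\in\Omega$ has a ball around it on which $f$ is Lipschitz; such a map into $\mathbb{R}^m$ is differentiable almost everywhere (with respect to Lebesgue measure) by Rademacher's theorem, and $Df$ denotes its derivative at points of differentiability. *)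

theory Defs
  imports "HOL-Analysis.Analysis"
begin

definition locally_lipschitz_on ::
    "'a::metric_space set \<Rightarrow> ('a \<Rightarrow> 'b::metric_space) \<Rightarrow> bool"
  where "locally_lipschitz_on \<Omega> f \<longleftrightarrow>
    (\<forall>x\<in>\<Omega>. \<exists>r>0. \<exists>L. ball x r \<subseteq> \<Omega> \<and> L-lipschitz_on (ball x r) f)"

(* C^k regularity by recursion on k: all directional derivatives of f are C^(k-1).
   Meant for open S only, since derivatives are taken with respect to the full
   neighbourhood filter (at x). *)
primrec Ck_on ::
    "nat \<Rightarrow> 'a::real_normed_vector set \<Rightarrow> ('a \<Rightarrow> 'b::real_normed_vector) \<Rightarrow> bool"
  where
    "Ck_on 0 S f \<longleftrightarrow> continuous_on S f"
  | "Ck_on (Suc k) S f \<longleftrightarrow>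
       (\<forall>x\<in>S. f differentiable (at x)) \<and>
       (\<forall>v. Ck_on k S (\<lambda>x. frechet_derivative f (at x) v))"

definition smooth_on ::
    "'a::real_normed_vector set \<Rightarrow> ('a \<Rightarrow> 'b::real_normed_vector) \<Rightarrow> bool"
  where "smooth_on S f \<longleftrightarrow> (\<forall>k. Ck_on k S f)"

end

theory Submission
  imports Defs
begin

text \<open>
  By Rademacher's theorem and Fubini, for a finite fine net \<open>P\<close> of a small ball and a generic apex \<open>a\<close>,
  almost every point of each triangle \<open>a p q\<close> with \<open>p, q \<in> P\<close> is a point where \<open>f\<close> is differentiable
  with rank at most one, so that by Sard every planar coordinate projection of the image of the
  triangle is null. Hence a generic cubical grid of mesh \<open>\<epsilon>\<close> has its codimension two skeleton disjoint
  from \<open>f K\<close>, where \<open>K\<close> is the union of the triangles, and \<open>f\<close> on \<open>K\<close> can be pushed to the dual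
  one-dimensional grid.

  Each connected component of the preimage of the open grid edges defines a map from \<open>K\<close> to the circle. As \<open>K\<close>
  is a cone, the map has a logarithm, which shows that the component cuts \<open>K\<close> into two sides. Since \<open>K\<close> is
  connected, any two of these cuts are nested or disjoint: they are the edges of a tree through
  which the map factors up to an error \<open>O(\<epsilon>)\<close>. Distances to the net points on the root side of a cut
  extend the cuts to the whole ball such that at each point at most one of them is in transition;
  composing polynomial approximations of these functions with a smooth step function that is constant
  outside of a compact interval yields the smooth maps of rank at most one.
\<close>

section \<open>Differentiability of Lipschitz functions of one variable\<close>

text \<open>The obstacle is the exceptional null set: for n at least 3 a null set of the ball can
  have a Lipschitz image of positive area (a plane in three-space, projected), so nothing can be
  concluded about planar projections of the image of the ball itself. Lipschitz maps between planes
  do preserve null sets; this is why only values on a two-dimensional set \<open>K\<close> are used.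
  The rank condition speaks only of points where \<open>f\<close> is differentiable, so that Sard's
  argument needs Rademacher's theorem as well.

  The extended cuts do not restrict to the given ones on \<open>K\<close>. It is enough that every
  \<open>x\<close> in the ball has some \<open>y\<close> in \<open>K\<close> nearby such that the
  cut values at \<open>x\<close> and at \<open>y\<close> differ for at most two cuts. Each cut
  carries a vector of at most one grid unit, so the error is a fixed multiple of the mesh, however
  many cuts there are. Their number, over which there is no control, only enters the width of the
  transitions.\<close>

lemma emeasure_image_le_slope:
  fixes F G :: "real \<Rightarrow> real"
  assumes mono: "strict_mono F" and GF: "\<And>x. G (F x) = x" and FG: "\<And>y. F (G y) = y"
    and lip: "M-lipschitz_on UNIV F" and contG: "continuous_on UNIV G"
    and E: "E \<in> sets borel" and p: "p \<ge> 0"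
    and slope: "\<And>x \<delta>. \<lbrakk>x \<in> E; \<delta> > 0\<rbrakk> \<Longrightarrow> \<exists>h. h \<noteq> 0 \<and> \<bar>h\<bar> < \<delta> \<and> \<bar>F (x + h) - F x\<bar> < p * \<bar>h\<bar>"
  shows "emeasure lebesgue (F ` E) \<le> ennreal p * emeasure lebesgue E"
proof -
  have FE: "F ` E \<in> sets borel"
  proof -
    have "F ` E = G -` E \<inter> space borel"
      using GF FG by (auto simp: image_iff) metis
    moreover have "G \<in> borel_measurable borel"
      using contG by (intro borel_measurable_continuous_onI)
    ultimately show ?thesis
      using measurable_sets[OF _ E, of G borel] by simp
  qed
  have EL: "E \<in> sets lebesgue" using E by auto
  have main: "emeasure lebesgue (F ` E) \<le> ennreal p * (emeasure lebesgue E + ennreal e)" if e: "e > 0" for e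
  proof -
    obtain U where U: "open U" "E \<subseteq> U" "emeasure lebesgue (U - E) < ennreal e"
      by (rule sets_lebesgue_outer_open[OF EL e]) auto
    have mU: "emeasure lebesgue U \<le> emeasure lebesgue E + ennreal e"
    proof -
      have "emeasure lebesgue U = emeasure lebesgue (E \<union> (U - E))" using U by (simp add: Un_absorb1)
      also have "\<dots> \<le> emeasure lebesgue E + emeasure lebesgue (U - E)"
        using U EL by (intro emeasure_subadditive) auto
      finally show ?thesis using U(3) by (meson add_left_mono dual_order.trans less_imp_le)
    qed
    \<comment> \<open>Intervals with centre \<open>c\<close> and radius \<rho> inside
      \<open>U\<close> on which the mean slope of \<open>F\<close> is at most \<open>p\<close>. By
      \<open>slope\<close>, every point of \<open>E\<close> is an end point of arbitrarily short
      ones, so they form a Vitali cover of \<open>E\<close>.\<close>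
    define K where "K = {(c, \<rho>). \<rho> > 0 \<and> cball c \<rho> \<subseteq> U \<and> F (c + \<rho>) - F (c - \<rho>) \<le> p * (2 * \<rho>)}"
    have cov: "\<exists>i. i \<in> K \<and> x \<in> cball (fst i) (snd i) \<and> snd i < d" if xd: "x \<in> E" "d > 0" for x d
    proof -
      obtain \<delta> where \<delta>: "\<delta> > 0" "ball x \<delta> \<subseteq> U" using U xd by (meson openE subsetD)
      then obtain h where h: "h \<noteq> 0" "\<bar>h\<bar> < min \<delta> d" "\<bar>F (x + h) - F x\<bar> < p * \<bar>h\<bar>"
        using slope[OF xd(1), of "min \<delta> d"] xd by auto
      have "cball (x + h/2) (\<bar>h\<bar>/2) \<subseteq> ball x \<delta>"
      proof
        fix y assume "y \<in> cball (x + h/2) (\<bar>h\<bar>/2)"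
        then have "\<bar>x + h/2 - y\<bar> \<le> \<bar>h\<bar>/2" by (simp add: dist_real_def)
        then have "\<bar>x - y\<bar> \<le> \<bar>h\<bar>" by linarith
        then show "y \<in> ball x \<delta>" using h by (simp add: dist_real_def)
      qed
      moreover have "F (x + h/2 + \<bar>h\<bar>/2) - F (x + h/2 - \<bar>h\<bar>/2) \<le> p * (2 * (\<bar>h\<bar>/2))"
      proof (cases "h > 0")
        case True
        then have eqs: "2 * (\<bar>h\<bar>/2) = \<bar>h\<bar>" "x + h/2 + \<bar>h\<bar>/2 = x + h" "x + h/2 - \<bar>h\<bar>/2 = x" by auto
        then show ?thesis using h(3) True by (simp only: eqs)
      next
        case False
        then have eqs: "2 * (\<bar>h\<bar>/2) = \<bar>h\<bar>" "x + h/2 + \<bar>h\<bar>/2 = x" "x + h/2 - \<bar>h\<bar>/2 = x + h" by auto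
        then show ?thesis using h(3) False by (simp only: eqs)
      qed
      ultimately have "(x + h/2, \<bar>h\<bar>/2) \<in> K" using \<delta> h unfolding K_def by auto
      moreover have "x \<in> cball (x + h/2) (\<bar>h\<bar>/2)" by (auto simp: dist_real_def)
      ultimately show ?thesis using h xd by (intro exI[of _ "(x + h/2, \<bar>h\<bar>/2)"]) auto
    qed
    obtain C where C: "countable C" "C \<subseteq> K"
        "pairwise (\<lambda>i j. disjnt (cball (fst i) (snd i)) (cball (fst j) (snd j))) C"
        "negligible (E - (\<Union>i\<in>C. cball (fst i) (snd i)))"
    proof (rule Vitali_covering_theorem_cballs[of K snd E fst])
      show "0 < snd i" if "i \<in> K" for i using that by (auto simp: K_def)
    qed (use cov in blast)+
    let ?B = "\<lambda>i::real\<times>real. cball (fst i) (snd i)"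
    let ?J = "\<lambda>i::real\<times>real. {F (fst i - snd i)..F (fst i + snd i)}"
    have disj: "disjoint_family_on ?B C"
      using C(3) unfolding disjoint_family_on_def pairwise_def disjnt_def by blast
    have injF: "inj F" using mono strict_mono_imp_inj_on by blast
    have JB: "?J i = F ` ?B i" for i
    proof
      show "F ` ?B i \<subseteq> ?J i"
        using mono by (auto simp: cball_eq_atLeastAtMost strict_mono_less_eq)
      show "?J i \<subseteq> F ` ?B i"
      proof
        fix y assume "y \<in> ?J i"
        then have "G y \<in> ?B i"
          using mono FG by (metis atLeastAtMost_iff cball_eq_atLeastAtMost strict_mono_less_eq)
        then show "y \<in> F ` ?B i" using FG by (metis imageI)
      qed
    qed
    have disjJ: "disjoint_family_on ?J C"
      using disj injF unfolding disjoint_family_on_def JB by (metis image_Int image_empty)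
    \<comment> \<open>The disjoint intervals miss a null part of \<open>E\<close>; the Lipschitz
      condition keeps the image of that part null.\<close>
    have neg: "negligible (F ` (E - (\<Union>i\<in>C. ?B i)))"
    proof (rule negligible_locally_Lipschitz_image[OF _ C(4)])
      show "\<exists>T B. open T \<and> x \<in> T \<and> (\<forall>y\<in>(E - (\<Union>i\<in>C. ?B i)) \<inter> T. norm (F y - F x) \<le> B * norm (y - x))" for x
        using lipschitz_on_normD[OF lip] by (intro exI[of _ UNIV] exI[of _ M]) auto
    qed simp
    have sJ: "(\<Union>i\<in>C. ?J i) \<in> sets lebesgue"
      using C(1) by (intro sets.countable_UN') auto
    have "F ` E \<subseteq> F ` (E - (\<Union>i\<in>C. ?B i)) \<union> (\<Union>i\<in>C. ?J i)"
      unfolding JB by auto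
    then have "emeasure lebesgue (F ` E) \<le> emeasure lebesgue (F ` (E - (\<Union>i\<in>C. ?B i)) \<union> (\<Union>i\<in>C. ?J i))"
      using sets.Un[OF negligible_imp_sets[OF neg] sJ] by (intro emeasure_mono)
    also have "\<dots> = emeasure lebesgue (\<Union>i\<in>C. ?J i)"
      using emeasure_Un_null_set[OF sJ] neg by (simp add: negligible_iff_null_sets Un_commute)
    also have "\<dots> = (\<integral>\<^sup>+i. emeasure lebesgue (?J i) \<partial>count_space C)"
      using C disjJ by (intro emeasure_UN_countable) auto
    also have "\<dots> \<le> (\<integral>\<^sup>+i. ennreal p * emeasure lebesgue (?B i) \<partial>count_space C)"
    proof (intro nn_integral_mono)
      fix i assume "i \<in> space (count_space C)"
      then have "i \<in> K" using C by auto
      then have i: "snd i > 0" "F (fst i + snd i) - F (fst i - snd i) \<le> p * (2 * snd i)"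
        by (auto simp: K_def)
      have "F (fst i - snd i) \<le> F (fst i + snd i)" using mono i by (simp add: strict_mono_less_eq)
      then show "emeasure lebesgue (?J i) \<le> ennreal p * emeasure lebesgue (?B i)"
        using i p by (simp add: cball_eq_atLeastAtMost ennreal_mult[symmetric] ennreal_leI)
    qed
    also have "\<dots> = ennreal p * (\<integral>\<^sup>+i. emeasure lebesgue (?B i) \<partial>count_space C)"
      by (intro nn_integral_cmult) auto
    also have "(\<integral>\<^sup>+i. emeasure lebesgue (?B i) \<partial>count_space C) = emeasure lebesgue (\<Union>i\<in>C. ?B i)"
      using C disj by (intro emeasure_UN_countable[symmetric]) auto
    also have "ennreal p * \<dots> \<le> ennreal p * (emeasure lebesgue E + ennreal e)"
    proof (intro mult_left_mono order_trans[OF _ mU] emeasure_mono)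
      show "(\<Union>i\<in>C. ?B i) \<subseteq> U" using C(2) unfolding K_def by fastforce
    qed (use U in auto)
    finally show ?thesis .
  qed
  show ?thesis
  proof (rule ennreal_le_epsilon)
    fix e :: real assume "e > 0"
    \<comment> \<open>The denominator is \<open>p + 1\<close> rather than \<open>p\<close> to admit
      \<open>p = 0\<close>.\<close>
    then have "emeasure lebesgue (F ` E) \<le> ennreal p * (emeasure lebesgue E + ennreal (e / (p + 1)))"
      using p by (intro main) auto
    also have "\<dots> = ennreal p * emeasure lebesgue E + ennreal (p * (e / (p + 1)))"
      using p \<open>e > 0\<close> ennreal_mult[of p "e / (p + 1)"] by (simp add: distrib_left)
    also have "\<dots> \<le> ennreal p * emeasure lebesgue E + ennreal e"
      using p \<open>e > 0\<close> by (intro add_left_mono ennreal_leI) (simp add: field_simps)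
    finally show "emeasure lebesgue (F ` E) \<le> ennreal p * emeasure lebesgue E + ennreal e" .
  qed
qed

text \<open>\<open>Sup S\<close> is the lower limit of \<open>Q\<close>; if the upper limit were
  larger, two rationals between them would violate \<open>gap\<close>. Rational bounds suffice,
  which later leaves only countably many exceptional sets.\<close>

lemma bounded_no_gap_convergent:
  fixes Q :: "'a \<Rightarrow> real"
  assumes F: "F \<noteq> bot" and bd: "\<And>x. \<bar>Q x\<bar> \<le> M"
    and gap: "\<And>p q. \<lbrakk>p \<in> \<rat>; q \<in> \<rat>; p < q\<rbrakk> \<Longrightarrow> (\<forall>\<^sub>F x in F. p \<le> Q x) \<or> (\<forall>\<^sub>F x in F. Q x \<le> q)"
  shows "\<exists>l. (Q \<longlongrightarrow> l) F"
proof -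
  define S where "S = {p. \<forall>\<^sub>F x in F. p \<le> Q x}"
  have "-M \<in> S" unfolding S_def using bd by (auto intro!: always_eventually) (metis abs_le_D2 minus_le_iff)
  have up: "p \<le> M" if "p \<in> S" for p
  proof -
    have "\<forall>\<^sub>F x in F. p \<le> M"
      using that unfolding S_def
      by (auto elim!: eventually_mono) (metis abs_le_D1 bd order_trans)
    then show ?thesis using F by (simp add: eventually_const_iff)
  qed
  have bdd: "bdd_above S" using up by (auto simp: bdd_above_def)
  let ?l = "Sup S"
  have "\<forall>\<^sub>F x in F. ?l - e < Q x" "\<forall>\<^sub>F x in F. Q x < ?l + e" if e0: "e > 0" for e
  proof -
    obtain s where s: "s \<in> S" "?l - e < s"
      using less_cSup_iff[OF _ bdd, of "?l - e"] \<open>-M \<in> S\<close> e0 by (metis empty_iff diff_less_eq less_add_same_cancel1)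
    then have "\<forall>\<^sub>F x in F. s \<le> Q x" by (simp add: S_def)
    then show "\<forall>\<^sub>F x in F. ?l - e < Q x" by eventually_elim (use s in linarith)
    obtain p where p: "p \<in> \<rat>" "?l < p" "p < ?l + e/2" using Rats_dense_in_real[of ?l "?l + e/2"] e0 by auto
    obtain q where q: "q \<in> \<rat>" "p < q" "q < ?l + e" using Rats_dense_in_real[of p "?l + e"] p e0 by auto
    have "p \<notin> S" using cSup_upper[OF _ bdd] p(2) by (meson not_less)
    then have "\<forall>\<^sub>F x in F. Q x \<le> q" using gap[OF p(1) q(1,2)] by (simp add: S_def)
    then show "\<forall>\<^sub>F x in F. Q x < ?l + e" by eventually_elim (use q in linarith)
  qed
  then have "(Q \<longlongrightarrow> ?l) F"
    unfolding tendsto_iff dist_real_def abs_less_iff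
    by (auto intro!: eventually_conj simp: less_diff_eq diff_less_eq add.commute)
  then show ?thesis by blast
qed

text \<open>The covering estimate is used twice: for \<open>F\<close>, which has slopes below
  \<open>p\<close> at every point of the set, and for its inverse, which has slopes below
  \<open>1/q\<close> at the image points. A bounded piece \<open>A\<close> then satisfies
  \<open>|A| <= (p/q) |A|\<close>, so it is null. Slopes of at least one make \<open>F\<close> a
  bijection with Lipschitz inverse.\<close>

lemma negligible_lipschitz_slope_gap:
  fixes F :: "real \<Rightarrow> real"
  assumes lip: "M-lipschitz_on UNIV F" and inc: "\<And>x y. x \<le> y \<Longrightarrow> y - x \<le> F y - F x"
    and pq: "p < q"
  shows "negligible {x. (\<forall>n. \<exists>h. h \<noteq> 0 \<and> \<bar>h\<bar> < inverse (real (Suc n)) \<and> (F (x + h) - F x) / h < p) \<and>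
                        (\<forall>n. \<exists>h. h \<noteq> 0 \<and> \<bar>h\<bar> < inverse (real (Suc n)) \<and> q < (F (x + h) - F x) / h)}"
    (is "negligible ?E")
proof -
  define E where "E = ?E"
  let ?Q = "\<lambda>x h. (F (x + h) - F x) / h"
  have contF: "continuous_on UNIV F" using lip lipschitz_on_continuous_on by blast
  have M: "\<bar>F (x + h) - F x\<bar> \<le> M * \<bar>h\<bar>" for x h
    using lipschitz_onD[OF lip, of "x + h" x] by (simp add: dist_real_def)
  have mono: "strict_mono F"
    using inc by (intro strict_monoI) (smt (verit) less_imp_le)
  have Q1: "1 \<le> ?Q x h" if "h \<noteq> 0" for x h
  proof (cases "h > 0")
    case True then show ?thesis using inc[of x "x + h"] by (simp add: le_divide_eq)
  next
    case False then show ?thesis using inc[of "x + h" x] that by (simp add: le_divide_eq)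
  qed
  have "surj F"
  proof -
    have "\<exists>x. F x = y" for y
    proof (cases "F 0 \<le> y")
      case True
      have "y \<le> F (y - F 0)" using inc[of 0 "y - F 0"] True by simp
      then show ?thesis
        using IVT'[of F 0 y "y - F 0"] True continuous_on_subset[OF contF] by auto
    next
      case False
      have "F (y - F 0) \<le> y" using inc[of "y - F 0" 0] False by simp
      then show ?thesis
        using IVT'[of F "y - F 0" y 0] False continuous_on_subset[OF contF] by auto
    qed
    then show ?thesis by (metis surjI)
  qed
  define G where "G = inv F"
  have GF: "G (F x) = x" for x
    unfolding G_def using mono by (simp add: inv_f_f strict_mono_imp_inj_on)
  have FG: "F (G y) = y" for y
    unfolding G_def using \<open>surj F\<close> by (simp add: surj_f_inv_f)
  have lipG: "1-lipschitz_on UNIV G"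
  proof (rule lipschitz_onI)
    fix x y :: real
    show "dist (G x) (G y) \<le> 1 * dist x y"
      using inc[of "G x" "G y"] inc[of "G y" "G x"] FG[of x] FG[of y] by (simp add: dist_real_def) linarith
  qed simp
  then have contG: "continuous_on UNIV G" using lipschitz_on_continuous_on by blast
  \<comment> \<open>For fixed \<open>h\<close> the condition on \<open>x\<close> is open, so the
    union over all real \<open>h\<close> is still open and the set becomes a countable intersection
    of open sets.\<close>
  have op: "open {x. ?Q x h < p}" "open {x. q < ?Q x h}" for h
    by (auto intro!: open_Collect_less continuous_intros continuous_on_compose2[OF contF] simp: divide_inverse)
  have Eborel: "E \<in> sets borel"
  proof -
    have "E = (\<Inter>n. \<Union>h\<in>{h. h \<noteq> 0 \<and> \<bar>h\<bar> < inverse (real (Suc n))}. {x. ?Q x h < p}) \<inter>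
               (\<Inter>n. \<Union>h\<in>{h. h \<noteq> 0 \<and> \<bar>h\<bar> < inverse (real (Suc n))}. {x. q < ?Q x h})" unfolding E_def by auto
    moreover have "open (\<Union>h\<in>{h. h \<noteq> 0 \<and> \<bar>h\<bar> < inverse (real (Suc n))}. {x. ?Q x h < p})" for n
      using op by blast
    moreover have "open (\<Union>h\<in>{h. h \<noteq> 0 \<and> \<bar>h\<bar> < inverse (real (Suc n))}. {x. q < ?Q x h})" for n
      using op by blast
    ultimately show ?thesis by (simp only:) (intro sets.Int sets.countable_INT borel_open; auto)
  qed
  have neg: "negligible (E \<inter> {-k..k})" for k :: real
  proof (cases "E = {}")
    case False
    then obtain x h where "h \<noteq> 0" "?Q x h < p" unfolding E_def by blast
    then have p: "1 < p" using Q1[of h x] by linarith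
    define A where "A = E \<inter> {-k..k}"
    have A: "A \<in> sets borel" using Eborel unfolding A_def by (intro sets.Int) auto
    have img: "F ` S = G -` S \<inter> space borel" for S
      using GF FG by (auto simp: image_iff) metis
    have 1: "emeasure lebesgue (F ` A) \<le> ennreal p * emeasure lebesgue A"
    proof (rule emeasure_image_le_slope[OF mono GF FG lip contG A])
      fix x \<delta> :: real assume x: "x \<in> A" and "\<delta> > 0"
      then obtain n where n: "inverse (real (Suc n)) < \<delta>" using reals_Archimedean by blast
      obtain h where h: "h \<noteq> 0" "\<bar>h\<bar> < inverse (real (Suc n))" "?Q x h < p" using x unfolding A_def E_def by blast
      have "\<bar>F (x + h) - F x\<bar> / \<bar>h\<bar> < p"
        using h Q1[of h x] by (simp flip: abs_divide)
      then have "\<bar>F (x + h) - F x\<bar> < p * \<bar>h\<bar>" using h by (simp add: divide_less_eq)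
      then show "\<exists>h. h \<noteq> 0 \<and> \<bar>h\<bar> < \<delta> \<and> \<bar>F (x + h) - F x\<bar> < p * \<bar>h\<bar>" using h n by force
    qed (use p in auto)
    have FA: "F ` A \<in> sets borel"
      unfolding img using measurable_sets[OF borel_measurable_continuous_onI[OF contG] A] .
    have monoG: "strict_mono G"
      using mono FG by (metis strict_mono_less strict_monoI)
    have M0: "M \<ge> 0" using lip lipschitz_on_nonneg by blast
    have 2: "emeasure lebesgue (G ` (F ` A)) \<le> ennreal (1/q) * emeasure lebesgue (F ` A)"
    proof (rule emeasure_image_le_slope[OF monoG FG GF lipG contF FA])
      fix y \<delta> :: real assume "y \<in> F ` A" and "\<delta> > 0"
      then obtain x where x: "x \<in> A" "y = F x" by auto
      \<comment> \<open>The increment \<open>?k\<close> of \<open>F\<close> is the step used for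
        \<open>G\<close>. It is at most \<open>M * |h|\<close>, so \<open>h\<close> has to be
        shorter than \<delta> by the factor \<open>M + 1\<close>.\<close>
      obtain n where n: "inverse (real (Suc n)) < \<delta> / (M + 1)"
        using reals_Archimedean[of "\<delta> / (M + 1)"] \<open>\<delta> > 0\<close> M0 by auto
      obtain h where h: "h \<noteq> 0" "\<bar>h\<bar> < inverse (real (Suc n))" "q < ?Q x h" using x unfolding A_def E_def by blast
      let ?k = "F (x + h) - F x"
      have "q < \<bar>?k\<bar> / \<bar>h\<bar>" using h(3) by (metis abs_divide abs_ge_self less_le_trans)
      then have qk: "q * \<bar>h\<bar> < \<bar>?k\<bar>" using h by (simp add: less_divide_eq)
      have "?k \<noteq> 0" using qk p pq h by (smt (verit) mult_pos_pos abs_zero zero_less_abs_iff)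
      moreover have "\<bar>?k\<bar> < \<delta>"
      proof -
        have "\<bar>?k\<bar> \<le> (M + 1) * \<bar>h\<bar>" using M[of x h] by (simp add: distrib_right)
        also have "\<dots> < (M + 1) * (\<delta> / (M + 1))" using h n M0 by (intro mult_strict_left_mono) auto
        finally show ?thesis using M0 by simp
      qed
      moreover have "G (y + ?k) - G y = h" using x GF by simp
      moreover have "\<bar>h\<bar> < 1/q * \<bar>?k\<bar>" using qk p pq by (simp add: field_simps)
      ultimately show "\<exists>h. h \<noteq> 0 \<and> \<bar>h\<bar> < \<delta> \<and> \<bar>G (y + h) - G y\<bar> < 1/q * \<bar>h\<bar>" by metis
    qed (use p pq in auto)
    have GFA: "G ` (F ` A) = A" using GF by (simp add: image_image)
    have fin: "A \<in> lmeasurable" by (rule bounded_set_imp_lmeasurable) (use A in \<open>auto simp: A_def intro: bounded_subset\<close>)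
    then obtain a where a: "a \<ge> 0" "emeasure lebesgue A = ennreal a"
      by (metis emeasure_eq_measure2 measure_nonneg)
    have "ennreal a \<le> ennreal (1/q) * (ennreal p * ennreal a)"
      using 1 2 unfolding GFA a by (meson mult_left_mono order_trans zero_le)
    also have "\<dots> = ennreal (1/q * (p * a))"
    proof -
      have "ennreal (1/q * (p * a)) = ennreal (1/q) * ennreal (p * a)"
        using a p pq by (intro ennreal_mult) auto
      also have "ennreal (p * a) = ennreal p * ennreal a"
        using a p by (intro ennreal_mult) auto
      finally show ?thesis by simp
    qed
    finally have "a \<le> 1/q * (p * a)" using a p pq by (subst (asm) ennreal_le_iff) auto
    then have "q * a \<le> p * a" using p pq by (simp add: field_simps)
    then have "a = 0" using a pq by (simp add: mult_le_cancel_right)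
    then have "A \<in> null_sets lebesgue" using a A by (intro null_setsI) auto
    then show ?thesis by (simp add: negligible_iff_null_sets A_def)
  qed simp
  have "negligible (\<Union>(range (\<lambda>k::nat. E \<inter> {- real k..real k})))"
    using neg by (intro negligible_countable_Union) auto
  moreover have "E \<subseteq> \<Union>(range (\<lambda>k::nat. E \<inter> {- real k..real k}))"
  proof
    fix x assume "x \<in> E"
    moreover obtain k :: nat where "\<bar>x\<bar> \<le> real k" using real_arch_simple by blast
    ultimately have "x \<in> E \<inter> {- real k..real k}" by auto
    then show "x \<in> \<Union>(range (\<lambda>k::nat. E \<inter> {- real k..real k}))" by blast
  qed
  ultimately show ?thesis using negligible_subset unfolding E_def by blast
qed

lemma negligible_lipschitz_not_differentiable_real:
  fixes f :: "real \<Rightarrow> real"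
  assumes lip: "L-lipschitz_on UNIV f"
  shows "negligible {x. \<not> (\<exists>l. ((\<lambda>h. (f (x + h) - f x) / h) \<longlongrightarrow> l) (at 0))}"
proof -
  \<comment> \<open>The linear term shifts every difference quotient by \<open>L + 1\<close>, from
    [-L, L] to [1, 2L + 1], and does not affect its convergence.\<close>
  define F where "F x = f x + (L + 1) * x" for x
  have L0: "L \<ge> 0" using lip lipschitz_on_nonneg by blast
  have fl: "\<bar>f y - f x\<bar> \<le> L * \<bar>y - x\<bar>" for x y
    using lipschitz_onD[OF lip, of y x] by (simp add: dist_real_def)
  have lipF: "(2*L + 1)-lipschitz_on UNIV F"
  proof (rule lipschitz_onI)
    fix x y :: real
    have "\<bar>F x - F y\<bar> \<le> \<bar>f x - f y\<bar> + \<bar>(L + 1) * (x - y)\<bar>" unfolding F_def by (simp add: algebra_simps)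
    also have "\<dots> \<le> L * \<bar>x - y\<bar> + (L + 1) * \<bar>x - y\<bar>" using fl[of x y] L0 by (simp add: abs_mult)
    finally show "dist (F x) (F y) \<le> (2*L + 1) * dist x y" by (simp add: dist_real_def algebra_simps)
  qed (use L0 in auto)
  have inc: "y - x \<le> F y - F x" if "x \<le> y" for x y
    using fl[of y x] that unfolding F_def by (simp add: algebra_simps)
  let ?Q = "\<lambda>x h. (F (x + h) - F x) / h"
  let ?E = "\<lambda>p q. {x. (\<forall>n. \<exists>h. h \<noteq> 0 \<and> \<bar>h\<bar> < inverse (real (Suc n)) \<and> ?Q x h < p) \<and>
                        (\<forall>n. \<exists>h. h \<noteq> 0 \<and> \<bar>h\<bar> < inverse (real (Suc n)) \<and> q < ?Q x h)}"
  have sub: "{x. \<not> (\<exists>l. ((\<lambda>h. (f (x + h) - f x) / h) \<longlongrightarrow> l) (at 0))}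
     \<subseteq> (\<Union>(p, q) \<in> {(p, q). p \<in> \<rat> \<and> q \<in> \<rat> \<and> p < q}. ?E p q)"
  proof
    fix x assume x: "x \<in> {x. \<not> (\<exists>l. ((\<lambda>h. (f (x + h) - f x) / h) \<longlongrightarrow> l) (at 0))}"
    have "\<not> (\<exists>l. (?Q x \<longlongrightarrow> l) (at 0))"
    proof
      assume "\<exists>l. (?Q x \<longlongrightarrow> l) (at 0)"
      then obtain l where "(?Q x \<longlongrightarrow> l) (at 0)" by blast
      then have "((\<lambda>h. ?Q x h - (L + 1)) \<longlongrightarrow> l - (L + 1)) (at 0)" by (intro tendsto_intros)
      moreover have "\<forall>\<^sub>F h in at 0. ?Q x h - (L + 1) = (f (x + h) - f x) / h"
        unfolding F_def by (auto simp: eventually_at field_simps intro!: exI[of _ 1])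
      ultimately have "((\<lambda>h. (f (x + h) - f x) / h) \<longlongrightarrow> l - (L + 1)) (at 0)"
        by (rule Lim_transform_eventually)
      then show False using x by blast
    qed
    moreover have "\<bar>?Q x h\<bar> \<le> 2*L + 1" for h
    proof (cases "h = 0")
      case False
      then show ?thesis using lipschitz_onD[OF lipF, of "x + h" x] by (simp add: dist_real_def divide_le_eq)
    qed (use L0 in auto)
    ultimately obtain p q where pq: "p \<in> \<rat>" "q \<in> \<rat>" "p < q"
      "\<not> (\<forall>\<^sub>F h in at 0. p \<le> ?Q x h)" "\<not> (\<forall>\<^sub>F h in at 0. ?Q x h \<le> q)"
      using bounded_no_gap_convergent[of "at 0" "?Q x" "2*L + 1"] trivial_limit_at by blast
    have "x \<in> ?E p q"
    proof -
      have "\<exists>h. h \<noteq> 0 \<and> \<bar>h\<bar> < d \<and> ?Q x h < p" "\<exists>h. h \<noteq> 0 \<and> \<bar>h\<bar> < d \<and> q < ?Q x h" if "d > 0" for d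
        using pq(4,5) that unfolding eventually_at by (auto simp: not_le dist_real_def)
      then show ?thesis by simp
    qed
    then show "x \<in> (\<Union>(p, q) \<in> {(p, q). p \<in> \<rat> \<and> q \<in> \<rat> \<and> p < q}. ?E p q)" using pq by blast
  qed
  have "countable {(p, q). p \<in> \<rat> \<and> q \<in> \<rat> \<and> p < (q::real)}"
    by (rule countable_subset[of _ "\<rat> \<times> \<rat>"]) (auto simp: countable_rat)
  then have "negligible (\<Union>(p, q) \<in> {(p, q). p \<in> \<rat> \<and> q \<in> \<rat> \<and> p < q}. ?E p q)"
    using negligible_lipschitz_slope_gap[OF lipF inc] by (intro negligible_countable_Union) auto
  then show ?thesis using sub negligible_subset by blast
qed

section \<open>Rademacher's theorem\<close>

lemma AE_lborel_iff_negligible: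
  fixes P :: "'a::euclidean_space \<Rightarrow> bool"
  shows "(AE x in lborel. P x) \<longleftrightarrow> negligible {x. \<not> P x}"
proof -
  have "(AE x in lborel. P x) \<longleftrightarrow> (AE x in lebesgue. P x)" by (simp add: AE_completion_iff)
  also have "\<dots> \<longleftrightarrow> negligible {x. \<not> P x}"
    unfolding eventually_ae_filter_negligible using negligible_subset by blast
  finally show ?thesis .
qed

lemma AE_lborel_commute:
  fixes S :: "('a::euclidean_space \<times> 'b::euclidean_space) set"
  assumes "S \<in> sets borel"
  shows "(AE x in lborel. AE y in lborel. (x, y) \<in> S) \<longleftrightarrow> (AE y in lborel. AE x in lborel. (x, y) \<in> S)"
proof -
  have "{z \<in> space (lborel \<Otimes>\<^sub>M lborel). (fst z, snd z) \<in> S} \<in> sets (lborel \<Otimes>\<^sub>M (lborel :: 'b measure))"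
    unfolding lborel_prod using assms by simp
  then show ?thesis by (rule pair_sigma_finite.AE_commute[OF pair_sigma_finite.intro[OF sigma_finite_lborel sigma_finite_lborel]])
qed

lemma AE_lborel_ex:
  fixes P :: "'a::euclidean_space \<Rightarrow> bool"
  assumes "AE x in lborel. P x"
  shows "\<exists>x. P x"
proof -
  have "ae_filter (lborel :: 'a measure) \<noteq> bot" by (simp add: ae_filter_eq_bot_iff)
  then show ?thesis using assms eventually_happens' by blast
qed

text \<open>By Fubini some \<open>y\<close> has \<open>x + c y \<in> S\<close> for almost every
  \<open>x\<close>, and translating by \<open>c y\<close> preserves null sets. It is applied to
  lines in a given direction and to coordinate planes.\<close>

lemma AE_lborel_slices:
  fixes S :: "'a::euclidean_space set" and c :: "'b::euclidean_space \<Rightarrow> 'a"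
  assumes S: "S \<in> sets borel" and c: "continuous_on UNIV c"
    and sl: "\<And>x. AE y in lborel. x + c y \<in> S"
  shows "AE x in lborel. x \<in> S"
proof -
  let ?T = "{z. fst z + c (snd z) \<in> S}"
  have "?T = (\<lambda>z. fst z + c (snd z)) -` S \<inter> space borel" by auto
  moreover have "(\<lambda>z. fst z + c (snd z)) \<in> borel_measurable borel"
    by (intro borel_measurable_continuous_onI continuous_intros continuous_on_compose2[OF c]) auto
  ultimately have T: "?T \<in> sets borel" using measurable_sets[OF _ S] by metis
  have "AE y in lborel. AE x in lborel. (x, y) \<in> ?T"
    using AE_lborel_commute[OF T] sl by simp
  then obtain y where "AE x in lborel. (x, y) \<in> ?T" using AE_lborel_ex by blast
  then have "negligible {x. x + c y \<notin> S}" by (simp add: AE_lborel_iff_negligible)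
  then have "negligible ((+) (c y) ` {x. x + c y \<notin> S})" by (rule negligible_translation)
  moreover have "(+) (c y) ` {x. x + c y \<notin> S} = {x. x \<notin> S}"
    by (auto simp: image_iff algebra_simps intro!: exI[of _ "_ - c y"])
  ultimately show ?thesis by (simp add: AE_lborel_iff_negligible)
qed

section \<open>Directional derivatives of Lipschitz functions\<close>

definition dir_quot :: "('a::real_normed_vector \<Rightarrow> real) \<Rightarrow> 'a \<Rightarrow> 'a \<Rightarrow> real \<Rightarrow> real"
  where "dir_quot F v x h = (F (x + h *\<^sub>R v) - F x) / h"

definition dir_diff :: "('a::real_normed_vector \<Rightarrow> real) \<Rightarrow> 'a \<Rightarrow> 'a \<Rightarrow> bool"
  where "dir_diff F v x \<longleftrightarrow> (\<exists>l. (dir_quot F v x \<longlongrightarrow> l) (at 0))"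

text \<open>The limit along a single sequence is Borel measurable on the whole space when
  \<open>F\<close> is continuous, and it is the true derivative wherever \<open>dir_diff\<close>
  holds.\<close>

definition dir_deriv :: "('a::real_normed_vector \<Rightarrow> real) \<Rightarrow> 'a \<Rightarrow> 'a \<Rightarrow> real"
  where "dir_deriv F v x = lim (\<lambda>n. dir_quot F v x (inverse (real (Suc n))))"

lemma dir_derivI:
  assumes "(dir_quot F v x \<longlongrightarrow> l) (at 0)"
  shows "dir_deriv F v x = l"
proof -
  have "filterlim (\<lambda>n. inverse (real (Suc n))) (at 0) sequentially"
    using LIMSEQ_inverse_real_of_nat by (simp add: filterlim_at)
  then have "(\<lambda>n. dir_quot F v x (inverse (real (Suc n)))) \<longlonglongrightarrow> l"
    using assms filterlim_compose by blast
  then show ?thesis unfolding dir_deriv_def by (rule limI)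
qed

lemma dir_deriv_tendsto:
  assumes "dir_diff F v x"
  shows "(dir_quot F v x \<longlongrightarrow> dir_deriv F v x) (at 0)"
  using assms dir_derivI unfolding dir_diff_def by metis

text \<open>The outer quantifiers are countable, and for continuous \<open>F\<close> the inner
  condition is closed in \<open>x\<close>, even after intersecting over all real \<open>s\<close>
  and \<open>t\<close>. This is what makes the set of points of differentiability in direction
  \<open>v\<close> Borel.\<close>

lemma dir_diff_iff_Cauchy:
  "dir_diff F v x \<longleftrightarrow> (\<forall>k. \<exists>n. \<forall>s t. s \<noteq> 0 \<longrightarrow> \<bar>s\<bar> < inverse (real (Suc n)) \<longrightarrow> t \<noteq> 0 \<longrightarrow> \<bar>t\<bar> < inverse (real (Suc n)) \<longrightarrow>
     \<bar>dir_quot F v x s - dir_quot F v x t\<bar> \<le> inverse (real (Suc k)))" (is "_ \<longleftrightarrow> ?C")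
proof
  assume "dir_diff F v x"
  then obtain l where l: "(dir_quot F v x \<longlongrightarrow> l) (at 0)" unfolding dir_diff_def by blast
  show ?C
  proof
    fix k
    have "\<forall>\<^sub>F h in at 0. dist (dir_quot F v x h) l < inverse (real (Suc k)) / 2"
      using l by (intro tendstoD) auto
    then obtain d where d: "d > 0" "\<And>h. h \<noteq> 0 \<Longrightarrow> \<bar>h\<bar> < d \<Longrightarrow> \<bar>dir_quot F v x h - l\<bar> < inverse (real (Suc k)) / 2"
      unfolding eventually_at by (auto simp: dist_real_def)
    obtain n where n: "inverse (real (Suc n)) < d" using reals_Archimedean[OF d(1)] by blast
    show "\<exists>n. \<forall>s t. s \<noteq> 0 \<longrightarrow> \<bar>s\<bar> < inverse (real (Suc n)) \<longrightarrow> t \<noteq> 0 \<longrightarrow> \<bar>t\<bar> < inverse (real (Suc n)) \<longrightarrow>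
     \<bar>dir_quot F v x s - dir_quot F v x t\<bar> \<le> inverse (real (Suc k))"
    proof (intro exI[of _ n] allI impI)
      fix s t assume st: "s \<noteq> 0" "\<bar>s\<bar> < inverse (real (Suc n))" "t \<noteq> 0" "\<bar>t\<bar> < inverse (real (Suc n))"
      show "\<bar>dir_quot F v x s - dir_quot F v x t\<bar> \<le> inverse (real (Suc k))"
        using d(2)[of s] d(2)[of t] st n by linarith
    qed
  qed
next
  assume C: ?C
  let ?q = "dir_quot F v x" and ?i = "\<lambda>n. inverse (real (Suc n))"
  have mono: "?i m \<le> ?i n" if "n \<le> m" for m n using that by simp
  have sm: "\<exists>k. ?i k < e" if "e > 0" for e using reals_Archimedean[OF that] by blast
  have ip: "?i m \<noteq> 0" "\<bar>?i m\<bar> = ?i m" for m by auto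
  have "Cauchy (\<lambda>n. ?q (?i n))"
  proof (rule metric_CauchyI)
    fix e :: real assume "e > 0"
    then obtain k where k: "?i k < e" using sm by blast
    obtain n where n: "\<And>s t. \<lbrakk>s \<noteq> 0; \<bar>s\<bar> < ?i n; t \<noteq> 0; \<bar>t\<bar> < ?i n\<rbrakk> \<Longrightarrow> \<bar>?q s - ?q t\<bar> \<le> ?i k"
      using C by metis
    show "\<exists>M. \<forall>m\<ge>M. \<forall>n\<ge>M. dist (?q (?i m)) (?q (?i n)) < e"
    proof (intro exI[of _ "Suc n"] allI impI)
      fix m m' assume "m \<ge> Suc n" "m' \<ge> Suc n"
      then have "?i m < ?i n" "?i m' < ?i n" by auto
      then have "\<bar>?q (?i m) - ?q (?i m')\<bar> \<le> ?i k" by (intro n) auto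
      then show "dist (?q (?i m)) (?q (?i m')) < e" using k by (simp add: dist_real_def)
    qed
  qed
  then obtain l where l: "(\<lambda>n. ?q (?i n)) \<longlonglongrightarrow> l" using Cauchy_convergent convergent_def by blast
  have "(?q \<longlongrightarrow> l) (at 0)"
  proof (rule tendstoI)
    fix e :: real assume "e > 0"
    then obtain k where k: "?i k < e/2" using sm[of "e/2"] by auto
    obtain n where n: "\<And>s t. \<lbrakk>s \<noteq> 0; \<bar>s\<bar> < ?i n; t \<noteq> 0; \<bar>t\<bar> < ?i n\<rbrakk> \<Longrightarrow> \<bar>?q s - ?q t\<bar> \<le> ?i k"
      using C by metis
    have "\<forall>\<^sub>F m in sequentially. dist (?q (?i m)) l < e/2" using l \<open>e > 0\<close> by (intro tendstoD) auto
    then obtain N where N: "\<And>m. m \<ge> N \<Longrightarrow> dist (?q (?i m)) l < e/2" unfolding eventually_sequentially by blast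
    define m where "m = max N (Suc n)"
    have m: "?i m < ?i n" unfolding m_def by auto
    have "dist (?q s) l < e" if "s \<noteq> 0" "\<bar>s\<bar> < ?i n" for s
    proof -
      have "\<bar>?q s - ?q (?i m)\<bar> \<le> ?i k" using that m by (intro n) auto
      moreover have "dist (?q (?i m)) l < e/2" by (rule N) (simp add: m_def)
      ultimately show ?thesis using k unfolding dist_real_def by linarith
    qed
    then show "\<forall>\<^sub>F s in at 0. dist (?q s) l < e"
      unfolding eventually_at by (intro exI[of _ "?i n"]) (auto simp: dist_real_def)
  qed
  then show "dir_diff F v x" unfolding dir_diff_def by blast
qed

lemma dir_diff_borel:
  fixes F :: "'a::euclidean_space \<Rightarrow> real"
  assumes F: "continuous_on UNIV F"
  shows "{x. dir_diff F v x} \<in> sets borel"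
proof -
  let ?i = "\<lambda>n. inverse (real (Suc n))"
  let ?H = "\<lambda>n. {s. s \<noteq> 0 \<and> \<bar>s\<bar> < ?i n}"
  have "{x. dir_diff F v x} = (\<Inter>k. \<Union>n. \<Inter>s\<in>?H n. \<Inter>t\<in>?H n. {x. \<bar>dir_quot F v x s - dir_quot F v x t\<bar> \<le> ?i k})"
    unfolding dir_diff_iff_Cauchy by (simp add: set_eq_iff imp_conjL del: of_nat_Suc)
  moreover have "closed {x. \<bar>dir_quot F v x s - dir_quot F v x t\<bar> \<le> ?i k}" for s t k
    unfolding dir_quot_def divide_inverse
    by (intro closed_Collect_le continuous_intros continuous_on_compose2[OF F]) auto
  then have "closed (\<Inter>s\<in>?H n. \<Inter>t\<in>?H n. {x. \<bar>dir_quot F v x s - dir_quot F v x t\<bar> \<le> ?i k})" for n k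
    by (intro closed_INT) auto
  ultimately show ?thesis
    by (simp only:) (intro sets.countable_INT sets.countable_UN borel_closed; auto)
qed

lemma AE_dir_diff:
  fixes F :: "'a::euclidean_space \<Rightarrow> real"
  assumes lip: "L-lipschitz_on UNIV F"
  shows "AE x in lborel. dir_diff F v x"
proof -
  have cF: "continuous_on UNIV F" using lip lipschitz_on_continuous_on by blast
  have "AE x in lborel. x \<in> {x. dir_diff F v x}"
  proof (rule AE_lborel_slices[OF dir_diff_borel[OF cF], where c = "\<lambda>t::real. t *\<^sub>R v"])
    fix x
    have "(L * norm v)-lipschitz_on UNIV (\<lambda>t. F (x + t *\<^sub>R v))"
    proof (rule lipschitz_onI)
      fix s t :: real
      have "dist (F (x + s *\<^sub>R v)) (F (x + t *\<^sub>R v)) \<le> L * dist (x + s *\<^sub>R v) (x + t *\<^sub>R v)"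
        using lipschitz_onD[OF lip] by blast
      also have "dist (x + s *\<^sub>R v) (x + t *\<^sub>R v) = norm v * dist s t"
        by (simp add: dist_norm flip: scaleR_diff_left)
      finally show "dist (F (x + s *\<^sub>R v)) (F (x + t *\<^sub>R v)) \<le> L * norm v * dist s t"
        by (simp add: mult.assoc)
    qed (use lipschitz_on_nonneg[OF lip] in auto)
    from negligible_lipschitz_not_differentiable_real[OF this]
    show "AE t in lborel. x + t *\<^sub>R v \<in> {x. dir_diff F v x}"
      unfolding AE_lborel_iff_negligible dir_diff_def dir_quot_def
      by (simp add: algebra_simps)
  qed (intro continuous_intros)
  then show ?thesis by simp
qed

lemma dir_quot_bound:
  assumes lip: "L-lipschitz_on UNIV F"
  shows "\<bar>dir_quot F v x h\<bar> \<le> L * norm v"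
proof (cases "h = 0")
  case False
  have "\<bar>F (x + h *\<^sub>R v) - F x\<bar> \<le> L * (\<bar>h\<bar> * norm v)"
    using lipschitz_onD[OF lip, of "x + h *\<^sub>R v" x] by (simp add: dist_norm)
  then show ?thesis using False by (simp add: dir_quot_def divide_le_eq algebra_simps)
qed (use lipschitz_on_nonneg[OF lip] in \<open>simp add: dir_quot_def\<close>)

lemma dir_deriv_bound:
  assumes lip: "L-lipschitz_on UNIV F" and d: "dir_diff F v x"
  shows "\<bar>dir_deriv F v x\<bar> \<le> L * norm v"
  by (rule tendsto_upperbound[OF tendsto_rabs[OF dir_deriv_tendsto[OF d]]])
    (auto intro!: always_eventually dir_quot_bound[OF lip])

lemma dir_deriv_scale:
  assumes d: "dir_diff F v x"
  shows "dir_deriv F (c *\<^sub>R v) x = c * dir_deriv F v x"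
proof (cases "c = 0")
  case True
  have "dir_quot F 0 x = (\<lambda>_. 0)" by (auto simp: dir_quot_def)
  then show ?thesis using True dir_derivI[of F 0 x 0] by simp
next
  case False
  have "filterlim (\<lambda>h. h * c) (at 0) (at 0)"
    using False by (auto simp: filterlim_at eventually_at_filter intro!: tendsto_eq_intros)
  then have "((\<lambda>h. c * dir_quot F v x (h * c)) \<longlongrightarrow> c * dir_deriv F v x) (at 0)"
    by (intro tendsto_mult tendsto_const filterlim_compose[OF dir_deriv_tendsto[OF d]])
  moreover have "(\<lambda>h. c * dir_quot F v x (h * c)) = dir_quot F (c *\<^sub>R v) x"
    using False by (auto simp: dir_quot_def)
  ultimately show ?thesis using dir_derivI by metis
qed

text \<open>\<open>h = 1 + G / (C + 1)\<close> is a non-negative density. Since the box integrals of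
  \<open>G\<close> vanish, it gives every box its Lebesgue measure; hence the measure with density
  \<open>h\<close> is Lebesgue measure and \<open>h\<close> is 1 almost everywhere.\<close>

lemma AE_zero_if_box_integrals_zero:
  fixes G :: "'a::euclidean_space \<Rightarrow> real"
  assumes G[measurable]: "G \<in> borel_measurable borel" and bd: "\<And>x. \<bar>G x\<bar> \<le> C"
    and int0: "\<And>l u. (\<integral>x. indicator (box l u) x * G x \<partial>lborel) = 0"
  shows "AE x in lborel. G x = 0"
proof -
  have C0: "C \<ge> 0" using bd[of 0] by linarith
  define h where "h x = 1 + G x / (C + 1)" for x
  have [measurable]: "h \<in> borel_measurable borel" unfolding h_def by measurable
  have h: "0 \<le> h x" "h x \<le> 2" for x
  proof -
    have "\<bar>G x / (C + 1)\<bar> \<le> 1" using bd[of x] C0 by simp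
    then show "0 \<le> h x" "h x \<le> 2" unfolding h_def by linarith+
  qed
  have int_bd: "integrable lborel (\<lambda>x. indicator (box l u) x * k x)"
    if [measurable]: "k \<in> borel_measurable borel" and "\<And>x. \<bar>k x\<bar> \<le> D" for l u and k :: "'a \<Rightarrow> real" and D
  proof (rule Bochner_Integration.integrable_bound)
    show "integrable lborel (\<lambda>x. indicator (box l u) x * D :: real)"
      using emeasure_lborel_box_finite[of l u] by (intro integrable_mult_left) simp
    show "AE x in lborel. norm (indicator (box l u) x * k x) \<le> norm (indicator (box l u) x * D)"
      using order_trans[OF that(2) abs_ge_self] by (intro AE_I2) (auto simp: indicator_def)
  qed measurable
  have "lborel = density lborel h"
  proof (rule lborel_eqI)
    fix l u :: 'a assume lu: "\<And>b. b \<in> Basis \<Longrightarrow> l \<bullet> b \<le> u \<bullet> b"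
    have "emeasure (density lborel h) (box l u) = (\<integral>\<^sup>+x. ennreal (indicator (box l u) x * h x) \<partial>lborel)"
      by (subst emeasure_density) (auto intro!: nn_integral_cong simp: indicator_def)
    also have "\<dots> = ennreal (\<integral>x. indicator (box l u) x * h x \<partial>lborel)"
      using h by (intro nn_integral_eq_integral int_bd[where D = 2]) auto
    also have "(\<integral>x. indicator (box l u) x * h x \<partial>lborel)
        = (\<integral>x. indicator (box l u) x * 1 \<partial>lborel) + (\<integral>x. indicator (box l u) x * G x / (C + 1) \<partial>lborel)"
    proof -
      have "(\<integral>x. indicator (box l u) x * h x \<partial>lborel)
        = (\<integral>x. indicator (box l u) x * 1 + indicator (box l u) x * G x / (C + 1) \<partial>lborel)"
        by (simp add: h_def distrib_left)
      also have "\<dots> = (\<integral>x. indicator (box l u) x * 1 \<partial>lborel) + (\<integral>x. indicator (box l u) x * G x / (C + 1) \<partial>lborel)"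
        using bd by (intro Bochner_Integration.integral_add integrable_divide_zero int_bd[where D = 1] int_bd[where D = C]) auto
      finally show ?thesis .
    qed
    also have "\<dots> = measure lborel (box l u)"
      using int0 by simp
    also have "ennreal \<dots> = emeasure lborel (box l u)"
      using emeasure_lborel_box_finite[of l u] by (simp add: emeasure_eq_ennreal_measure)
    finally show "emeasure (density lborel h) (box l u) = (\<Prod>b\<in>Basis. (u - l) \<bullet> b)"
      using lu by simp
  qed simp
  then have "density lborel (\<lambda>_. 1) = density lborel (\<lambda>x. ennreal (h x))" by (simp add: density_1)
  then have "AE x in lborel. 1 = ennreal (h x)"
    by (subst (asm) sigma_finite_measure.density_unique_iff[OF sigma_finite_lborel]) auto
  then show ?thesis
  proof eventually_elim
    case (elim x)
    then have "h x = 1" using h by (metis ennreal_1 ennreal_inj zero_le_one)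
    then show ?case using C0 by (simp add: h_def)
  qed
qed

lemma dir_deriv_borel:
  fixes F :: "'a::euclidean_space \<Rightarrow> real"
  assumes F: "continuous_on UNIV F"
  shows "dir_deriv F v \<in> borel_measurable borel"
proof -
  have "(\<lambda>x. dir_quot F v x h) \<in> borel_measurable borel" for h
    unfolding dir_quot_def divide_inverse
    by (intro borel_measurable_continuous_onI continuous_intros continuous_on_compose2[OF F]) auto
  then show ?thesis unfolding dir_deriv_def[abs_def] by measurable
qed

text \<open>The quotient in direction \<open>v + w\<close> at \<open>x\<close> with step
  \<open>h\<close> is the one in direction \<open>v\<close> at \<open>x + h w\<close> plus the one
  in direction \<open>w\<close> at \<open>x\<close>. Translation invariance moves the shift from the
  quotient to the box, where dominated convergence removes it, the frontier of a box being
  null.\<close>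

lemma box_integral_dir_deriv_add:
  fixes F :: "'a::euclidean_space \<Rightarrow> real"
  assumes lip: "L-lipschitz_on UNIV F"
  shows "(\<integral>x. indicator (box l u) x * dir_deriv F (v + w) x \<partial>lborel) =
         (\<integral>x. indicator (box l u) x * dir_deriv F v x \<partial>lborel) + (\<integral>x. indicator (box l u) x * dir_deriv F w x \<partial>lborel)"
proof -
  have cF: "continuous_on UNIV F" using lip lipschitz_on_continuous_on by blast
  have L0: "L \<ge> 0" using lip lipschitz_on_nonneg by blast
  let ?i = "\<lambda>n. inverse (real (Suc n))"
  let ?I = "indicator (box l u) :: 'a \<Rightarrow> real"
  have i0: "?i \<longlonglongrightarrow> 0" by (rule LIMSEQ_inverse_real_of_nat)
  have i1: "\<bar>?i n\<bar> \<le> 1" for n by (simp add: inverse_le_1_iff)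
  have qm[measurable]: "(\<lambda>x. dir_quot F z x h) \<in> borel_measurable borel" for z h
    unfolding dir_quot_def divide_inverse
    by (intro borel_measurable_continuous_onI continuous_intros continuous_on_compose2[OF cF]) auto
  note [measurable] = dir_deriv_borel[OF cF]
  obtain R where R: "box l u \<subseteq> cball 0 R"
  proof -
    obtain R where "\<And>x. x \<in> box l u \<Longrightarrow> norm x \<le> R" using bounded_box[of l u] unfolding bounded_iff by blast
    then show ?thesis by (intro that[of R]) auto
  qed
  have lim: "AE x in lborel. (\<lambda>n. dir_quot F z x (?i n)) \<longlonglongrightarrow> dir_deriv F z x" for z
    using AE_dir_diff[OF lip, of z]
  proof eventually_elim
    case (elim x)
    have "filterlim ?i (at 0) sequentially" using i0 by (simp add: filterlim_at)
    then show ?case using dir_deriv_tendsto[OF elim] filterlim_compose by blast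
  qed
  have dom: "integrable lborel (\<lambda>x::'a. indicator (cball 0 r) x * D :: real)" for r D
    using emeasure_lborel_cball_finite[of "0 :: 'a" r]
    by (intro integrable_mult_left integrable_real_indicator) auto
  \<comment> \<open>The vector \<open>y\<close> covers both uses: \<open>y = w\<close> for the
    shifted box and \<open>y = 0\<close> for the fixed one.\<close>
  have A: "(\<lambda>n. \<integral>x. ?I (x - ?i n *\<^sub>R y) * dir_quot F z x (?i n) \<partial>lborel) \<longlonglongrightarrow> (\<integral>x. ?I x * dir_deriv F z x \<partial>lborel)" for y z
  proof (rule integral_dominated_convergence[where w = "\<lambda>x. indicator (cball 0 (R + norm y)) x * (L * norm z)"])
    have fr: "AE x in lborel. x \<notin> frontier (box l u)"
      by (simp add: AE_lborel_iff_negligible negligible_convex_frontier)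
    show "AE x in lborel. (\<lambda>n. ?I (x - ?i n *\<^sub>R y) * dir_quot F z x (?i n)) \<longlonglongrightarrow> ?I x * dir_deriv F z x"
      using lim[of z] fr
    proof eventually_elim
      case (elim x)
      have t: "(\<lambda>n. x - ?i n *\<^sub>R y) \<longlonglongrightarrow> x"
        using tendsto_diff[OF tendsto_const[of x] tendsto_scaleR[OF i0 tendsto_const[of y]]] by simp
      have "(\<lambda>n. ?I (x - ?i n *\<^sub>R y)) \<longlonglongrightarrow> ?I x"
      proof (cases "x \<in> box l u")
        case True
        have "\<forall>\<^sub>F n in sequentially. x - ?i n *\<^sub>R y \<in> box l u"
          using topological_tendstoD[OF t open_box True] .
        then show ?thesis
          by (intro tendsto_eventually) (auto elim!: eventually_mono simp: True)
      next
        case False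
        then have "x \<in> - closure (box l u)" using elim(2) interior_open[OF open_box, of l u] by (simp add: frontier_def)
        then have "\<forall>\<^sub>F n in sequentially. x - ?i n *\<^sub>R y \<in> - closure (box l u)"
          using topological_tendstoD[OF t] by blast
        then have "\<forall>\<^sub>F n in sequentially. x - ?i n *\<^sub>R y \<notin> box l u"
          by eventually_elim (use closure_subset in blast)
        then show ?thesis
          by (intro tendsto_eventually) (auto elim!: eventually_mono simp: False)
      qed
      then show ?case using elim(1) by (intro tendsto_mult)
    qed
    show "AE x in lborel. norm (?I (x - ?i n *\<^sub>R y) * dir_quot F z x (?i n)) \<le> indicator (cball 0 (R + norm y)) x * (L * norm z)" for n
    proof (intro AE_I2)
      fix x
      have "x \<in> cball 0 (R + norm y)" if "x - ?i n *\<^sub>R y \<in> box l u"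
      proof -
        have "norm (x - ?i n *\<^sub>R y) \<le> R" using that R by auto
        moreover have "norm (?i n *\<^sub>R y) \<le> norm y" using mult_right_mono[OF i1[of n] norm_ge_zero[of y]] by simp
        ultimately show ?thesis using norm_triangle_ineq[of "x - ?i n *\<^sub>R y" "?i n *\<^sub>R y"] by simp
      qed
      then show "norm (?I (x - ?i n *\<^sub>R y) * dir_quot F z x (?i n)) \<le> indicator (cball 0 (R + norm y)) x * (L * norm z)"
        using dir_quot_bound[OF lip, of z x "?i n"] L0 by (auto simp: indicator_def)
    qed
    have [measurable]: "box l u \<in> sets borel" by simp
    show "(\<lambda>x. ?I (x - ?i n *\<^sub>R y) * dir_quot F z x (?i n)) \<in> borel_measurable lborel" for n by measurable
    show "(\<lambda>x. ?I x * dir_deriv F z x) \<in> borel_measurable lborel" by measurable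
  qed (rule dom)
  have split: "(\<integral>x. ?I x * dir_quot F (v + w) x (?i n) \<partial>lborel) =
      (\<integral>x. ?I (x - ?i n *\<^sub>R w) * dir_quot F v x (?i n) \<partial>lborel) + (\<integral>x. ?I x * dir_quot F w x (?i n) \<partial>lborel)" for n
  proof -
    have ig: "integrable lborel (\<lambda>x. ?I x * dir_quot F z (x + c) (?i n))" for z c
    proof (rule Bochner_Integration.integrable_bound[OF dom[of R "L * norm z"]])
      have [measurable]: "(\<lambda>x. dir_quot F z (x + c) (?i n)) \<in> borel_measurable borel"
        unfolding dir_quot_def divide_inverse
        by (intro borel_measurable_continuous_onI continuous_intros continuous_on_compose2[OF cF]) auto
      show "(\<lambda>x. ?I x * dir_quot F z (x + c) (?i n)) \<in> borel_measurable lborel" by measurable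
      show "AE x in lborel. norm (?I x * dir_quot F z (x + c) (?i n)) \<le> norm (indicator (cball 0 R) x * (L * norm z))"
        using dir_quot_bound[OF lip] R L0 by (intro AE_I2) (auto simp: indicator_def)
    qed
    have "(\<integral>x. ?I x * dir_quot F (v + w) x (?i n) \<partial>lborel) =
      (\<integral>x. ?I x * dir_quot F v (x + ?i n *\<^sub>R w) (?i n) + ?I x * dir_quot F w (x + 0) (?i n) \<partial>lborel)"
      by (intro Bochner_Integration.integral_cong refl)
        (simp add: dir_quot_def distrib_left[symmetric] add_divide_distrib[symmetric] scaleR_add_right add_ac)
    also have "\<dots> = (\<integral>x. ?I x * dir_quot F v (x + ?i n *\<^sub>R w) (?i n) \<partial>lborel) + (\<integral>x. ?I x * dir_quot F w (x + 0) (?i n) \<partial>lborel)"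
      by (intro Bochner_Integration.integral_add ig)
    also have "(\<integral>x. ?I x * dir_quot F v (x + ?i n *\<^sub>R w) (?i n) \<partial>lborel) = (\<integral>x. ?I (x - ?i n *\<^sub>R w) * dir_quot F v x (?i n) \<partial>lborel)"
    proof -
      let ?c = "?i n *\<^sub>R w"
      have "(\<integral>x. ?I (x - ?c) * dir_quot F v x (?i n) \<partial>lborel) = (\<integral>x. ?I (x - ?c) * dir_quot F v x (?i n) \<partial>distr lborel borel ((+) ?c))"
        by (simp add: lborel_distr_plus)
      also have "\<dots> = (\<integral>x. ?I x * dir_quot F v (x + ?c) (?i n) \<partial>lborel)"
        by (subst integral_distr) (simp_all add: add.commute)
      finally show ?thesis by simp
    qed
    finally show ?thesis by simp
  qed
  have "(\<lambda>n. \<integral>x. ?I x * dir_quot F (v + w) x (?i n) \<partial>lborel) \<longlonglongrightarrow>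
      (\<integral>x. ?I x * dir_deriv F v x \<partial>lborel) + (\<integral>x. ?I x * dir_deriv F w x \<partial>lborel)"
    unfolding split using A[of 0 w] by (intro tendsto_add A) simp
  moreover have "(\<lambda>n. \<integral>x. ?I x * dir_quot F (v + w) x (?i n) \<partial>lborel) \<longlonglongrightarrow> (\<integral>x. ?I x * dir_deriv F (v + w) x \<partial>lborel)"
    using A[of 0 "v + w"] by simp
  ultimately show ?thesis using LIMSEQ_unique by blast
qed

lemma AE_dir_deriv_add:
  fixes F :: "'a::euclidean_space \<Rightarrow> real"
  assumes lip: "L-lipschitz_on UNIV F"
  shows "AE x in lborel. dir_deriv F (v + w) x = dir_deriv F v x + dir_deriv F w x"
proof -
  have cF: "continuous_on UNIV F" using lip lipschitz_on_continuous_on by blast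
  have L0: "L \<ge> 0" using lip lipschitz_on_nonneg by blast
  \<comment> \<open>Where \<open>F\<close> is not differentiable in the direction, nothing bounds
    \<open>dir_deriv\<close>. Setting it to 0 there gives a function that is bounded everywhere and
    has the same integrals.\<close>
  define D where "D z x = (if dir_diff F z x then dir_deriv F z x else 0)" for z x
  have AED: "AE x in lborel. D z x = dir_deriv F z x" for z
    using AE_dir_diff[OF lip, of z] by eventually_elim (simp add: D_def)
  have bD: "\<bar>D z x\<bar> \<le> L * norm z" for z x
    using dir_deriv_bound[OF lip, of z x] L0 by (simp add: D_def)
  note [measurable] = dir_deriv_borel[OF cF]
  have [measurable]: "Measurable.pred borel (dir_diff F z)" for z
    using dir_diff_borel[OF cF, of z] by (simp add: pred_def)
  have [measurable]: "D z \<in> borel_measurable borel" for z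
    unfolding D_def[abs_def] by measurable
  define G where "G x = D (v + w) x - (D v x + D w x)" for x
  have "AE x in lborel. G x = 0"
  proof (rule AE_zero_if_box_integrals_zero[where C = "L * norm (v + w) + (L * norm v + L * norm w)"])
    show "G \<in> borel_measurable borel" unfolding G_def[abs_def] by measurable
    show "\<bar>G x\<bar> \<le> L * norm (v + w) + (L * norm v + L * norm w)" for x
      unfolding G_def using bD[of "v + w" x] bD[of v x] bD[of w x] by linarith
    fix l u :: 'a
    let ?I = "indicator (box l u) :: 'a \<Rightarrow> real"
    have eq: "(\<integral>x. ?I x * D z x \<partial>lborel) = (\<integral>x. ?I x * dir_deriv F z x \<partial>lborel)" for z
      using AED[of z] by (intro integral_cong_AE) (auto elim: eventually_mono)
    have ig: "integrable lborel (\<lambda>x. ?I x * D z x)" for z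
    proof (rule Bochner_Integration.integrable_bound)
      show "integrable lborel (\<lambda>x. ?I x * (L * norm z))"
        using emeasure_lborel_box_finite[of l u] by (intro integrable_mult_left) simp
      show "AE x in lborel. norm (?I x * D z x) \<le> norm (?I x * (L * norm z))"
        using bD L0 by (intro AE_I2) (auto simp: indicator_def)
    qed measurable
    have "(\<integral>x. ?I x * G x \<partial>lborel) = (\<integral>x. ?I x * D (v + w) x - (?I x * D v x + ?I x * D w x) \<partial>lborel)"
      by (simp add: G_def algebra_simps)
    also have "\<dots> = (\<integral>x. ?I x * D (v + w) x \<partial>lborel) - ((\<integral>x. ?I x * D v x \<partial>lborel) + (\<integral>x. ?I x * D w x \<partial>lborel))"
      using ig by simp
    also have "\<dots> = 0" unfolding eq box_integral_dir_deriv_add[OF lip] by simp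
    finally show "(\<integral>x. ?I x * G x \<partial>lborel) = 0" .
  qed
  then show ?thesis
    using AED[of "v + w"] AED[of v] AED[of w] by eventually_elim (simp add: G_def)
qed

lemma AE_dir_deriv_sum:
  fixes F :: "'a::euclidean_space \<Rightarrow> real"
  assumes lip: "L-lipschitz_on UNIV F" and I: "finite I"
  shows "AE x in lborel. dir_deriv F (\<Sum>b\<in>I. c b *\<^sub>R b) x = (\<Sum>b\<in>I. c b * dir_deriv F b x)"
  using I
proof (induction I rule: finite_induct)
  case empty
  have "dir_quot F 0 x = (\<lambda>_. 0)" for x by (auto simp: dir_quot_def)
  then show ?case using dir_derivI[of F 0 _ 0] by simp
next
  case (insert b I)
  show ?case
    using insert.IH AE_dir_deriv_add[OF lip, of "c b *\<^sub>R b" "\<Sum>b\<in>I. c b *\<^sub>R b"] AE_dir_diff[OF lip, of b]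
    by eventually_elim (use insert.hyps in \<open>simp add: dir_deriv_scale\<close>)
qed

text \<open>By compactness of the unit sphere, finitely many directions of \<open>Q\<close> come
  close to all unit vectors. The quotients in these directions converge uniformly, and the Lipschitz
  bound carries the estimate over to the remaining directions.\<close>

lemma has_derivative_if_dense_directions:
  fixes F :: "'a::euclidean_space \<Rightarrow> real"
  assumes lip: "L-lipschitz_on UNIV F" and Q: "\<And>U. \<lbrakk>open U; U \<noteq> {}\<rbrakk> \<Longrightarrow> \<exists>v\<in>Q. v \<in> U"
    and d: "\<And>v. v \<in> Q \<Longrightarrow> (dir_quot F v x \<longlongrightarrow> w \<bullet> v) (at 0)"
  shows "(F has_derivative (\<lambda>h. w \<bullet> h)) (at x)"
  unfolding has_derivative_at_alt
proof (intro conjI allI impI)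
  show "bounded_linear ((\<bullet>) w)" by (rule bounded_linear_inner_right)
  fix e :: real assume e: "e > 0"
  have L0: "L \<ge> 0" using lip lipschitz_on_nonneg by blast
  \<comment> \<open>Three errors, each a multiple of \<epsilon> times the distance, are added:
    \<open>L\<close> for moving the argument of \<open>F\<close>, 1 for the quotient, and
    \<open>norm w\<close> for the linear form.\<close>
  define \<epsilon> where "\<epsilon> = e / (L + 1 + norm w)"
  have den: "L + 1 + norm w > 0" using L0 by (smt (verit) norm_ge_zero)
  have \<epsilon>: "\<epsilon> > 0" using e den by (simp add: \<epsilon>_def)
  have "sphere 0 1 \<subseteq> (\<Union>v\<in>Q. ball v \<epsilon>)"
  proof
    fix z :: 'a
    obtain v where "v \<in> Q" "v \<in> ball z \<epsilon>" using Q[of "ball z \<epsilon>"] \<epsilon> by auto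
    then show "z \<in> (\<Union>v\<in>Q. ball v \<epsilon>)" by (auto simp: dist_commute)
  qed
  then obtain T where T: "T \<subseteq> Q" "finite T" "sphere 0 1 \<subseteq> (\<Union>v\<in>T. ball v \<epsilon>)"
    using compactE_image[OF compact_sphere[of "0::'a" 1], of Q "\<lambda>v. ball v \<epsilon>"] by auto
  have "\<forall>\<^sub>F h in at 0. \<forall>v\<in>T. dist (dir_quot F v x h) (w \<bullet> v) < \<epsilon>"
    using T(1,2) d \<epsilon> by (intro eventually_ball_finite) (auto intro: tendstoD)
  then obtain \<delta> where \<delta>: "\<delta> > 0"
      "\<And>h v. h \<noteq> 0 \<Longrightarrow> \<bar>h\<bar> < \<delta> \<Longrightarrow> v \<in> T \<Longrightarrow> \<bar>dir_quot F v x h - w \<bullet> v\<bar> < \<epsilon>"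
    unfolding eventually_at by (auto simp: dist_real_def)
  show "\<exists>\<delta>>0. \<forall>y. norm (y - x) < \<delta> \<longrightarrow> norm (F y - F x - w \<bullet> (y - x)) \<le> e * norm (y - x)"
  proof (intro exI[of _ \<delta>] conjI allI impI \<delta>)
    fix y assume y: "norm (y - x) < \<delta>"
    show "norm (F y - F x - w \<bullet> (y - x)) \<le> e * norm (y - x)"
    proof (cases "y = x")
      case False
      define t where "t = norm (y - x)"
      have t: "t > 0" "t < \<delta>" using False y by (auto simp: t_def)
      define z where "z = (y - x) /\<^sub>R t"
      have z: "z \<in> sphere 0 1" "y = x + t *\<^sub>R z" using t by (auto simp: z_def t_def)
      then obtain v where v: "v \<in> T" "z \<in> ball v \<epsilon>" using T(3) by blast
      then have vz: "norm (z - v) \<le> \<epsilon>" by (simp add: dist_norm norm_minus_commute)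
      have 1: "\<bar>F y - F (x + t *\<^sub>R v)\<bar> \<le> L * (t * \<epsilon>)"
      proof -
        have "\<bar>F y - F (x + t *\<^sub>R v)\<bar> \<le> L * norm (y - (x + t *\<^sub>R v))"
          using lipschitz_on_normD[OF lip, of y "x + t *\<^sub>R v"] by simp
        also have "norm (y - (x + t *\<^sub>R v)) = t * norm (z - v)"
          using t z by (simp flip: scaleR_diff_right)
        finally show ?thesis using L0 t vz by (smt (verit) mult_left_mono)
      qed
      have 2: "\<bar>F (x + t *\<^sub>R v) - F x - t * (w \<bullet> v)\<bar> \<le> t * \<epsilon>"
      proof -
        have "F (x + t *\<^sub>R v) - F x - t * (w \<bullet> v) = t * (dir_quot F v x t - w \<bullet> v)"
          using t by (simp add: dir_quot_def field_simps)
        then show ?thesis using \<delta>(2)[of t v] t v by (simp add: abs_mult)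
      qed
      have 3: "\<bar>t * (w \<bullet> v) - w \<bullet> (y - x)\<bar> \<le> norm w * (t * \<epsilon>)"
      proof -
        have "t * (w \<bullet> v) - w \<bullet> (y - x) = t * (w \<bullet> (v - z))" using z by (simp add: inner_diff_right algebra_simps)
        moreover have "\<bar>w \<bullet> (v - z)\<bar> \<le> norm w * \<epsilon>"
          using Cauchy_Schwarz_ineq2[of w "v - z"] vz by (smt (verit) mult_left_mono norm_ge_zero norm_minus_commute)
        ultimately show ?thesis using t by (simp add: abs_mult)
      qed
      have "\<bar>F y - F x - w \<bullet> (y - x)\<bar> \<le> L * (t * \<epsilon>) + t * \<epsilon> + norm w * (t * \<epsilon>)"
        using 1 2 3 by linarith
      also have "\<dots> = (L + 1 + norm w) * \<epsilon> * t" by (simp add: algebra_simps)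
      also have "\<dots> = e * t" using den by (simp add: \<epsilon>_def)
      finally show ?thesis by (simp add: t_def)
    qed simp
  qed
qed

theorem Rademacher_real:
  fixes F :: "'a::euclidean_space \<Rightarrow> real"
  assumes lip: "L-lipschitz_on UNIV F"
  shows "AE x in lborel. F differentiable (at x)"
proof -
  \<comment> \<open>Only countably many directions are considered, so that the exceptional null sets
    still have a null union.\<close>
  obtain Q :: "'a set" where Q: "countable Q" "\<And>U. \<lbrakk>open U; U \<noteq> {}\<rbrakk> \<Longrightarrow> \<exists>v\<in>Q. v \<in> U"
    by (rule countable_dense_setE) blast
  have "AE x in lborel. \<forall>v\<in>Q. dir_diff F v x \<and> dir_deriv F v x = (\<Sum>b\<in>Basis. (v \<bullet> b) * dir_deriv F b x)"
    unfolding AE_ball_countable[OF Q(1)]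
  proof
    fix v assume "v \<in> Q"
    show "AE x in lborel. dir_diff F v x \<and> dir_deriv F v x = (\<Sum>b\<in>Basis. (v \<bullet> b) * dir_deriv F b x)"
      using AE_dir_diff[OF lip, of v] AE_dir_deriv_sum[OF lip finite_Basis, of "\<lambda>b. v \<bullet> b"]
      by eventually_elim (simp add: euclidean_representation)
  qed
  then show ?thesis
  proof eventually_elim
    case (elim x)
    define w where "w = (\<Sum>b\<in>Basis. dir_deriv F b x *\<^sub>R b)"
    have "w \<bullet> v = (\<Sum>b\<in>Basis. (v \<bullet> b) * dir_deriv F b x)" for v
      by (simp add: w_def inner_sum_left inner_commute[of v] mult.commute)
    then have "(dir_quot F v x \<longlongrightarrow> w \<bullet> v) (at 0)" if "v \<in> Q" for v
      using dir_deriv_tendsto[of F v x] elim that by simp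
    then have "(F has_derivative (\<lambda>h. w \<bullet> h)) (at x)"
      using has_derivative_if_dense_directions[OF lip Q(2), of x w] by blast
    then show ?case unfolding differentiable_def by blast
  qed
qed

theorem Rademacher:
  fixes f :: "'a::euclidean_space \<Rightarrow> 'b::euclidean_space"
  assumes lip: "L-lipschitz_on UNIV f"
  shows "AE x in lborel. f differentiable (at x)"
proof -
  have "AE x in lborel. \<forall>b\<in>Basis. (\<lambda>y. f y \<bullet> b) differentiable (at x)"
    unfolding AE_ball_countable[OF countable_finite[OF finite_Basis]]
  proof
    fix b :: 'b assume b: "b \<in> Basis"
    have "L-lipschitz_on UNIV (\<lambda>y. f y \<bullet> b)"
    proof (rule lipschitz_onI)
      fix x y
      have "\<bar>(f x - f y) \<bullet> b\<bar> \<le> norm (f x - f y)" using Basis_le_norm[OF b] .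
      also have "\<dots> \<le> L * dist x y" using lipschitz_onD[OF lip, of x y] by (simp add: dist_norm)
      finally show "dist (f x \<bullet> b) (f y \<bullet> b) \<le> L * dist x y" by (simp add: dist_real_def inner_diff_left)
    qed (rule lipschitz_on_nonneg[OF lip])
    then show "AE x in lborel. (\<lambda>y. f y \<bullet> b) differentiable (at x)" by (rule Rademacher_real)
  qed
  then show ?thesis
    by eventually_elim (simp add: differentiable_componentwise_within[of f])
qed

section \<open>Smooth maps of rank at most one\<close>

lemma Ck_on_cong_imp:
  assumes "open S" "\<And>x. x \<in> S \<Longrightarrow> f x = g x" "Ck_on k S f"
  shows "Ck_on k S g"
  using assms(2,3)
proof (induction k arbitrary: f g)
  case 0
  then show ?case using continuous_on_cong[of S S f g] by simp
next
  case (Suc k)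
  have d: "(f has_derivative f') (at x) \<longleftrightarrow> (g has_derivative f') (at x)" if "x \<in> S" for x f'
    using has_derivative_transform_within_open[OF _ \<open>open S\<close> that, of f f' UNIV g]
      has_derivative_transform_within_open[OF _ \<open>open S\<close> that, of g f' UNIV f] Suc.prems(1) by auto
  have fd: "frechet_derivative f (at x) = frechet_derivative g (at x)" if "x \<in> S" for x
    unfolding frechet_derivative_def using d[OF that] by simp
  have df: "f differentiable (at x) \<longleftrightarrow> g differentiable (at x)" if "x \<in> S" for x
    unfolding differentiable_def using d[OF that] by simp
  have "Ck_on k S (\<lambda>x. frechet_derivative g (at x) v)" for v
    by (rule Suc.IH[of "\<lambda>x. frechet_derivative f (at x) v"]) (use fd Suc.prems in auto)
  then show ?case using Suc.prems(2) df by simp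
qed

lemma Ck_on_SucI:
  assumes "open S" "\<And>x. x \<in> S \<Longrightarrow> (f has_derivative f' x) (at x)"
    "\<And>v. Ck_on k S (\<lambda>x. f' x v)"
  shows "Ck_on (Suc k) S f"
proof -
  have "frechet_derivative f (at x) = f' x" if "x \<in> S" for x
    using frechet_derivative_at[OF assms(2)[OF that]] by simp
  then have "Ck_on k S (\<lambda>x. frechet_derivative f (at x) v)" for v
    by (intro Ck_on_cong_imp[OF assms(1) _ assms(3)[of v]]) simp
  then show ?thesis using assms(2) by (auto simp: differentiable_def)
qed

lemma Ck_on_SucD:
  assumes "Ck_on (Suc k) S f" "x \<in> S"
  shows "(f has_derivative frechet_derivative f (at x)) (at x)"
  using assms by (simp add: frechet_derivative_works)

lemma Ck_on_pred: "Ck_on (Suc k) S f \<Longrightarrow> Ck_on k S f"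
proof (induction k arbitrary: f)
  case 0
  then show ?case
    by (auto intro!: continuous_at_imp_continuous_on dest: differentiable_imp_continuous_within)
qed simp

lemma Ck_on_const: "Ck_on k S (\<lambda>_. c)"
  by (induction k arbitrary: c) (simp_all add: frechet_derivative_const)

lemma Ck_on_add:
  assumes "open S" "Ck_on k S f" "Ck_on k S g"
  shows "Ck_on k S (\<lambda>x. f x + g x)"
  using assms(2,3)
proof (induction k arbitrary: f g)
  case 0
  then show ?case by (simp add: continuous_on_add)
next
  case (Suc k)
  show ?case
    by (rule Ck_on_SucI[OF assms(1) has_derivative_add[OF Ck_on_SucD[OF Suc.prems(1)] Ck_on_SucD[OF Suc.prems(2)]]])
      (use Suc in auto)
qed

lemma Ck_on_sum:
  assumes "open S" "finite I" "\<And>i. i \<in> I \<Longrightarrow> Ck_on k S (f i)"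
  shows "Ck_on k S (\<lambda>x. \<Sum>i\<in>I. f i x)"
  using assms(2,3) by (induction I rule: finite_induct) (auto intro: Ck_on_const Ck_on_add[OF assms(1)])

lemma Ck_on_scaleR:
  assumes "open S" "Ck_on k S u" "Ck_on k S f"
  shows "Ck_on k S (\<lambda>x. u x *\<^sub>R f x)"
  using assms(2,3)
proof (induction k arbitrary: u f)
  case 0
  then show ?case by (simp add: continuous_on_scaleR)
next
  case (Suc k)
  show ?case
    by (rule Ck_on_SucI[OF assms(1) has_derivative_scaleR[OF Ck_on_SucD[OF Suc.prems(1)] Ck_on_SucD[OF Suc.prems(2)]]])
      (use Suc Suc.prems[THEN Ck_on_pred] in \<open>auto intro!: Ck_on_add[OF assms(1)]\<close>)
qed

lemma Ck_on_bounded_linear: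
  assumes "open S" "bounded_linear f"
  shows "Ck_on k S f"
proof (cases k)
  case 0
  then show ?thesis using assms by (simp add: linear_continuous_on)
next
  case (Suc j)
  then show ?thesis
    using Ck_on_SucI[OF assms(1) bounded_linear_imp_has_derivative[OF assms(2)] Ck_on_const] by simp
qed

lemma Ck_on_real_polynomial_function:
  assumes "open S" "real_polynomial_function p"
  shows "Ck_on k S p"
  using assms(2)
proof (induction p rule: real_polynomial_function.induct)
  case (mult f g)
  then show ?case using Ck_on_scaleR[OF assms(1), of k f g] by simp
qed (auto intro: Ck_on_const Ck_on_add[OF assms(1)] Ck_on_bounded_linear[OF assms(1)])

text \<open>\<open>H\<close> lists a function with all its derivatives. Differentiating
  \<open>H j\<close> composed with \<open>p\<close> gives \<open>H (Suc j)\<close> composed with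
  \<open>p\<close>, times the derivative of \<open>p\<close>; hence the induction on
  \<open>k\<close> is over all \<open>j\<close> at once.\<close>

lemma Ck_on_compose_real:
  fixes H :: "nat \<Rightarrow> real \<Rightarrow> real"
  assumes "open S" and H: "\<And>j x. (H j has_real_derivative H (Suc j) x) (at x)" and "Ck_on k S p"
  shows "Ck_on k S (\<lambda>x. H j (p x))"
  using assms(3)
proof (induction k arbitrary: j)
  case 0
  have "continuous_on UNIV (H j)"
    using H DERIV_isCont continuous_at_imp_continuous_on by blast
  then show ?case using 0 by (auto intro: continuous_on_compose2)
next
  case (Suc k)
  have der: "((\<lambda>x. H j (p x)) has_derivative (\<lambda>v. H (Suc j) (p x) *\<^sub>R frechet_derivative p (at x) v)) (at x)"
    if "x \<in> S" for x
    using has_derivative_compose[OF Ck_on_SucD[OF Suc.prems that] H[of j "p x", unfolded has_field_derivative_def]]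
    by simp
  show ?case
    by (rule Ck_on_SucI[OF assms(1) der])
      (use Suc Suc.prems[THEN Ck_on_pred] in \<open>auto intro!: Ck_on_scaleR[OF assms(1)] simp del: real_scaleR_def\<close>)
qed

section \<open>Flat functions and a smooth step\<close>

definition flat_exp :: "real poly \<Rightarrow> real \<Rightarrow> real"
  where "flat_exp q x = (if x > 0 then poly q (1/x) * exp (- (1/x)) else 0)"

lemma poly_times_exp_minus_tendsto_0:
  "((\<lambda>y. poly q y * exp (- y)) \<longlongrightarrow> (0::real)) at_top"
proof -
  have "((\<lambda>y. \<Sum>i\<le>degree q. coeff q i * (y ^ i / exp y)) \<longlongrightarrow> (\<Sum>i\<le>degree q. coeff q i * 0)) at_top"
    by (intro tendsto_sum tendsto_mult tendsto_const tendsto_power_div_exp_0)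
  then show ?thesis
    by (simp add: poly_altdef sum_distrib_right exp_minus divide_inverse mult.assoc)
qed

text \<open>For positive \<open>x\<close> the derivative of \<open>q(1/x) exp(-1/x)\<close> is
  \<open>(1/x)^2 (q - q')(1/x) exp(-1/x)\<close>, again of the same form. The family is thus closed
  under differentiation, which gives all derivatives at once.\<close>

lemma flat_exp_has_derivative:
  "(flat_exp q has_real_derivative flat_exp ([:0, 0, 1:] * (q - pderiv q)) x) (at x)"
proof -
  consider "x > 0" | "x < 0" | "x = 0" by linarith
  then show ?thesis
  proof cases
    case 1
    have "((\<lambda>x. poly q (1/x) * exp (- (1/x))) has_real_derivative flat_exp ([:0, 0, 1:] * (q - pderiv q)) x) (at x)"
      using 1 by (auto intro!: derivative_eq_intros DERIV_chain'[OF _ poly_DERIV] simp: flat_exp_def field_simps power2_eq_square)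
    then show ?thesis
      by (rule has_field_derivative_transform_within_open[where S = "{0<..}"]) (use 1 in \<open>auto simp: flat_exp_def\<close>)
  next
    case 2
    have "((\<lambda>x. 0) has_real_derivative 0) (at x)" by simp
    then have "(flat_exp q has_real_derivative 0) (at x)"
      by (rule has_field_derivative_transform_within_open[where S = "{..<0}"]) (use 2 in \<open>auto simp: flat_exp_def\<close>)
    then show ?thesis using 2 by (simp add: flat_exp_def)
  next
    case 3
    have "((\<lambda>h. flat_exp q h / h) \<longlongrightarrow> 0) (at_right 0)"
    proof -
      \<comment> \<open>Dividing by \<open>h\<close> multiplies the polynomial in \<open>1/h\<close>
        by its variable, whence \<open>pCons 0 q\<close>.\<close>
      have "((\<lambda>h. poly (pCons 0 q) (inverse h) * exp (- inverse h)) \<longlongrightarrow> (0::real)) (at_right 0)"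
        by (rule filterlim_compose[OF poly_times_exp_minus_tendsto_0 filterlim_inverse_at_top_right])
      then show ?thesis
        by (rule Lim_transform_eventually) (auto simp: eventually_at_right_less eventually_at_filter flat_exp_def field_simps)
    qed
    moreover have "((\<lambda>h. flat_exp q h / h) \<longlongrightarrow> 0) (at_left 0)"
      by (rule tendsto_eventually) (auto simp: eventually_at_filter flat_exp_def)
    ultimately have "((\<lambda>h. flat_exp q h / h) \<longlongrightarrow> 0) (at 0)" by (simp add: filterlim_at_split)
    then show ?thesis using 3 by (simp add: DERIV_def flat_exp_def)
  qed
qed

lemma Ck_on_flat_exp:
  assumes "open S" "Ck_on k S p"
  shows "Ck_on k S (\<lambda>x. flat_exp q (p x))"
proof -
  define Q where "Q j = ((\<lambda>q. [:0, 0, 1:] * (q - pderiv q)) ^^ j) q" for j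
  show ?thesis
    using Ck_on_compose_real[OF assms(1) _ assms(2), of "\<lambda>j. flat_exp (Q j)" 0] flat_exp_has_derivative
    by (simp add: Q_def del: mult_pCons_left)
qed

text \<open>The flat function is composed with a reflected copy of itself, in place of the usual
  quotient of two flat functions: only a constant is divided by, so smoothness is a matter of
  composition. For t \<ge> 1 the outer argument is at most 0 and the fraction vanishes; for t \<le>
  0 it is \<open>flat_exp 1 1\<close> and the fraction is 1.\<close>

definition smooth_step :: "real \<Rightarrow> real"
  where "smooth_step t = 1 - flat_exp 1 (flat_exp 1 1 - flat_exp 1 t) / flat_exp 1 (flat_exp 1 1)"

lemma flat_exp_1_mono: "x \<le> y \<Longrightarrow> flat_exp 1 x \<le> flat_exp 1 y"
  by (auto simp: flat_exp_def frac_le)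

lemma flat_exp_1_pos: "x > 0 \<Longrightarrow> flat_exp 1 x > 0"
  by (simp add: flat_exp_def)

lemma smooth_step_props:
  shows "t \<le> 0 \<Longrightarrow> smooth_step t = 0" "t \<ge> 1 \<Longrightarrow> smooth_step t = 1" "0 \<le> smooth_step t" "smooth_step t \<le> 1"
proof -
  let ?K = "flat_exp 1 1"
  have K: "?K > 0" "flat_exp 1 ?K > 0" using flat_exp_1_pos by auto
  have nn: "flat_exp 1 x \<ge> 0" for x by (simp add: flat_exp_def)
  show "t \<le> 0 \<Longrightarrow> smooth_step t = 0"
    using K by (simp add: smooth_step_def flat_exp_def[of _ t])
  show "t \<ge> 1 \<Longrightarrow> smooth_step t = 1"
    using flat_exp_1_mono[of 1 t] by (simp add: smooth_step_def flat_exp_def[of _ "?K - flat_exp 1 t"])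
  have "flat_exp 1 (?K - flat_exp 1 t) \<le> flat_exp 1 ?K" using nn[of t] by (intro flat_exp_1_mono) simp
  then show "0 \<le> smooth_step t" using K by (simp add: smooth_step_def)
  show "smooth_step t \<le> 1" using K nn by (simp add: smooth_step_def)
qed

lemma smooth_step_derivative:
  obtains D where "\<And>t. (smooth_step has_real_derivative D t) (at t)" "\<And>t. t \<notin> {0<..<1} \<Longrightarrow> D t = 0"
proof
  let ?K = "flat_exp 1 1" and ?q = "[:0, 0, 1:] * (1 - pderiv 1) :: real poly"
  let ?D = "\<lambda>t. flat_exp ?q (?K - flat_exp 1 t) * flat_exp ?q t / flat_exp 1 ?K"
  show "(smooth_step has_real_derivative ?D t) (at t)" for t
  proof -
    have "((\<lambda>t. ?K - flat_exp 1 t) has_real_derivative - flat_exp ?q t) (at t)"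
      by (auto intro!: derivative_eq_intros flat_exp_has_derivative)
    from DERIV_chain2[OF flat_exp_has_derivative this]
    have "((\<lambda>t. flat_exp 1 (?K - flat_exp 1 t)) has_real_derivative
        flat_exp ?q (?K - flat_exp 1 t) * - flat_exp ?q t) (at t)" .
    from DERIV_diff[OF DERIV_const[of 1] DERIV_cdivide[OF this, of "flat_exp 1 ?K"]]
    show ?thesis unfolding smooth_step_def[abs_def] by simp
  qed
  show "?D t = 0" if "t \<notin> {0<..<1}" for t
  proof (cases "t \<le> 0")
    case True then show ?thesis by (simp add: flat_exp_def)
  next
    case False
    then have "?K \<le> flat_exp 1 t" using that by (intro flat_exp_1_mono) auto
    then show ?thesis by (simp add: flat_exp_def[of _ "?K - flat_exp 1 t"])
  qed
qed

lemma Ck_on_smooth_step: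
  assumes "open S" "Ck_on k S p"
  shows "Ck_on k S (\<lambda>x. smooth_step (p x))"
proof -
  let ?K = "flat_exp 1 1"
  have 1: "Ck_on k S (\<lambda>x. ?K + (-1) *\<^sub>R flat_exp 1 (p x))"
    by (intro Ck_on_add[OF assms(1)] Ck_on_const Ck_on_scaleR[OF assms(1)] Ck_on_flat_exp assms)
  have "Ck_on k S (\<lambda>x. 1 + (- 1 / flat_exp 1 ?K) *\<^sub>R flat_exp 1 (?K + (-1) *\<^sub>R flat_exp 1 (p x)))"
    by (intro Ck_on_add[OF assms(1)] Ck_on_const Ck_on_scaleR[OF assms(1)] Ck_on_flat_exp[OF assms(1) 1])
  then show ?thesis by (simp add: smooth_step_def)
qed

lemma rank_matrix_le_1:
  fixes \<phi> :: "real^'n \<Rightarrow> real" and w :: "real^'m"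
  assumes "linear \<phi>"
  shows "rank (matrix (\<lambda>h. \<phi> h *\<^sub>R w)) \<le> 1"
proof -
  have "linear (\<lambda>h. \<phi> h *\<^sub>R w)"
    using assms by (intro linearI) (simp_all add: linear_add linear_scale scaleR_add_left)
  then have "rank (matrix (\<lambda>h. \<phi> h *\<^sub>R w)) = dim (range (\<lambda>h. \<phi> h *\<^sub>R w))"
    by (simp add: rank_dim_range matrix_works)
  also have "\<dots> \<le> dim (span {w})"
    by (intro dim_subset) (auto intro: span_mul span_base)
  also have "\<dots> \<le> 1" by (simp add: dim_singleton)
  finally show ?thesis .
qed

text \<open>The step has derivative 0 wherever its argument is outside of the open unit interval. By
  \<open>disj\<close> at most one summand moves at \<open>y\<close>, so the derivative of
  \<open>g\<close> maps into the line spanned by a single \<open>W e\<close>.\<close>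

lemma smooth_rank_one_sum:
  fixes p :: "'e \<Rightarrow> real^'n \<Rightarrow> real" and W :: "'e \<Rightarrow> real^'m" and c :: "real^'m"
  assumes S: "open S" and E: "finite E" and p: "\<And>e. e \<in> E \<Longrightarrow> real_polynomial_function (p e)"
    and disj: "\<And>e e' y. \<lbrakk>y \<in> S; e \<in> E; e' \<in> E; e \<noteq> e'; p e y \<in> {0<..<1}\<rbrakk> \<Longrightarrow> p e' y \<notin> {0<..<1}"
  defines "g \<equiv> \<lambda>y. c + (\<Sum>e\<in>E. smooth_step (p e y) *\<^sub>R W e)"
  shows "smooth_on S g" "\<And>y. y \<in> S \<Longrightarrow> rank (jacobian g (at y)) \<le> 1"
proof -
  show "smooth_on S g"
    unfolding smooth_on_def g_def
    by (intro allI Ck_on_add[OF S] Ck_on_sum[OF S E] Ck_on_const Ck_on_scaleR[OF S] Ck_on_smooth_step[OF S]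
        Ck_on_real_polynomial_function[OF S] p)
  fix y assume y: "y \<in> S"
  obtain D where D: "\<And>t. (smooth_step has_real_derivative D t) (at t)" "\<And>t. t \<notin> {0<..<1} \<Longrightarrow> D t = 0"
    using smooth_step_derivative by blast
  define p' where "p' e = frechet_derivative (p e) (at y)" for e
  have p': "(p e has_derivative p' e) (at y)" if "e \<in> E" for e
    unfolding p'_def by (rule Ck_on_SucD[OF Ck_on_real_polynomial_function[OF S p[OF that]] y])
  have "(g has_derivative (\<lambda>h. \<Sum>e\<in>E. (D (p e y) * p' e h) *\<^sub>R W e)) (at y)"
  proof -
    have "((\<lambda>y. smooth_step (p e y) *\<^sub>R W e) has_derivative (\<lambda>h. (D (p e y) * p' e h) *\<^sub>R W e)) (at y)"
      if "e \<in> E" for e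
    proof -
      have "((\<lambda>y. smooth_step (p e y)) has_derivative (\<lambda>h. D (p e y) * p' e h)) (at y)"
        using has_derivative_compose[OF p'[OF that] D(1)[of "p e y", unfolded has_field_derivative_def]] .
      then show ?thesis by (rule has_derivative_scaleR_left)
    qed
    then have "((\<lambda>y. c + (\<Sum>e\<in>E. smooth_step (p e y) *\<^sub>R W e)) has_derivative (\<lambda>h. 0 + (\<Sum>e\<in>E. (D (p e y) * p' e h) *\<^sub>R W e))) (at y)"
      by (intro has_derivative_add has_derivative_const has_derivative_sum)
    then show ?thesis by (simp add: g_def)
  qed
  then have J: "jacobian g (at y) = matrix (\<lambda>h. \<Sum>e\<in>E. (D (p e y) * p' e h) *\<^sub>R W e)"
    unfolding jacobian_def by (simp only: frechet_derivative_at[symmetric])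
  show "rank (jacobian g (at y)) \<le> 1"
  proof (cases "\<exists>e\<in>E. p e y \<in> {0<..<1}")
    case True
    then obtain e where e: "e \<in> E" "p e y \<in> {0<..<1}" by blast
    have "(\<Sum>e\<in>E. (D (p e y) * p' e h) *\<^sub>R W e) = (D (p e y) * p' e h) *\<^sub>R W e" for h
    proof -
      have "D (p e' y) = 0" if "e' \<in> E - {e}" for e'
        using disj[OF y e(1) _ _ e(2)] that D(2) by auto
      then have "(\<Sum>e\<in>E. (D (p e y) * p' e h) *\<^sub>R W e) = (\<Sum>e\<in>{e}. (D (p e y) * p' e h) *\<^sub>R W e)"
        using E e by (intro sum.mono_neutral_right) auto
      then show ?thesis by simp
    qed
    moreover have "linear (\<lambda>h. D (p e y) * p' e h)"
      using has_derivative_linear[OF p'[OF e(1)]] by (intro linearI) (simp_all add: linear_add linear_scale distrib_left)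
    ultimately show ?thesis unfolding J by (simp only: rank_matrix_le_1)
  next
    case False
    then have "(\<lambda>h. \<Sum>e\<in>E. (D (p e y) * p' e h) *\<^sub>R W e) = (\<lambda>h. 0 *\<^sub>R 0)" using D(2) by fastforce
    then show ?thesis unfolding J by (simp only: rank_matrix_le_1 linear_zero)
  qed
qed

section \<open>Trees of cuts\<close>

lemma connected_real_value:
  fixes f :: "'a::topological_space \<Rightarrow> real"
  assumes "connected S" "continuous_on S f" "a \<in> S" "b \<in> S" "f a \<le> c" "c \<le> f b"
  shows "\<exists>z\<in>S. f z = c"
proof -
  have "connected (f ` S)" using assms(1,2) connected_continuous_image by blast
  then have "c \<in> f ` S" using assms(3-6) connectedD_interval[of "f ` S" "f a" "f b" c] by blast
  then show ?thesis by blast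
qed

text \<open>Each \<open>e\<close> stands for an edge of a tree to which \<open>K\<close> is mapped,
  and \<open>s e\<close> is the coordinate along it: it grows from 0 on the root side to 1 on the
  far side. The root may lie on an edge itself, so at \<open>p0\<close> only the bound 1/2 is asked
  for. By \<open>half\<close> every edge is met at its midpoint, so no cut is trivial.\<close>

locale tree_cuts =
  fixes K :: "'a::metric_space set" and I :: "'e set" and s :: "'e \<Rightarrow> 'a \<Rightarrow> real" and p0 :: 'a
  assumes finite_I: "finite I" and connected_K: "connected K"
    and cont: "e \<in> I \<Longrightarrow> continuous_on K (s e)"
    and range: "e \<in> I \<Longrightarrow> x \<in> K \<Longrightarrow> 0 \<le> s e x \<and> s e x \<le> 1"
    and connected_edge: "e \<in> I \<Longrightarrow> connected {x \<in> K. 0 < s e x \<and> s e x < 1}"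
    and half: "e \<in> I \<Longrightarrow> \<exists>x\<in>K. s e x = 1/2"
    and disjoint_edges: "\<lbrakk>e \<in> I; e' \<in> I; e \<noteq> e'; x \<in> K; 0 < s e x; s e x < 1\<rbrakk> \<Longrightarrow> s e' x = 0 \<or> s e' x = 1"
    and root: "p0 \<in> K" "e \<in> I \<Longrightarrow> s e p0 \<le> 1/2"
begin

text \<open>The cut \<open>e'\<close> has the edge \<open>e\<close>, and all that is behind it, on
  its far side: the relation orders the edges from the root outwards.\<close>

definition below :: "'e \<Rightarrow> 'e \<Rightarrow> bool"
  where "below e' e \<longleftrightarrow> e' \<noteq> e \<and> (\<forall>y\<in>K. s e y > 0 \<longrightarrow> s e' y = 1)"

lemma constant_on_edge:
  assumes "e \<in> I" "e' \<in> I" "e \<noteq> e'"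
  shows "\<exists>\<alpha>\<in>{0, 1}. \<forall>x\<in>K. 0 < s e' x \<and> s e' x < 1 \<longrightarrow> s e x = \<alpha>"
proof (rule ccontr)
  let ?E = "{x \<in> K. 0 < s e' x \<and> s e' x < 1}"
  assume "\<not> ?thesis"
  then obtain x y where "x \<in> ?E" "s e x \<noteq> 0" "y \<in> ?E" "s e y \<noteq> 1" by auto
  moreover from this have "s e x = 1" "s e y = 0"
    using disjoint_edges[of e' e] assms by auto
  ultimately have "\<exists>z\<in>?E. s e z = 1/2"
    using connected_real_value[OF connected_edge[OF assms(2)], of "s e" y x "1/2"]
      continuous_on_subset[OF cont[OF assms(1)]] by auto
  then show False using disjoint_edges[of e' e] assms by fastforce
qed

text \<open>The image of \<open>K\<close> under a pair of cuts lies in the boundary of the unit square; a corner not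
  adjacent to the two open sides that are hit would be an isolated point of a connected set.\<close>

lemma corner_empty:
  assumes e: "e \<in> I" "e' \<in> I" "e \<noteq> e'" and ab: "\<alpha> \<in> {0, 1}" "\<beta> \<in> {0, 1}"
    and A: "\<forall>x\<in>K. 0 < s e' x \<and> s e' x < 1 \<longrightarrow> s e x = \<alpha>"
    and B: "\<forall>x\<in>K. 0 < s e x \<and> s e x < 1 \<longrightarrow> s e' x = \<beta>"
    and y: "y \<in> K"
  shows "s e y \<noteq> 1 - \<alpha> \<or> s e' y \<noteq> 1 - \<beta>"
proof (rule ccontr)
  assume n: "\<not> ?thesis"
  \<comment> \<open>The sup distance of the pair of cut values to the corner. It has only the values
    0 and 1 on \<open>K\<close>, with 0 at \<open>y\<close> and a positive value at a midpoint of
    the edge \<open>e\<close>.\<close>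
  let ?f = "\<lambda>x. max \<bar>s e x - (1 - \<alpha>)\<bar> \<bar>s e' x - (1 - \<beta>)\<bar>"
  have c: "continuous_on K ?f" using cont e by (intro continuous_intros) auto
  have vals: "?f x = 0 \<or> ?f x = 1" if x: "x \<in> K" for x
  proof -
    have "0 \<le> s e x" "s e x \<le> 1" "0 \<le> s e' x" "s e' x \<le> 1" using range e x by auto
    then have le: "\<bar>s e x - (1 - \<alpha>)\<bar> \<le> 1" "\<bar>s e' x - (1 - \<beta>)\<bar> \<le> 1" using ab by auto
    consider "0 < s e x \<and> s e x < 1" | "0 < s e' x \<and> s e' x < 1" | "s e x \<in> {0, 1}" "s e' x \<in> {0, 1}"
      using \<open>0 \<le> s e x\<close> \<open>s e x \<le> 1\<close> \<open>0 \<le> s e' x\<close> \<open>s e' x \<le> 1\<close> by fastforce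
    then show ?thesis
    proof cases
      case 1
      then have "\<bar>s e' x - (1 - \<beta>)\<bar> = 1" using B x ab by auto
      then show ?thesis using le by simp
    next
      case 2
      then have "\<bar>s e x - (1 - \<alpha>)\<bar> = 1" using A x ab by auto
      then show ?thesis using le by simp
    next
      case 3
      then show ?thesis using ab by auto
    qed
  qed
  obtain h where h: "h \<in> K" "s e h = 1/2" using half e by blast
  then have "s e' h = \<beta>" using B by auto
  then have "?f h \<ge> 1/2" using ab h by auto
  then obtain z where "z \<in> K" "?f z = 1/2"
    using connected_real_value[OF connected_K c y h(1), of "1/2"] n by auto
  then show False using vals by fastforce
qed

text \<open>\<alpha> and \<beta> record on which side of the other cut each edge lies. Emptiness of
  the corner opposite to (\<alpha>, \<beta>) turns the mixed cases into nesting and the case (0, 0)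
  into disjointness.\<close>

lemma nested:
  assumes e: "e \<in> I" "e' \<in> I" "e \<noteq> e'"
  shows "below e e' \<or> below e' e \<or> (\<forall>y\<in>K. \<not> (s e y > 0 \<and> s e' y > 0))"
proof -
  obtain \<alpha> where \<alpha>: "\<alpha> \<in> {0, 1}" "\<forall>x\<in>K. 0 < s e' x \<and> s e' x < 1 \<longrightarrow> s e x = \<alpha>"
    using constant_on_edge e by blast
  obtain \<beta> where \<beta>: "\<beta> \<in> {0, 1}" "\<forall>x\<in>K. 0 < s e x \<and> s e x < 1 \<longrightarrow> s e' x = \<beta>"
    using constant_on_edge e by metis
  have corner: "s e y \<noteq> 1 - \<alpha> \<or> s e' y \<noteq> 1 - \<beta>" if "y \<in> K" for y
    using corner_empty[OF e \<alpha>(1) \<beta>(1) \<alpha>(2) \<beta>(2) that] .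
  have R: "0 \<le> s e y" "s e y \<le> 1" "0 \<le> s e' y" "s e' y \<le> 1" if "y \<in> K" for y using range e that by auto
  consider "\<alpha> = 1" "\<beta> = 0" | "\<alpha> = 0" "\<beta> = 1" | "\<alpha> = 0" "\<beta> = 0" | "\<alpha> = 1" "\<beta> = 1" using \<alpha>(1) \<beta>(1) by blast
  then show ?thesis
  proof cases
    case 1
    have "s e y = 1" if "y \<in> K" "s e' y > 0" for y
      using corner[OF that(1)] R[OF that(1)] \<alpha>(2) \<beta>(2) that 1 by (smt (verit))
    then show ?thesis using e by (simp add: below_def)
  next
    case 2
    have "s e' y = 1" if "y \<in> K" "s e y > 0" for y
      using corner[OF that(1)] R[OF that(1)] \<alpha>(2) \<beta>(2) that 2 by (smt (verit))
    then show ?thesis using e by (simp add: below_def)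
  next
    case 3
    have "\<not> (s e y > 0 \<and> s e' y > 0)" if "y \<in> K" for y
      using corner[OF that(1)] R[OF that(1)] \<alpha>(2) \<beta>(2) that 3 by (smt (verit))
    then show ?thesis by blast
  next
    \<comment> \<open>Each edge would be on the far side of the other cut; the root, which is on the
      low side of both, would have to sit in the empty corner (0, 0).\<close>
    case 4
    have "s e p0 \<le> 1/2" "s e' p0 \<le> 1/2" using root e by auto
    then have False
      using corner[OF root(1)] R[OF root(1)] \<alpha>(2) \<beta>(2) root(1) 4 by (smt (verit) divide_less_eq_1_pos)
    then show ?thesis ..
  qed
qed

lemma below_trans:
  assumes "e \<in> I" "e' \<in> I" "e'' \<in> I" "below e e'" "below e' e''"
  shows "below e e''"
proof -
  have *: "s e y = 1" if "y \<in> K" "s e'' y > 0" for y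
    using assms that unfolding below_def by force
  moreover have "e \<noteq> e''"
  proof
    assume "e = e''"
    moreover obtain y where "y \<in> K" "s e'' y = 1/2" using half assms by blast
    ultimately show False using *[of y] by simp
  qed
  ultimately show ?thesis by (simp add: below_def)
qed

definition depth :: "'e \<Rightarrow> nat"
  where "depth e = card {e' \<in> I. below e' e}"

lemma depth_less:
  assumes "e \<in> I" "e' \<in> I" "below e e'"
  shows "depth e < depth e'"
  unfolding depth_def
proof (rule psubset_card_mono)
  show "{x \<in> I. below x e} \<subset> {x \<in> I. below x e'}"
  proof (rule psubsetI)
    show "{x \<in> I. below x e} \<subseteq> {x \<in> I. below x e'}"
      using below_trans[OF _ assms(1,2) _ assms(3)] by blast
    have "e \<in> {x \<in> I. below x e'}" "e \<notin> {x \<in> I. below x e}"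
      using assms by (auto simp: below_def[of e e])
    then show "{x \<in> I. below x e} \<noteq> {x \<in> I. below x e'}" by blast
  qed
qed (use finite_I in auto)

lemma depth_bound:
  assumes "e \<in> I"
  shows "depth e < card I"
proof -
  have "e \<notin> {e' \<in> I. below e' e}" by (simp add: below_def)
  then have "{e' \<in> I. below e' e} \<subset> I" using assms by blast
  then show ?thesis unfolding depth_def using finite_I psubset_card_mono by blast
qed

end

section \<open>Extension of the cuts from \<open>K\<close> to the whole space\<close>

locale tree_net = tree_cuts K I s p0
  for K :: "'a::euclidean_space set" and I :: "'e set" and s :: "'e \<Rightarrow> 'a \<Rightarrow> real" and p0 :: 'a +
  fixes P :: "'a set" and r :: real
  assumes finite_P: "finite P" and p0_P: "p0 \<in> P" and r: "r > 0"
    and segments: "\<lbrakk>p \<in> P; q \<in> P\<rbrakk> \<Longrightarrow> closed_segment p q \<subseteq> K"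
begin

definition \<alpha> :: "'e \<Rightarrow> 'a \<Rightarrow> real"
  where "\<alpha> e x = infdist x {p \<in> P. s e p \<le> 1/2}"

text \<open>Depths are smaller than \<open>card I\<close>, so each transition takes place between
  the distances \<open>r\<close> and \<open>2 * r\<close> from the net points on the root side: it
  has not begun within \<open>r\<close> of such a point and is complete at \<open>2 * r\<close> from
  all of them.\<close>

definition \<eta> :: real where "\<eta> = r / (card I + 1)"

text \<open>Deeper cuts get larger thresholds, so that a cut has finished its transition before any
  deeper one starts.\<close>

definition threshold :: "'e \<Rightarrow> real"
  where "threshold e = r + \<eta> * depth e"

definition \<tau> :: "'e \<Rightarrow> 'a \<Rightarrow> real"
  where "\<tau> e x = max 0 (min 1 ((\<alpha> e x - threshold e) / \<eta>))"

lemma P_subset: "P \<subseteq> K"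
  using segments by (metis ends_in_segment(1) subsetD subsetI)

lemma low_nonempty: "e \<in> I \<Longrightarrow> {p \<in> P. s e p \<le> 1/2} \<noteq> {}"
  using p0_P root by auto

lemma \<eta>_pos: "\<eta> > 0"
  using r by (simp add: \<eta>_def add_pos_nonneg)

lemma continuous_\<tau>: "continuous_on UNIV (\<tau> e)"
  unfolding \<tau>_def \<alpha>_def using \<eta>_pos by (intro continuous_intros) auto

lemma \<tau>_range: "0 \<le> \<tau> e x" "\<tau> e x \<le> 1"
  by (auto simp: \<tau>_def)

lemma threshold_ge: "r \<le> threshold e"
  using \<eta>_pos by (simp add: threshold_def)

lemma \<tau>_pos_iff: "0 < \<tau> e x \<longleftrightarrow> threshold e < \<alpha> e x"
proof -
  have "0 < \<tau> e x \<longleftrightarrow> 0 < (\<alpha> e x - threshold e) / \<eta>" unfolding \<tau>_def by linarith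
  then show ?thesis using \<eta>_pos by (simp add: zero_less_divide_iff)
qed

lemma \<tau>_eq_1_iff: "\<tau> e x = 1 \<longleftrightarrow> threshold e + \<eta> \<le> \<alpha> e x"
proof -
  have "\<tau> e x = 1 \<longleftrightarrow> 1 \<le> (\<alpha> e x - threshold e) / \<eta>" unfolding \<tau>_def by linarith
  also have "\<dots> \<longleftrightarrow> threshold e + \<eta> \<le> \<alpha> e x" using \<eta>_pos by (simp add: le_divide_eq algebra_simps)
  finally show ?thesis .
qed

text \<open>The net points on the root side of \<open>e\<close> are also on the root side of
  \<open>e'\<close>, so \<alpha> does not increase from \<open>e\<close> to \<open>e'\<close>,
  whereas the threshold grows by at least \<eta>, the full width of a transition.\<close>

lemma \<tau>_below:
  assumes e: "e \<in> I" "e' \<in> I" and b: "below e e'" and pos: "0 < \<tau> e' x"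
  shows "\<tau> e x = 1"
proof -
  have "{p \<in> P. s e p \<le> 1/2} \<subseteq> {p \<in> P. s e' p \<le> 1/2}"
    using b P_subset unfolding below_def by force
  then have "\<alpha> e' x \<le> \<alpha> e x"
    unfolding \<alpha>_def using infdist_mono low_nonempty e by metis
  moreover have "threshold e + \<eta> \<le> threshold e'"
  proof -
    have "real (depth e) + 1 \<le> real (depth e')" using depth_less[OF e b] by simp
    then have "\<eta> * (real (depth e) + 1) \<le> \<eta> * real (depth e')" using \<eta>_pos by simp
    then show ?thesis by (simp add: threshold_def algebra_simps)
  qed
  ultimately show ?thesis using pos unfolding \<tau>_pos_iff \<tau>_eq_1_iff by linarith
qed

lemma \<tau>_pos_imp:
  assumes "e \<in> I" "y0 \<in> P" "dist x y0 < r" "0 < \<tau> e x"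
  shows "s e y0 > 1/2"
proof (rule ccontr)
  assume "\<not> ?thesis"
  then have "\<alpha> e x \<le> dist x y0" unfolding \<alpha>_def using assms by (intro infdist_le) auto
  then show False using assms threshold_ge[of e] unfolding \<tau>_pos_iff by linarith
qed

text \<open>If both values are positive at \<open>x\<close>, the nearby net point \<open>y0\<close>
  is on the far side of both cuts. The cuts are then nested, and the one nearer to the root has
  already reached 1.\<close>

lemma \<tau>_disjoint:
  assumes e: "e \<in> I" "e' \<in> I" "e \<noteq> e'" and y0: "y0 \<in> P" "dist x y0 < r"
    and pos: "0 < \<tau> e x" "\<tau> e x < 1"
  shows "\<tau> e' x = 0 \<or> \<tau> e' x = 1"
proof (rule ccontr)
  assume n: "\<not> ?thesis"
  then have pos': "0 < \<tau> e' x" using \<tau>_range[of e' x] by linarith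
  have "s e y0 > 1/2" "s e' y0 > 1/2" using \<tau>_pos_imp e y0 pos pos' by blast+
  then have "below e e' \<or> below e' e"
    using nested[OF e] P_subset y0 by (metis half_gt_zero_iff less_trans subsetD zero_less_one)
  then show False using \<tau>_below e pos pos' n by (metis less_irrefl)
qed

text \<open>The net point \<open>y0\<close> serves unless it is behind some cut whose \<tau> is not
  yet 1 at \<open>x\<close>. In that case \<open>y\<close> is placed at the middle of the shallowest
  such edge \<open>e\<close>: cuts at 1 there lie between the root and \<open>e\<close> and are
  complete at \<open>x\<close>, and no cut at 0 there can be complete at \<open>x\<close>.\<close>

lemma \<tau>_approx:
  assumes y0: "y0 \<in> P" "dist x y0 < r"
  shows "\<exists>y\<in>K. dist x y < 2 * r \<and> (\<forall>e\<in>I. s e y \<in> {0, 1} \<longrightarrow> \<tau> e x \<in> {0, 1} \<longrightarrow> s e y = \<tau> e x)"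
proof -
  define M where "M = {e \<in> I. \<tau> e x = 1}"
  define S where "S = {e \<in> I. s e y0 > 1/2}"
  have y0K: "y0 \<in> K" using y0 P_subset by blast
  have posS: "e \<in> S" if "e \<in> I" "0 < \<tau> e x" for e
    using \<tau>_pos_imp[OF that(1) y0 that(2)] that by (simp add: S_def)
  show ?thesis
  proof (cases "S \<subseteq> M")
    case True
    have "s e y0 = \<tau> e x" if e: "e \<in> I" "s e y0 \<in> {0, 1}" "\<tau> e x \<in> {0, 1}" for e
    proof (cases "\<tau> e x = 0")
      case True
      then have "e \<notin> S" using \<open>S \<subseteq> M\<close> by (auto simp: M_def)
      then show ?thesis using e True by (auto simp: S_def)
    next
      case False
      then have "e \<in> S" using e posS by auto
      then show ?thesis using e False by (auto simp: S_def)
    qed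
    then show ?thesis using y0 y0K r by (intro bexI[of _ y0]) auto
  next
    case False
    then have ne: "S - M \<noteq> {}" by blast
    have "finite (S - M)" using finite_I by (simp add: S_def)
    \<comment> \<open>Minimal depth puts every cut between the root and \<open>e\<close> into
      \<open>M\<close>, since such a cut also has \<open>y0\<close> on its far side.\<close>
    then obtain e where e: "e \<in> S - M" and min: "\<And>e'. e' \<in> S - M \<Longrightarrow> depth e \<le> depth e'"
      using ne arg_min_if_finite(1)[of "S - M" depth] arg_min_least[of "S - M" _ depth] by metis
    have eI: "e \<in> I" and e12: "s e y0 > 1/2" and e1: "\<tau> e x \<noteq> 1" using e by (auto simp: S_def M_def)
    have "\<alpha> e x < 2 * r"
    proof -
      have "\<alpha> e x < threshold e + \<eta>" using e1 unfolding \<tau>_eq_1_iff by simp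
      also have "\<dots> = r + \<eta> * (real (depth e) + 1)" by (simp add: threshold_def algebra_simps)
      also have "\<dots> \<le> r + \<eta> * (real (card I) + 1)"
        using depth_bound[OF eI] \<eta>_pos by (intro add_left_mono mult_left_mono) auto
      also have "\<dots> = 2 * r" by (simp add: \<eta>_def add.commute)
      finally show ?thesis .
    qed
    then obtain p where p: "p \<in> P" "s e p \<le> 1/2" "dist x p < 2 * r"
    proof -
      have "closed {p \<in> P. s e p \<le> 1/2}" using finite_P by (simp add: finite_imp_closed)
      then obtain p where "p \<in> {p \<in> P. s e p \<le> 1/2}" "infdist x {p \<in> P. s e p \<le> 1/2} = dist x p"
        by (rule infdist_attains_inf[OF _ low_nonempty[OF eI]])
      then show ?thesis using that[of p] \<open>\<alpha> e x < 2 * r\<close> by (simp add: \<alpha>_def)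
    qed
    have seg: "closed_segment y0 p \<subseteq> K" using segments y0 p by blast
    \<comment> \<open>The incomplete transition of \<open>e\<close> provided a net point
      \<open>p\<close> on the root side within \<open>2 * r\<close> of \<open>x\<close>, while
      \<open>y0\<close> is on the far side. The segment joining them crosses the middle of the edge
      without leaving \<open>K\<close> or the ball of radius \<open>2 * r\<close> about
      \<open>x\<close>.\<close>
    obtain y where y: "y \<in> closed_segment y0 p" "s e y = 1/2"
      using connected_real_value[OF connected_segment(1)[of y0 p] continuous_on_subset[OF cont[OF eI] seg], of p y0 "1/2"]
        p e12 by auto
    have yK: "y \<in> K" using y seg by blast
    have "closed_segment y0 p \<subseteq> ball x (2 * r)"
      using y0 p r by (intro closed_segment_subset) auto
    then have dy: "dist x y < 2 * r" using y by auto
    have "s e' y = \<tau> e' x" if e': "e' \<in> I" "s e' y \<in> {0, 1}" "\<tau> e' x \<in> {0, 1}" for e'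
    proof -
      have ne': "e \<noteq> e'" using e' y by auto
      consider "s e' y = 1" | "s e' y = 0" using e' by auto
      then show ?thesis
      proof cases
        case 1
        have "\<not> below e e'" using 1 y yK unfolding below_def by force
        moreover have "\<not> (\<forall>y\<in>K. \<not> (s e y > 0 \<and> s e' y > 0))" using 1 y yK by force
        ultimately have b: "below e' e" using nested[OF eI e'(1) ne'] by blast
        then have "s e' y0 = 1" using e12 y0K unfolding below_def by force
        then have "e' \<in> S" using e' by (simp add: S_def)
        moreover have "depth e' < depth e" using depth_less e' eI b by blast
        ultimately have "e' \<in> M" using min[of e'] by fastforce
        then show ?thesis using 1 by (simp add: M_def)
      next
        case 2
        have False if "\<tau> e' x = 1"
        proof -
          have "e' \<in> S" using posS e' that by simp
          then have "\<not> (\<forall>y\<in>K. \<not> (s e y > 0 \<and> s e' y > 0))"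
            using e12 y0K unfolding S_def by force
          moreover have "\<not> below e' e" using 2 y yK unfolding below_def by force
          ultimately have "below e e'" using nested[OF eI e'(1) ne'] by blast
          then show False using \<tau>_below[OF eI e'(1)] that e1 by simp
        qed
        then show ?thesis using 2 e' by auto
      qed
    qed
    then show ?thesis using yK dy by blast
  qed
qed

lemma card_partial_\<tau>:
  assumes y0: "y0 \<in> P" "dist x y0 < r"
  shows "card {e \<in> I. \<tau> e x \<notin> {0, 1}} \<le> 1"
proof -
  have "e = e'" if "e \<in> {e \<in> I. \<tau> e x \<notin> {0, 1}}" "e' \<in> {e \<in> I. \<tau> e x \<notin> {0, 1}}" for e e'
    using \<tau>_disjoint[OF _ _ _ y0, of e e'] \<tau>_range[of e x] that by force
  then show ?thesis using finite_I by (simp add: card_le_Suc0_iff_eq)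
qed

text \<open>At most one cut is in transition at \<open>y\<close> and at most one at
  \<open>x\<close>. All others agree, and each of these two contributes at most 1.\<close>

lemma \<tau>_sum_approx:
  assumes y0: "y0 \<in> P" "dist x y0 < r"
  obtains y where "y \<in> K" "dist x y < 2 * r" "(\<Sum>e\<in>I. \<bar>s e y - \<tau> e x\<bar>) \<le> 2"
proof -
  obtain y where y: "y \<in> K" "dist x y < 2 * r"
    "\<And>e. e \<in> I \<Longrightarrow> s e y \<in> {0, 1} \<Longrightarrow> \<tau> e x \<in> {0, 1} \<Longrightarrow> s e y = \<tau> e x"
    using \<tau>_approx[OF assms] by blast
  let ?A = "{e \<in> I. s e y \<notin> {0, 1}}" and ?B = "{e \<in> I. \<tau> e x \<notin> {0, 1}}"
  have fin: "finite ?A" using finite_I by auto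
  have A: "card ?A \<le> 1"
  proof -
    have "e = e'" if "e \<in> ?A" "e' \<in> ?A" for e e'
      using disjoint_edges[of e e' y] range[of e y] that y(1) by force
    then show ?thesis using fin by (simp add: card_le_Suc0_iff_eq)
  qed
  have B: "card ?B \<le> 1" by (rule card_partial_\<tau>[OF y0])
  have "(\<Sum>e\<in>I. \<bar>s e y - \<tau> e x\<bar>) = (\<Sum>e\<in>?A \<union> ?B. \<bar>s e y - \<tau> e x\<bar>)"
    using finite_I y(3) by (intro sum.mono_neutral_right) auto
  also have "\<dots> \<le> (\<Sum>e\<in>?A \<union> ?B. 1)"
    using range y(1) \<tau>_range by (intro sum_mono) (smt (verit) Un_iff mem_Collect_eq)
  also have "\<dots> \<le> 2" using card_Un_le[of ?A ?B] A B by simp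
  finally show ?thesis using that y by blast
qed

end

section \<open>Cuts from maps into a grid\<close>

lemma connected_Ints_constant:
  fixes f :: "'a::topological_space \<Rightarrow> real"
  assumes "connected S" "continuous_on S f" "\<And>x. x \<in> S \<Longrightarrow> f x \<in> \<int>" "a \<in> S" "b \<in> S"
  shows "f a = f b"
proof (rule ccontr)
  assume ne: "f a \<noteq> f b"
  have le: False if xy: "x \<in> S" "y \<in> S" "f x < f y" for x y
  proof -
    obtain m n where mn: "f x = of_int m" "f y = of_int n" using assms(3)[OF xy(1)] assms(3)[OF xy(2)] by (auto elim!: Ints_cases)
    then have "m < n" using that by simp
    then have "\<exists>z\<in>S. f z = of_int m + 1/2"
      using that mn by (intro connected_real_value[OF assms(1,2) that(1,2)]) auto
    then obtain z where z: "z \<in> S" "f z = of_int m + 1/2" by blast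
    obtain k where "f z = of_int k" using assms(3) z by (meson Ints_cases)
    then have "2 * k = 2 * m + 1" using z by (simp flip: of_int_eq_iff[where 'a = real])
    then show False by presburger
  qed
  then show False using ne assms(4,5) by (metis linorder_neqE_linordered_idom)
qed

lemma closed_int_coords: "closed {v :: real^'m. \<forall>j\<in>J. v $ j \<in> \<int>}"
proof -
  have "closed ((\<lambda>v :: real^'m. v $ j) -` \<int>)" for j
    by (intro closed_vimage closed_Ints continuous_intros)
  then have "closed (\<Inter>j\<in>J. (\<lambda>v :: real^'m. v $ j) -` \<int>)" by blast
  moreover have "(\<Inter>j\<in>J. (\<lambda>v :: real^'m. v $ j) -` \<int>) = {v. \<forall>j\<in>J. v $ j \<in> \<int>}" by auto
  ultimately show ?thesis by simp
qed

text \<open>The lift \<theta> is an integer off \<open>E\<close> and equals the grid coordinate up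
  to an integer constant on \<open>E\<close>. Once normalised it lies in (0, 1) on \<open>E\<close>,
  and by connectedness of \<open>K\<close> it cannot reach an integer other than 0 and 1
  elsewhere.\<close>

lemma cut_function:
  fixes K :: "'a::euclidean_space set" and A :: "'a \<Rightarrow> real^'m"
  assumes conn: "connected K" and contr: "contractible K" and lc: "locally connected K"
    and A: "continuous_on K A" and grid: "\<And>x. x \<in> K \<Longrightarrow> \<exists>i. \<forall>j. j \<noteq> i \<longrightarrow> A x $ j \<in> \<int>"
    and U: "U = {x \<in> K. \<exists>i. A x $ i \<notin> \<int>}" and E: "E \<in> components U"
  shows "openin (top_of_set K) E"
    "\<exists>s k i. continuous_on K s \<and> (\<forall>x\<in>K. 0 \<le> s x \<and> s x \<le> 1) \<and> {x \<in> K. 0 < s x \<and> s x < 1} = E \<and>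
      k \<in> \<int> \<and> (\<forall>x\<in>E. s x = A x $ i - k \<and> (\<forall>j. j \<noteq> i \<longrightarrow> A x $ j \<in> \<int>))"
proof -
  have cA: "continuous_on K (\<lambda>x. A x $ i)" for i using A by (intro continuous_intros)
  have opU: "openin (top_of_set K) U"
  proof -
    have "closed {v :: real^'m. \<forall>i. v $ i \<in> \<int>}" using closed_int_coords[of UNIV] by simp
    then have "openin (top_of_set K) (K \<inter> A -` (- {v :: real^'m. \<forall>i. v $ i \<in> \<int>}))"
      using A continuous_openin_preimage_gen by blast
    moreover have "K \<inter> A -` (- {v :: real^'m. \<forall>i. v $ i \<in> \<int>}) = U" unfolding U by auto
    ultimately show ?thesis by simp
  qed
  have EU: "E \<subseteq> U" using E in_components_subset by blast
  then have EK: "E \<subseteq> K" unfolding U by blast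
  have connE: "connected E" and neE: "E \<noteq> {}" using E in_components_connected in_components_nonempty by blast+
  \<comment> \<open>Local connectedness of \<open>K\<close> makes components of a relatively open
    set relatively open.\<close>
  have "openin (top_of_set U) E"
    using openin_components_locally_connected[OF locally_open_subset[OF lc opU] E] .
  then show opE: "openin (top_of_set K) E" using opU openin_trans by blast
  have clE: "closedin (top_of_set U) E" using closedin_component[OF E] .
  obtain e0 i where e0: "e0 \<in> E" "A e0 $ i \<notin> \<int>" using neE EU unfolding U by blast
  \<comment> \<open>A component runs along one coordinate direction: the part of \<open>E\<close>
    where coordinate \<open>i\<close> is an integer is closed, and it is the complement of the
    closed part where all other coordinates are integers, so by connectedness it is empty or all of
    \<open>E\<close>.\<close>
  have dir: "A x $ i \<notin> \<int> \<and> (\<forall>j. j \<noteq> i \<longrightarrow> A x $ j \<in> \<int>)" if x: "x \<in> E" for x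
  proof -
    let ?Z = "E \<inter> A -` {v. \<forall>j\<in>{i}. v $ j \<in> \<int>}" and ?R = "E \<inter> A -` {v. \<forall>j\<in>-{i}. v $ j \<in> \<int>}"
    have cl: "closedin (top_of_set E) ?Z" "closedin (top_of_set E) ?R"
      using continuous_on_subset[OF A EK] closed_int_coords by (intro continuous_closedin_preimage; blast)+
    have "?Z = E - ?R"
    proof (intro equalityI subsetI)
      fix x assume x: "x \<in> ?Z"
      then obtain l where "A x $ l \<notin> \<int>" using EU unfolding U by blast
      moreover from this have "l \<noteq> i" using x by auto
      ultimately show "x \<in> E - ?R" using x by auto
    next
      fix x assume x: "x \<in> E - ?R"
      then obtain l where l: "l \<noteq> i" "A x $ l \<notin> \<int>" by auto
      obtain i' where "\<forall>j. j \<noteq> i' \<longrightarrow> A x $ j \<in> \<int>" using grid[of x] x EK by blast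
      then have "A x $ i \<in> \<int>" using l by metis
      then show "x \<in> ?Z" using x by auto
    qed
    then have "openin (top_of_set E) ?Z" using cl(2) by (simp add: openin_diff)
    then have "?Z = {} \<or> ?Z = E" using connE cl(1) connected_clopen by blast
    then have "?Z = {}" using e0 by auto
    then have "A x $ i \<notin> \<int>" using x by auto
    moreover obtain i' where "\<forall>j. j \<noteq> i' \<longrightarrow> A x $ j \<in> \<int>" using grid[of x] x EK by blast
    ultimately show ?thesis by metis
  qed
  define k where "k = \<lfloor>A e0 $ i\<rfloor>"
  have cAE: "continuous_on E (\<lambda>x. A x $ i)" using continuous_on_subset[OF cA EK] .
  have k0: "of_int k < A e0 $ i" "A e0 $ i < of_int k + 1"
  proof -
    have "of_int k \<noteq> A e0 $ i" using e0(2) by (metis Ints_of_int)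
    then show "of_int k < A e0 $ i" "A e0 $ i < of_int k + 1"
      using floor_correct[of "A e0 $ i"] unfolding k_def by linarith+
  qed
  have kE: "of_int k < A x $ i \<and> A x $ i < of_int k + 1" if x: "x \<in> E" for x
  proof (rule ccontr)
    assume "\<not> ?thesis"
    then have "\<exists>z\<in>E. A z $ i = of_int k \<or> A z $ i = of_int k + 1"
      using connected_real_value[OF connE cAE x e0(1), of "of_int k"] connected_real_value[OF connE cAE e0(1) x, of "of_int k + 1"] k0
      by (metis less_imp_le not_less)
    then show False using dir by (metis Ints_1 Ints_add Ints_of_int)
  qed
  \<comment> \<open>\<open>E\<close> is closed in \<open>U\<close>, so its limit points in
    \<open>K\<close> that are not in \<open>E\<close> lie outside of \<open>U\<close>. There all
    coordinates of \<open>A\<close> are integers, and the two formulas agree.\<close>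
  define u where "u x = (if x \<in> E then exp (2 * pi * \<i> * A x $ i) else 1)" for x
  have int1: "exp (2 * pi * \<i> * complex_of_real a) = 1" if "a \<in> \<int>" for a :: real
    using that by (auto elim!: Ints_cases simp: exp_eq_1)
  obtain C where C: "closed C" "E = U \<inter> C" using clE by (auto simp: closedin_closed)
  have cu: "continuous_on K u"
  proof -
    obtain T where T: "open T" "E = K \<inter> T" using opE by (auto simp: openin_open)
    have KCT: "K \<inter> C \<union> K \<inter> - T = K" using T C by blast
    have "continuous_on (K \<inter> C \<union> K \<inter> - T) u"
      unfolding u_def
    proof (rule continuous_on_cases_local)
      show "closedin (top_of_set (K \<inter> C \<union> K \<inter> - T)) (K \<inter> C)"
        unfolding KCT using C(1) by (rule closedin_closed_Int)
      show "closedin (top_of_set (K \<inter> C \<union> K \<inter> - T)) (K \<inter> - T)"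
        unfolding KCT using T(1) by (intro closedin_closed_Int) (simp add: closed_def)
      show "continuous_on (K \<inter> C) (\<lambda>x. exp (2 * pi * \<i> * A x $ i))"
        by (intro continuous_intros continuous_on_subset[OF cA]) auto
      show "exp (2 * pi * \<i> * A x $ i) = 1" if "x \<in> K \<inter> C \<and> x \<notin> E \<or> x \<in> K \<inter> - T \<and> x \<in> E" for x
      proof -
        have "x \<in> K" "x \<notin> U" using that T C by blast+
        then show ?thesis using int1 unfolding U by blast
      qed
    qed simp
    then show ?thesis unfolding KCT .
  qed
  have "u x \<noteq> 0" for x by (simp add: u_def)
  then obtain g where g: "continuous_on K g" "\<And>x. x \<in> K \<Longrightarrow> u x = exp (g x)"
    using continuous_logarithm_on_contractible[OF cu contr] by metis
  define \<theta> where "\<theta> x = Im (g x) / (2 * pi)" for x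
  have c\<theta>: "continuous_on K \<theta>" unfolding \<theta>_def using g by (intro continuous_intros) auto
  have off: "\<theta> x \<in> \<int>" if "x \<in> K - E" for x
  proof -
    have "exp (g x) = 1" using g(2)[of x] that by (simp add: u_def)
    then obtain n :: int where "Im (g x) = of_int (2 * n) * pi" unfolding exp_eq_1 by blast
    then have "\<theta> x = of_int n" by (simp add: \<theta>_def)
    then show ?thesis by simp
  qed
  have on: "\<theta> x - A x $ i \<in> \<int>" if "x \<in> E" for x
  proof -
    have "exp (g x) = exp (2 * pi * \<i> * A x $ i)" using g(2)[of x] that EK by (auto simp: u_def)
    then obtain n :: int where "g x = 2 * pi * \<i> * A x $ i + of_int (2 * n) * pi * \<i>" unfolding exp_eq by blast
    then have "Im (g x) = 2 * pi * (A x $ i + of_int n)" by (simp add: algebra_simps)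
    then have "\<theta> x = A x $ i + of_int n" by (simp add: \<theta>_def)
    then show ?thesis by simp
  qed
  define s where "s x = \<theta> x - (\<theta> e0 - A e0 $ i) - of_int k" for x
  have cs: "continuous_on K s" unfolding s_def using c\<theta> by (intro continuous_intros)
  have sE: "s x = A x $ i - of_int k" if "x \<in> E" for x
  proof -
    have "\<theta> x - A x $ i = \<theta> e0 - A e0 $ i"
      by (rule connected_Ints_constant[OF connE _ on that e0(1)])
        (intro continuous_intros continuous_on_subset[OF c\<theta> EK] cAE)
    then show ?thesis by (simp add: s_def)
  qed
  have sE01: "0 < s x" "s x < 1" if "x \<in> E" for x using sE[OF that] kE[OF that] by auto
  have sO: "s x \<in> \<int>" if "x \<in> K - E" for x
    unfolding s_def using Ints_diff[OF Ints_diff[OF off[OF that] on[OF e0(1)]] Ints_of_int] .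
  have e0K: "e0 \<in> K" using e0 EK by blast
  \<comment> \<open>The values -1/2 and 3/2 are neither integers nor in (0, 1), so \<open>s\<close>
    does not attain them on or off \<open>E\<close>. Connectedness confines \<open>s\<close> between
    them, which leaves the integers 0 and 1.\<close>
  have no: False if z: "z \<in> K" "s z = - 1/2 \<or> s z = 3/2" for z
  proof (cases "z \<in> E")
    case True
    then show ?thesis using sE01 that by force
  next
    case False
    then obtain n :: int where "s z = of_int n" using sO z(1) by (meson DiffI Ints_cases)
    then have "2 * n = - 1 \<or> 2 * n = 3" using that by (auto simp flip: of_int_eq_iff[where 'a = real])
    then show False by presburger
  qed
  have half_range: "- 1/2 < s x \<and> s x < 3/2" if "x \<in> K" for x
  proof (rule ccontr)
    assume "\<not> ?thesis"
    then have "\<exists>z\<in>K. s z = - 1/2 \<or> s z = 3/2"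
      using connected_real_value[OF conn cs that e0K, of "- 1/2"] connected_real_value[OF conn cs e0K that, of "3/2"] sE01[OF e0(1)]
      by force
    then show False using no by blast
  qed
  have sO01: "s x = 0 \<or> s x = 1" if x: "x \<in> K - E" for x
  proof -
    obtain n :: int where n: "s x = of_int n" using sO[OF x] by (meson Ints_cases)
    then have "- 1 < 2 * n" "2 * n < 3" using half_range[of x] that by (auto simp flip: of_int_less_iff[where 'a = real])
    then have "n = 0 \<or> n = 1" by presburger
    then show ?thesis using n by auto
  qed
  have "\<forall>x\<in>K. 0 \<le> s x \<and> s x \<le> 1" using sE01 sO01 by (metis DiffI less_imp_le order_refl zero_le_one)
  moreover have "{x \<in> K. 0 < s x \<and> s x < 1} = E" using sE01 sO01 EK by force
  moreover have "\<forall>x\<in>E. s x = A x $ i - of_int k \<and> (\<forall>j. j \<noteq> i \<longrightarrow> A x $ j \<in> \<int>)" using sE dir by blast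
  ultimately show "\<exists>s k i. continuous_on K s \<and> (\<forall>x\<in>K. 0 \<le> s x \<and> s x \<le> 1) \<and> {x \<in> K. 0 < s x \<and> s x < 1} = E \<and>
      k \<in> \<int> \<and> (\<forall>x\<in>E. s x = A x $ i - k \<and> (\<forall>j. j \<noteq> i \<longrightarrow> A x $ j \<in> \<int>))"
    using cs Ints_of_int by blast
qed

section \<open>Assembling the cuts of a grid map into a tree\<close>

lemma real_int_range:
  fixes f :: "'a::topological_space \<Rightarrow> real"
  assumes "connected S" "continuous_on S f" "p \<in> S" "\<And>x. x \<in> S \<Longrightarrow> f x - 1/2 \<notin> \<int>"
  obtains n :: int where "\<And>x. x \<in> S \<Longrightarrow> \<bar>f x - of_int n\<bar> \<le> 1/2"
proof -
  define n where "n = \<lfloor>f p + 1/2\<rfloor>"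
  have p: "of_int n - 1/2 \<le> f p" "f p \<le> of_int n + 1/2"
    using floor_correct[of "f p + 1/2"] unfolding n_def by linarith+
  have no: False if "z \<in> S" "f z = of_int n - 1/2 \<or> f z = of_int n + 1/2" for z
  proof -
    have "f z - 1/2 = of_int (n - 1) \<or> f z - 1/2 = of_int n" using that(2) by auto
    then show False using assms(4)[OF that(1)] by (metis Ints_of_int)
  qed
  have "\<bar>f x - of_int n\<bar> \<le> 1/2" if x: "x \<in> S" for x
  proof (rule ccontr)
    assume "\<not> ?thesis"
    then consider "f x < of_int n - 1/2" | "of_int n + 1/2 < f x" by linarith
    then show False
    proof cases
      case 1
      then show False
        using connected_real_value[OF assms(1,2) x assms(3), of "of_int n - 1/2"] p no by auto
    next
      case 2
      then show False
        using connected_real_value[OF assms(1,2) assms(3) x, of "of_int n + 1/2"] p no by auto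
    qed
  qed
  then show thesis by (rule that)
qed

text \<open>Passing to \<open>1 - s\<close> and reversing the axis puts the root on the low side,
  and it alters \<open>A x - s x *\<^sub>R W\<close> only by an integer vector.\<close>

lemma oriented_cut_function:
  fixes K :: "'a::euclidean_space set" and A :: "'a \<Rightarrow> real^'m"
  assumes conn: "connected K" and contr: "contractible K" and lc: "locally connected K"
    and A: "continuous_on K A" and grid: "\<And>x. x \<in> K \<Longrightarrow> \<exists>i. \<forall>j. j \<noteq> i \<longrightarrow> A x $ j \<in> \<int>"
    and U: "U = {x \<in> K. \<exists>i. A x $ i \<notin> \<int>}" and E: "E \<in> components U"
  shows "\<exists>s W. continuous_on K s \<and> (\<forall>x\<in>K. 0 \<le> s x \<and> s x \<le> 1) \<and> {x \<in> K. 0 < s x \<and> s x < 1} = E \<and>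
     s p0 \<le> 1/2 \<and> (\<exists>i. W = axis i 1 \<or> W = axis i (-1)) \<and> (\<forall>x\<in>E. \<forall>j. (A x - s x *\<^sub>R W) $ j \<in> \<int>)"
proof -
  obtain s k i where s: "continuous_on K s" "\<forall>x\<in>K. 0 \<le> s x \<and> s x \<le> 1" "{x \<in> K. 0 < s x \<and> s x < 1} = E"
    "k \<in> \<int>" "\<forall>x\<in>E. s x = A x $ i - k \<and> (\<forall>j. j \<noteq> i \<longrightarrow> A x $ j \<in> \<int>)"
    using cut_function(2)[OF assms] by blast
  show ?thesis
  proof (cases "s p0 \<le> 1/2")
    case True
    have "(A x - s x *\<^sub>R axis i 1) $ j \<in> \<int>" if "x \<in> E" for x j
      using s(4,5) that by (cases "j = i") (auto simp: axis_def)
    then show ?thesis using s True by (intro exI[of _ s] exI[of _ "axis i 1"]) blast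
  next
    case False
    have "(A x - (1 - s x) *\<^sub>R axis i (-1)) $ j \<in> \<int>" if "x \<in> E" for x j
      using s(4,5) that by (cases "j = i") (auto simp: axis_def)
    moreover have "{x \<in> K. 0 < 1 - s x \<and> 1 - s x < 1} = E" using s(3) by auto
    moreover have "continuous_on K (\<lambda>x. 1 - s x)" using s(1) by (intro continuous_intros)
    moreover have "\<forall>x\<in>K. 0 \<le> 1 - s x \<and> 1 - s x \<le> 1" using s(2) by auto
    moreover have "1 - s p0 \<le> 1/2" using False by simp
    ultimately show ?thesis by (intro exI[of _ "\<lambda>x. 1 - s x"] exI[of _ "axis i (-1)"]) blast
  qed
qed

text \<open>There may be infinitely many components. Only those on which some coordinate of
  \<open>A\<close> is a half-integer are kept; the other cuts stay below 1/2 and cost less than 1/2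
  in each coordinate. After subtraction of the kept cuts no coordinate is ever a half-integer, so on
  the connected \<open>K\<close> each remains within 1/2 of one integer.\<close>

lemma grid_tree:
  fixes K :: "'a::euclidean_space set" and A :: "'a \<Rightarrow> real^'m"
  assumes comp: "compact K" and conn: "connected K" and contr: "contractible K" and lc: "locally connected K"
    and A: "continuous_on K A" and grid: "\<And>x. x \<in> K \<Longrightarrow> \<exists>i. \<forall>j. j \<noteq> i \<longrightarrow> A x $ j \<in> \<int>"
    and p0: "p0 \<in> K"
  obtains I :: "'a set set" and s W c where "tree_cuts K I s p0" "\<forall>e\<in>I. norm (W e :: real^'m) \<le> 1"
    "\<forall>y\<in>K. \<forall>i. \<bar>(A y - (c + (\<Sum>e\<in>I. s e y *\<^sub>R W e))) $ i\<bar> \<le> 1/2"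
proof -
  define U where "U = {x \<in> K. \<exists>i. A x $ i \<notin> \<int>}"
  note cut = oriented_cut_function[OF conn contr lc A grid U_def]
  have "\<forall>E\<in>components U. \<exists>sW. continuous_on K (fst sW) \<and> (\<forall>x\<in>K. 0 \<le> fst sW x \<and> fst sW x \<le> 1) \<and>
     {x \<in> K. 0 < fst sW x \<and> fst sW x < 1} = E \<and> fst sW p0 \<le> 1/2 \<and>
     (\<exists>i. snd sW = axis i 1 \<or> snd sW = axis i (-1)) \<and> (\<forall>x\<in>E. \<forall>j. (A x - fst sW x *\<^sub>R snd sW) $ j \<in> \<int>)"
    using cut[where ?p0.0 = p0] by simp
  then obtain sW where sW: "\<forall>E\<in>components U. continuous_on K (fst (sW E)) \<and> (\<forall>x\<in>K. 0 \<le> fst (sW E) x \<and> fst (sW E) x \<le> 1) \<and>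
     {x \<in> K. 0 < fst (sW E) x \<and> fst (sW E) x < 1} = E \<and> fst (sW E) p0 \<le> 1/2 \<and>
     (\<exists>i. snd (sW E) = axis i 1 \<or> snd (sW E) = axis i (-1)) \<and> (\<forall>x\<in>E. \<forall>j. (A x - fst (sW E) x *\<^sub>R snd (sW E)) $ j \<in> \<int>)"
    by (rule bchoice[THEN exE]) blast
  define s where "s E = fst (sW E)" for E
  define W where "W E = snd (sW E)" for E
  have cs: "continuous_on K (s E)" and rs: "\<And>x. x \<in> K \<Longrightarrow> 0 \<le> s E x \<and> s E x \<le> 1"
    and eE: "{x \<in> K. 0 < s E x \<and> s E x < 1} = E" and s0: "s E p0 \<le> 1/2"
    and WE: "\<exists>i. W E = axis i 1 \<or> W E = axis i (-1)"
    and AE: "\<And>x j. x \<in> E \<Longrightarrow> (A x - s E x *\<^sub>R W E) $ j \<in> \<int>"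
    if "E \<in> components U" for E
    using sW that unfolding s_def W_def by blast+
  have W01: "W E $ j \<in> {-1, 0, 1}" if "E \<in> components U" for E j
    using WE[OF that] by (auto simp: axis_def)
  have EU: "E \<subseteq> U" "E \<noteq> {}" "connected E" if "E \<in> components U" for E
    using that in_components_subset in_components_nonempty in_components_connected by blast+
  have UK: "U \<subseteq> K" unfolding U_def by blast
  have in_comp: "\<exists>E\<in>components U. x \<in> E" if "x \<in> U" for x
    using that Union_components[of U] by blast
  have eq_comp: "E = E'" if "E \<in> components U" "E' \<in> components U" "x \<in> E" "x \<in> E'" for E E' x
    using components_nonoverlap[OF that(1,2)] that by blast
  have s01: "s E x \<in> {0, 1}" if "E \<in> components U" "x \<in> K" "x \<notin> E" for E x
    using rs[OF that(1,2)] eE[OF that(1)] that by (smt (verit) insertCI mem_Collect_eq)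
  \<comment> \<open>A compact set covered by the disjoint, relatively open components, so that only
    finitely many of them meet it.\<close>
  define Y where "Y = {x \<in> K. \<exists>i. A x $ i - 1/2 \<in> \<int>}"
  define I where "I = {E \<in> components U. E \<inter> Y \<noteq> {}}"
  have half_not_int: "a \<notin> \<int>" if ah: "a - 1/2 \<in> \<int>" for a :: real
  proof
    assume "a \<in> \<int>"
    then obtain m n :: int where "a = of_int m" "a - 1/2 = of_int n" using ah by (auto elim!: Ints_cases)
    then have "real_of_int (2 * m) = real_of_int (2 * n + 1)" by simp
    then have "2 * m = 2 * n + 1" by (simp only: of_int_eq_iff)
    then show False by presburger
  qed
  have YU: "Y \<subseteq> U" unfolding Y_def U_def using half_not_int by blast
  have "compact Y"
  proof -
    have "closed (\<Union>i. {v :: real^'m. v $ i - 1/2 \<in> \<int>})"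
    proof (intro closed_UN ballI)
      fix i
      have "closed ((\<lambda>v :: real^'m. v $ i - 1/2) -` \<int>)" by (intro closed_vimage closed_Ints continuous_intros)
      then show "closed {v :: real^'m. v $ i - 1/2 \<in> \<int>}" by (simp add: vimage_def)
    qed simp
    then have "closedin (top_of_set K) (K \<inter> A -` (\<Union>i. {v :: real^'m. v $ i - 1/2 \<in> \<int>}))"
      using A continuous_closedin_preimage by blast
    moreover have "K \<inter> A -` (\<Union>i. {v :: real^'m. v $ i - 1/2 \<in> \<int>}) = Y" unfolding Y_def by auto
    ultimately show ?thesis using comp closedin_compact by metis
  qed
  have finI: "finite I"
  proof -
    have "\<forall>E\<in>components U. \<exists>T. open T \<and> E = K \<inter> T"
      using cut_function(1)[OF conn contr lc A grid U_def] by (simp add: openin_open)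
    then obtain T where T: "\<forall>E\<in>components U. open (T E) \<and> E = K \<inter> T E"
      by (rule bchoice[THEN exE]) blast
    have "Y \<subseteq> (\<Union>E\<in>components U. T E)" using in_comp YU T by blast
    then obtain C' where C': "C' \<subseteq> components U" "finite C'" "Y \<subseteq> (\<Union>E\<in>C'. T E)"
      using compactE_image[OF \<open>compact Y\<close>, of "components U" T] T by blast
    have "I \<subseteq> C'"
    proof
      fix E assume "E \<in> I"
      then obtain y where y: "E \<in> components U" "y \<in> E" "y \<in> Y" unfolding I_def by blast
      then obtain E' where E': "E' \<in> C'" "y \<in> T E'" using C' by blast
      moreover have "E' \<in> components U" using E' C' by blast
      moreover have "y \<in> K" using y YU UK by blast
      ultimately have "E = E'" using eq_comp[of E E' y] y T by blast
      then show "E \<in> C'" using E' by simp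
    qed
    then show ?thesis using C' finite_subset by blast
  qed
  have IC: "E \<in> components U" if "E \<in> I" for E using that unfolding I_def by blast
  \<comment> \<open>At a point of \<open>E\<close> with a half-integral coordinate, this coordinate
    must be the one along the edge; being strictly between 0 and 1, \<open>s E\<close> can only be
    1/2 there.\<close>
  have halfI: "\<exists>x\<in>K. s E x = 1/2" if E: "E \<in> I" for E
  proof -
    obtain y i where y: "y \<in> E" "y \<in> K" "A y $ i - 1/2 \<in> \<int>" using E unfolding I_def Y_def by blast
    have "A y $ i - s E y * W E $ i \<in> \<int>" using AE[OF IC[OF E] y(1), of i] by simp
    then have d: "s E y * W E $ i - 1/2 \<in> \<int>" using Ints_diff[OF y(3)] by fastforce
    have "0 < s E y" "s E y < 1" using eE[OF IC[OF E]] y by blast+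
    obtain n :: int where "s E y * W E $ i - 1/2 = of_int n" using d by (rule Ints_cases)
    consider "W E $ i = -1" | "W E $ i = 0" | "W E $ i = 1" using W01[OF IC[OF E], of i] by blast
    then have "s E y = 1/2"
    proof cases
      case 1
      then have "- 2 < real_of_int n" "real_of_int n < 0"
        using \<open>0 < s E y\<close> \<open>s E y < 1\<close> \<open>s E y * W E $ i - 1/2 = of_int n\<close> by simp_all
      then have "n = -1" by linarith
      then show ?thesis using 1 \<open>s E y * W E $ i - 1/2 = of_int n\<close> by simp
    next
      case 2
      then show ?thesis using half_not_int[OF d] by simp
    next
      case 3
      then have "- 1 < real_of_int n" "real_of_int n < 1"
        using \<open>0 < s E y\<close> \<open>s E y < 1\<close> \<open>s E y * W E $ i - 1/2 = of_int n\<close> by simp_all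
      then have "n = 0" by linarith
      then show ?thesis using 3 \<open>s E y * W E $ i - 1/2 = of_int n\<close> by simp
    qed
    then show ?thesis using y by blast
  qed
  \<comment> \<open>\<open>s E\<close> is at most 1/2 at the root, so to reach 1/2 or more it has to
    take the value 1/2. Such a point is in \<open>E\<close> and has a half-integral coordinate,
    which would put \<open>E\<close> into \<open>I\<close>.\<close>
  have small: "s E x < 1/2" if E: "E \<in> components U" "E \<notin> I" and x: "x \<in> K" for E x
  proof (rule ccontr)
    assume "\<not> ?thesis"
    then obtain z where z: "z \<in> K" "s E z = 1/2"
      using connected_real_value[OF conn cs[OF E(1)] p0 x, of "1/2"] s0[OF E(1)] by auto
    then have zE: "z \<in> E" using eE[OF E(1)] by force
    then obtain j where j: "A z $ j \<notin> \<int>" using EU[OF E(1)] unfolding U_def by blast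
    have d: "A z $ j - 1/2 * W E $ j \<in> \<int>" using AE[OF E(1) zE, of j] z by simp
    have "z \<notin> Y" using E zE unfolding I_def by blast
    then have nh: "A z $ j - 1/2 \<notin> \<int>" using z unfolding Y_def by blast
    consider "W E $ j = -1" | "W E $ j = 0" | "W E $ j = 1" using W01[OF E(1), of j] by blast
    then show False
    proof cases
      case 1
      then have "A z $ j + 1/2 - 1 \<in> \<int>" using d by (intro Ints_diff) auto
      then show False using nh by simp
    next
      case 2 then show False using d j by simp
    next
      case 3 then show False using d nh by simp
    qed
  qed
  have tree: "tree_cuts K I s p0"
  proof
    fix e e' x assume "e \<in> I" "e' \<in> I" "e \<noteq> e'" "x \<in> K" "0 < s e x" "s e x < 1"
    then have "x \<in> e" using eE[OF IC] by blast
    then have "x \<notin> e'" using eq_comp IC \<open>e \<in> I\<close> \<open>e' \<in> I\<close> \<open>e \<noteq> e'\<close> by blast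
    then show "s e' x = 0 \<or> s e' x = 1" using s01[OF IC[OF \<open>e' \<in> I\<close>] \<open>x \<in> K\<close>] by blast
  qed (use finI conn cs rs eE EU halfI s0 IC p0 in auto)
  have normW: "norm (W E) \<le> 1" if "E \<in> I" for E
  proof -
    have "axis i (-1) = - (axis i 1 :: real^'m)" for i by (simp add: axis_def vec_eq_iff)
    then show ?thesis using WE[OF IC[OF that]] by (auto simp: norm_axis_1)
  qed
  define D where "D y = A y - (\<Sum>e\<in>I. s e y *\<^sub>R W e)" for y
  have cD: "continuous_on K (\<lambda>y. D y $ i)" for i
    unfolding D_def using cs IC by (intro continuous_intros A) auto
  \<comment> \<open>All coordinates of \<open>D\<close> are integers except on discarded edges,
    where they differ from an integer by less than 1/2.\<close>
  have Dint: "D y $ i - 1/2 \<notin> \<int>" if y: "y \<in> K" for y i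
  proof -
    have t: "s e y * W e $ i \<in> \<int>" if "e \<in> I" "y \<notin> e" for e
      using s01[OF IC[OF that(1)] y that(2)] W01[OF IC[OF that(1)], of i] by auto
    show ?thesis
    proof (cases "y \<in> U")
      case False
      then have "A y $ i \<in> \<int>" "\<And>e. e \<in> I \<Longrightarrow> y \<notin> e" using y EU IC unfolding U_def by blast+
      then have "D y $ i \<in> \<int>" unfolding D_def using t by (simp add: Ints_diff Ints_sum)
      then show ?thesis using half_not_int by blast
    next
      case True
      then obtain E where E: "E \<in> components U" "y \<in> E" using in_comp by blast
      have o: "s e y * W e $ i \<in> \<int>" if "e \<in> I - {E}" for e
        using t[of e] eq_comp[OF IC E(1)] E that by blast
      have aE: "A y $ i - s E y * W E $ i \<in> \<int>" using AE[OF E, of i] by simp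
      have so: "(\<Sum>e\<in>I - {E}. s e y * W e $ i) \<in> \<int>" using o by (rule Ints_sum)
      show ?thesis
      proof (cases "E \<in> I")
        case True
        have "D y $ i = (A y $ i - s E y * W E $ i) - (\<Sum>e\<in>I - {E}. s e y * W e $ i)"
          unfolding D_def using sum.remove[OF finI True, of "\<lambda>e. s e y * W e $ i"] by simp
        then have "D y $ i \<in> \<int>" using Ints_diff[OF aE so] by simp
        then show ?thesis using half_not_int by blast
      next
        case False
        then have I: "I - {E} = I" by blast
        have "D y $ i = (A y $ i - s E y * W E $ i) - (\<Sum>e\<in>I - {E}. s e y * W e $ i) + s E y * W E $ i"
          unfolding D_def I by simp
        moreover obtain n :: int
          where "(A y $ i - s E y * W E $ i) - (\<Sum>e\<in>I - {E}. s e y * W e $ i) = of_int n"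
          using Ints_diff[OF aE so] by (rule Ints_cases)
        ultimately have n: "D y $ i = of_int n + s E y * W E $ i" by linarith
        have "\<bar>s E y * W E $ i\<bar> < 1/2"
          using small[OF E(1) False y] rs[OF E(1) y] W01[OF E(1), of i] by auto
        then have lt: "of_int n - 1 < D y $ i - 1/2" "D y $ i - 1/2 < of_int n" using n by linarith+
        show ?thesis
        proof
          assume "D y $ i - 1/2 \<in> \<int>"
          then obtain m :: int where "D y $ i - 1/2 = of_int m" by (rule Ints_cases)
          then have "n - 1 < m" "m < n" using lt by linarith+
          then show False by simp
        qed
      qed
    qed
  qed
  have "\<exists>n :: int. \<forall>y\<in>K. \<bar>D y $ i - of_int n\<bar> \<le> 1/2" for i
    using real_int_range[OF conn cD p0 Dint] by metis
  then obtain n where n: "\<And>i. \<forall>y\<in>K. \<bar>D y $ i - of_int (n i)\<bar> \<le> 1/2" by metis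
  have "\<bar>(A y - ((\<chi> i. of_int (n i)) + (\<Sum>e\<in>I. s e y *\<^sub>R W e))) $ i\<bar> \<le> 1/2" if "y \<in> K" for y i
    using n[of i] that unfolding D_def by (simp add: algebra_simps)
  then show thesis using that tree normW by blast
qed

section \<open>Generic triangles and grids\<close>

lemma negligible_borel_superset:
  fixes N :: "'a::euclidean_space set"
  assumes "negligible N"
  obtains N' where "N' \<in> sets borel" "N \<subseteq> N'" "negligible N'"
proof -
  have "N \<in> null_sets (completion lborel)" using assms by (simp add: negligible_iff_null_sets)
  then obtain N' where "N' \<in> null_sets lborel" "N \<subseteq> N'" unfolding null_sets_completion_iff2 by blast
  then show thesis
    using that[of N'] by (auto simp: negligible_iff_null_sets null_sets_completionI)
qed

text \<open>Barycentric coordinates with respect to \<open>a\<close>, \<open>p\<close>,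
  \<open>q\<close>. The parameter ranges over all of \<open>real^2\<close>, beyond the triangle, so
  that "almost every" refers to Lebesgue measure of the plane.\<close>

definition cone_point :: "'a::real_vector \<Rightarrow> 'a \<Rightarrow> 'a \<Rightarrow> real^2 \<Rightarrow> 'a"
  where "cone_point a p q z = (1 - z$1 - z$2) *\<^sub>R a + z$1 *\<^sub>R p + z$2 *\<^sub>R q"

text \<open>For fixed \<open>z\<close> off the line \<open>z$1 + z$2 = 1\<close>, the point is an
  invertible affine function of the apex, so almost every apex avoids \<open>N\<close>. Fubini
  exchanges the apex and \<open>z\<close>.\<close>

lemma AE_apex:
  fixes N :: "'a::euclidean_space set"
  assumes N: "negligible N"
  shows "AE a in lborel. AE z in lborel. cone_point a p q z \<notin> N"
proof -
  obtain N' where N': "N' \<in> sets borel" "N \<subseteq> N'" "negligible N'" using negligible_borel_superset[OF N] .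
  let ?f = "\<lambda>(a, z). cone_point a p q z"
  let ?S = "- (?f -` N')"
  have "continuous_on UNIV ?f"
    unfolding cone_point_def case_prod_unfold by (intro continuous_intros)
  then have "?f -` N' \<inter> space borel \<in> sets borel"
    using measurable_sets[OF borel_measurable_continuous_onI N'(1)] by blast
  then have S: "?S \<in> sets borel" by (simp add: borel_comp)
  have hyp: "AE z :: real^2 in lborel. 1 - z$1 - z$2 \<noteq> (0::real)"
  proof -
    have "negligible {z :: real^2. (axis 1 1 + axis 2 1) \<bullet> z = 1}"
      by (intro negligible_hyperplane) simp
    moreover have "{z :: real^2. \<not> 1 - z$1 - z$2 \<noteq> 0} = {z. (axis 1 1 + axis 2 1) \<bullet> z = 1}"
      by (auto simp: inner_add_left inner_axis')
    ultimately show ?thesis by (simp add: AE_lborel_iff_negligible)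
  qed
  have "AE z in lborel. AE a in lborel. (a, z) \<in> ?S"
    using hyp
  proof eventually_elim
    case (elim z)
    let ?c = "1 - z$1 - z$2" and ?b = "z$1 *\<^sub>R p + z$2 *\<^sub>R q"
    have "negligible ((\<lambda>y. (1 / ?c) *\<^sub>R (y - ?b)) ` N')"
      by (intro negligible_differentiable_image_negligible N'(3) derivative_intros) auto
    moreover have "{a. \<not> (a, z) \<in> ?S} \<subseteq> (\<lambda>y. (1 / ?c) *\<^sub>R (y - ?b)) ` N'"
    proof
      fix a assume "a \<in> {a. \<not> (a, z) \<in> ?S}"
      then have y: "cone_point a p q z \<in> N'" by simp
      have "a = (1 / ?c) *\<^sub>R (cone_point a p q z - ?b)" using elim by (simp add: cone_point_def)
      then show "a \<in> (\<lambda>y. (1 / ?c) *\<^sub>R (y - ?b)) ` N'" using y by blast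
    qed
    ultimately show ?case unfolding AE_lborel_iff_negligible using negligible_subset by blast
  qed
  then have "AE a in lborel. AE z in lborel. (a, z) \<in> ?S"
    using AE_lborel_commute[OF S] by simp
  then show ?thesis
    by (rule eventually_mono) (auto elim!: eventually_mono simp: subsetD[OF N'(2)] dest: subsetD[OF N'(2)])
qed

section \<open>Projections to coordinate planes and generic grids\<close>

definition coord_pair :: "'m \<Rightarrow> 'm \<Rightarrow> real^'m \<Rightarrow> real^2"
  where "coord_pair i j v = (\<chi> k. if k = 1 then v $ i else v $ j)"

lemma coord_pair_nth [simp]: "coord_pair i j v $ 1 = v $ i" "coord_pair i j v $ 2 = v $ j"
  by (simp_all add: coord_pair_def)

lemma linear_coord_pair: "linear (coord_pair i j)"
  by (intro linearI) (simp_all add: coord_pair_def vec_eq_iff)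

lemma convex_hull_3_cone_point:
  "convex hull {a, p, q} = cone_point a p q ` {z. 0 \<le> z$1 \<and> 0 \<le> z$2 \<and> z$1 + z$2 \<le> 1}"
proof (intro equalityI subsetI)
  fix x assume "x \<in> convex hull {a, p, q}"
  then obtain u v w where uvw: "0 \<le> u" "0 \<le> v" "0 \<le> w" "u + v + w = 1" "x = u *\<^sub>R a + v *\<^sub>R p + w *\<^sub>R q"
    unfolding convex_hull_3 by blast
  define z :: "real^2" where "z = (\<chi> k. if k = 1 then v else w)"
  have z: "z $ 1 = v" "z $ 2 = w" by (simp_all add: z_def)
  have "u = 1 - v - w" using uvw by simp
  then have "x = cone_point a p q z" using uvw z by (simp add: cone_point_def)
  then show "x \<in> cone_point a p q ` {z. 0 \<le> z$1 \<and> 0 \<le> z$2 \<and> z$1 + z$2 \<le> 1}"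
    using uvw z by (intro image_eqI[of _ _ z]) auto
next
  fix x assume "x \<in> cone_point a p q ` {z. 0 \<le> z$1 \<and> 0 \<le> z$2 \<and> z$1 + z$2 \<le> 1}"
  then obtain z :: "real^2" where z: "0 \<le> z$1" "0 \<le> z$2" "z$1 + z$2 \<le> 1" "x = cone_point a p q z" by blast
  show "x \<in> convex hull {a, p, q}"
    unfolding convex_hull_3
    using z by (intro CollectI exI[of _ "1 - z$1 - z$2"] exI[of _ "z$1"] exI[of _ "z$2"]) (auto simp: cone_point_def)
qed

text \<open>Parameters and values both live in a plane. Where the image point is good, the rank is
  below two and Sard's argument applies; the bad parameters are a null set, which the Lipschitz map
  \<open>G\<close> between planes sends to a null set.\<close>

lemma negligible_coord_pair_triangle:
  fixes F :: "real^'n \<Rightarrow> real^'m"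
  assumes lip: "L-lipschitz_on UNIV F"
    and good: "AE z in lborel. cone_point a p q z \<notin> {y \<in> B. \<not> (F differentiable (at y) \<and> rank (jacobian F (at y)) \<le> 1)}"
    and B: "convex hull {a, p, q} \<subseteq> B"
  shows "negligible (coord_pair i j ` F ` (convex hull {a, p, q}))"
proof -
  let ?N = "{y \<in> B. \<not> (F differentiable (at y) \<and> rank (jacobian F (at y)) \<le> 1)}"
  let ?T = "{z :: real^2. 0 \<le> z$1 \<and> 0 \<le> z$2 \<and> z$1 + z$2 \<le> 1}"
  let ?c = "cone_point a p q"
  define G where "G = (\<lambda>z. coord_pair i j (F (?c z)))"
  let ?c' = "\<lambda>h :: real^2. h$1 *\<^sub>R (p - a) + h$2 *\<^sub>R (q - a)"
  have c': "(?c has_derivative ?c') (at z)" for z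
  proof -
    have "?c = (\<lambda>z. a + (z$1 *\<^sub>R (p - a) + z$2 *\<^sub>R (q - a)))"
      by (auto simp: cone_point_def algebra_simps)
    moreover have "bounded_linear ?c'"
      by (intro bounded_linear_add bounded_linear_scaleR_const bounded_linear_vec_nth)
    ultimately show ?thesis
      using has_derivative_add[OF has_derivative_const bounded_linear_imp_has_derivative, of ?c' a "at z"] by simp
  qed
  have good_part: "negligible (G ` {z \<in> ?T. ?c z \<notin> ?N})"
  proof (rule baby_Sard)
    fix z assume z: "z \<in> {z \<in> ?T. ?c z \<notin> ?N}"
    then have "?c z \<in> B" using B convex_hull_3_cone_point[of a p q] by blast
    then have d: "F differentiable (at (?c z))" and rk: "rank (jacobian F (at (?c z))) \<le> 1" using z by auto
    let ?F' = "frechet_derivative F (at (?c z))"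
    have F': "(F has_derivative ?F') (at (?c z))" using d frechet_derivative_works by blast
    let ?G' = "\<lambda>h. coord_pair i j (?F' (?c' h))"
    have G': "(G has_derivative ?G') (at z)"
      unfolding G_def
      by (rule bounded_linear.has_derivative[OF linear_conv_bounded_linear[THEN iffD1, OF linear_coord_pair]
          has_derivative_compose[OF c' F']])
    then show "(G has_derivative ?G') (at z within {z \<in> ?T. ?c z \<notin> ?N})"
      by (rule has_derivative_at_withinI)
    have "rank (matrix ?G') = dim (range ?G')"
      using has_derivative_linear[OF G'] by (simp add: rank_dim_range matrix_works)
    also have "\<dots> \<le> dim (coord_pair i j ` range ?F')" by (intro dim_subset) auto
    also have "\<dots> \<le> dim (range ?F')" by (rule dim_image_le[OF linear_coord_pair])
    also have "\<dots> = rank (jacobian F (at (?c z)))"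
      using has_derivative_linear[OF F'] by (simp add: rank_dim_range matrix_works jacobian_def)
    finally show "rank (matrix ?G') < CARD(2)" using rk by simp
  qed simp
  have lipG: "\<exists>D. \<forall>z w. norm (G z - G w) \<le> D * norm (z - w)"
  proof -
    obtain D1 where D1: "\<And>v. norm (coord_pair i j v) \<le> D1 * norm v" "D1 > 0"
      using linear_bounded_pos[OF linear_coord_pair, of i j] by metis
    have "linear ?c'" by (intro linearI) (simp_all add: algebra_simps)
    then obtain D2 where D2: "\<And>h. norm (?c' h) \<le> D2 * norm h" "D2 > 0"
      using linear_bounded_pos[of ?c'] by metis
    have "norm (G z - G w) \<le> (D1 * (L * D2)) * norm (z - w)" for z w
    proof -
      have "norm (G z - G w) = norm (coord_pair i j (F (?c z) - F (?c w)))"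
        by (simp add: G_def linear_diff[OF linear_coord_pair])
      also have "\<dots> \<le> D1 * norm (F (?c z) - F (?c w))" by (rule D1)
      also have "\<dots> \<le> D1 * (L * norm (?c z - ?c w))"
        using D1(2) lipschitz_on_normD[OF lip] by (intro mult_left_mono) auto
      also have "?c z - ?c w = ?c' (z - w)" by (simp add: cone_point_def algebra_simps)
      also have "D1 * (L * norm (?c' (z - w))) \<le> D1 * (L * (D2 * norm (z - w)))"
        using D1(2) lipschitz_on_nonneg[OF lip] by (intro mult_left_mono D2(1)) auto
      finally show ?thesis by (simp add: mult_ac)
    qed
    then show ?thesis by blast
  qed
  have "negligible {z. ?c z \<in> ?N}" using good unfolding AE_lborel_iff_negligible by simp
  then have bad_part: "negligible (G ` {z. ?c z \<in> ?N})"
    using lipG by (intro negligible_locally_Lipschitz_image) (auto intro: exI[of _ UNIV])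
  have "coord_pair i j ` F ` (convex hull {a, p, q}) = G ` ?T"
    unfolding convex_hull_3_cone_point G_def by (simp add: image_image)
  also have "\<dots> \<subseteq> G ` {z \<in> ?T. ?c z \<notin> ?N} \<union> G ` {z. ?c z \<in> ?N}" by blast
  finally show ?thesis by (rule negligible_subset[OF negligible_Un[OF good_part bad_part]])
qed

text \<open>Fubini over the translates of the plane spanned by the axes \<open>i\<close> and
  \<open>j\<close>, on which \<open>coord_pair i j\<close> acts as a translation.\<close>

lemma AE_coord_pair_avoids:
  assumes J: "negligible J" and ij: "i \<noteq> j"
  shows "AE t in lborel. coord_pair i j (t :: real^'m) \<notin> J"
proof -
  obtain J' where J': "J' \<in> sets borel" "J \<subseteq> J'" "negligible J'" using negligible_borel_superset[OF J] .
  have "(coord_pair i j :: real^'m \<Rightarrow> _) \<in> borel_measurable borel"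
    using linear_coord_pair
    by (intro borel_measurable_continuous_onI linear_continuous_on) (simp add: linear_conv_bounded_linear)
  from measurable_sets[OF this J'(1)]
  have S: "- (coord_pair i j -` J' :: (real^'m) set) \<in> sets borel" by (simp add: borel_comp)
  have "AE t in lborel. t \<in> - (coord_pair i j -` J' :: (real^'m) set)"
  proof (rule AE_lborel_slices[OF S, where c = "\<lambda>z :: real^2. z$1 *\<^sub>R axis i 1 + z$2 *\<^sub>R axis j 1"])
    fix t :: "real^'m"
    have "coord_pair i j (t + (z$1 *\<^sub>R axis i 1 + z$2 *\<^sub>R axis j 1)) = coord_pair i j t + z" for z :: "real^2"
      using ij by (simp add: vec_eq_iff forall_2 axis_def)
    moreover have "negligible {z. coord_pair i j t + z \<in> J'}"
    proof -
      have "{z. coord_pair i j t + z \<in> J'} = (+) (- coord_pair i j t) ` J'"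
        by (auto simp: image_iff algebra_simps)
      then show ?thesis using negligible_translation[OF J'(3)] by metis
    qed
    ultimately show "AE z :: real^2 in lborel. t + (z$1 *\<^sub>R axis i 1 + z$2 *\<^sub>R axis j 1) \<in> - (coord_pair i j -` J')"
      by (simp add: AE_lborel_iff_negligible)
  qed (intro continuous_intros)
  then show ?thesis by (rule eventually_mono) (use J' in auto)
qed

text \<open>A violation for \<open>i\<close> and \<open>j\<close> means that this pair of
  coordinates of \<open>F y\<close> is a point \<open>t + sh k l\<close> of the shifted lattice.
  Each lattice vector excludes a null set of shifts \<open>t\<close>, and there are countably many
  lattice vectors.\<close>

lemma generic_grid:
  fixes F :: "'a \<Rightarrow> real^'m"
  assumes J: "\<And>i j. i \<noteq> j \<Longrightarrow> negligible (coord_pair i j ` F ` K)" and \<epsilon>: "\<epsilon> > 0"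
  obtains t where "\<And>y i j. \<lbrakk>y \<in> K; i \<noteq> j; (F y $ i - t $ i) / \<epsilon> \<in> \<int>\<rbrakk> \<Longrightarrow> (F y $ j - t $ j) / \<epsilon> \<notin> \<int>"
proof -
  define sh :: "int \<Rightarrow> int \<Rightarrow> real^2" where "sh k l = (\<chi> n. if n = 1 then \<epsilon> * of_int k else \<epsilon> * of_int l)" for k l
  have "AE t in lborel. \<forall>i j. i \<noteq> j \<longrightarrow> (\<forall>k l. coord_pair i j (t :: real^'m) + sh k l \<notin> coord_pair i j ` F ` K)"
  proof -
    have "AE t in lborel. i \<noteq> j \<longrightarrow> coord_pair i j (t :: real^'m) + sh k l \<notin> coord_pair i j ` F ` K" for i j k l
    proof (cases "i = j")
      case False
      have "negligible ((+) (- sh k l) ` (coord_pair i j ` F ` K))" using J[OF False] by (rule negligible_translation)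
      from AE_coord_pair_avoids[OF this False] show ?thesis
        by (rule eventually_mono) (auto simp: image_iff algebra_simps)
    qed simp
    then have "AE t in lborel. \<forall>i j k l. i \<noteq> j \<longrightarrow> coord_pair i j (t :: real^'m) + sh k l \<notin> coord_pair i j ` F ` K"
      by (simp add: AE_all_countable)
    then show ?thesis by (rule eventually_mono) blast
  qed
  from AE_lborel_ex[OF this] obtain t :: "real^'m"
    where t: "\<forall>i j. i \<noteq> j \<longrightarrow> (\<forall>k l. coord_pair i j t + sh k l \<notin> coord_pair i j ` F ` K)"
    by (rule exE)
  show thesis
  proof (rule that)
    fix y i j assume y: "y \<in> K" "i \<noteq> j" "(F y $ i - t $ i) / \<epsilon> \<in> \<int>"
    show "(F y $ j - t $ j) / \<epsilon> \<notin> \<int>"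
    proof
      assume "(F y $ j - t $ j) / \<epsilon> \<in> \<int>"
      then obtain l where l: "(F y $ j - t $ j) / \<epsilon> = of_int l" by (rule Ints_cases)
      obtain k where k: "(F y $ i - t $ i) / \<epsilon> = of_int k" using y(3) by (rule Ints_cases)
      have "F y $ i = t $ i + \<epsilon> * of_int k" "F y $ j = t $ j + \<epsilon> * of_int l"
        using k l \<epsilon> by (simp_all add: field_simps)
      then have "coord_pair i j t + sh k l = coord_pair i j (F y)"
        by (simp add: vec_eq_iff forall_2 sh_def)
      then have "coord_pair i j t + sh k l \<in> coord_pair i j ` F ` K" using y(1) by simp
      then show False using t y(2) by blast
    qed
  qed
qed

text \<open>A continuous substitute for the floor, which is constant except on the last piece of
  length \<rho> of each unit interval, where it climbs to the next integer. A non-integral value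
  therefore means that \<open>z\<close> is close to a wall of the grid: crossing a wall becomes
  moving along an edge of the dual grid.\<close>

definition stair :: "real \<Rightarrow> real \<Rightarrow> real"
  where "stair \<rho> z = of_int \<lfloor>z\<rfloor> + max 0 ((frac z - 1 + \<rho>) / \<rho>)"

text \<open>One formula is valid on the closed interval, the jump point of the floor included, so
  that continuity follows by gluing neighbouring intervals.\<close>

lemma stair_on_interval:
  assumes \<rho>: "0 < \<rho>" "\<rho> \<le> 1" and z: "of_int k \<le> z" "z \<le> of_int k + 1"
  shows "stair \<rho> z = of_int k + max 0 ((z - of_int k - 1 + \<rho>) / \<rho>)"
proof (cases "z = of_int k + 1")
  case True
  then have "\<lfloor>z\<rfloor> = k + 1" "frac z = 0" by (simp_all add: frac_def)
  moreover have "(\<rho> - 1) / \<rho> \<le> 0" using \<rho> by (simp add: divide_le_0_iff)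
  ultimately show ?thesis using True \<rho> by (simp add: stair_def max_def)
next
  case False
  then have "\<lfloor>z\<rfloor> = k" using z by (intro floor_unique) auto
  then show ?thesis by (simp add: stair_def frac_def)
qed

lemma continuous_stair:
  assumes \<rho>: "0 < \<rho>" "\<rho> \<le> 1"
  shows "continuous_on UNIV (stair \<rho>)"
proof -
  have piece: "continuous_on {of_int k..of_int k + 1} (stair \<rho>)" for k
  proof -
    have "continuous_on {of_int k..of_int k + 1} (\<lambda>z. of_int k + max 0 ((z - of_int k - 1 + \<rho>) / \<rho>))"
      using \<rho> by (intro continuous_intros) auto
    then show ?thesis
      by (rule continuous_on_eq) (auto simp: stair_on_interval[OF \<rho>, of k])
  qed
  have "isCont (stair \<rho>) z" for z
  proof -
    let ?k = "\<lfloor>z\<rfloor>"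
    have "continuous_on ({of_int (?k - 1)..of_int (?k - 1) + 1} \<union> {of_int ?k..of_int ?k + 1}) (stair \<rho>)"
      by (intro continuous_on_closed_Un piece) auto
    moreover have "{of_int (?k - 1)..of_int (?k - 1) + 1} \<union> {of_int ?k..of_int ?k + 1} = {of_int ?k - 1..of_int ?k + (1::real)}"
      by auto
    ultimately have "continuous_on {of_int ?k - 1..of_int ?k + 1} (stair \<rho>)" by simp
    then have "continuous_on {of_int ?k - 1<..<of_int ?k + 1} (stair \<rho>)"
      by (rule continuous_on_subset) auto
    moreover have "z \<in> {of_int ?k - 1<..<of_int ?k + 1}" using floor_correct[of z] by simp linarith
    ultimately show ?thesis by (simp add: continuous_on_eq_continuous_at)
  qed
  then show ?thesis by (simp add: continuous_at_imp_continuous_on)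
qed

lemma stair_approx:
  assumes "0 < \<rho>" "\<rho> \<le> 1"
  shows "\<bar>stair \<rho> z - z\<bar> \<le> 1"
proof -
  have "(frac z - 1 + \<rho>) / \<rho> \<le> 1" using assms frac_lt_1[of z] by (simp add: divide_le_eq)
  then have "of_int \<lfloor>z\<rfloor> \<le> stair \<rho> z" "stair \<rho> z \<le> of_int \<lfloor>z\<rfloor> + 1" by (auto simp: stair_def)
  then show ?thesis using floor_correct[of z] by linarith
qed

lemma stair_not_Ints:
  assumes "0 < \<rho>" "stair \<rho> z \<notin> \<int>"
  shows "infdist z \<int> < \<rho>"
proof -
  have "\<not> (frac z - 1 + \<rho>) / \<rho> \<le> 0"
  proof
    assume "(frac z - 1 + \<rho>) / \<rho> \<le> 0"
    then have "stair \<rho> z = of_int \<lfloor>z\<rfloor>" by (simp add: stair_def)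
    then show False using assms by simp
  qed
  then have "1 - frac z < \<rho>" using assms by (simp add: zero_less_divide_iff not_le)
  moreover have "infdist z \<int> \<le> dist z (of_int (\<lfloor>z\<rfloor> + 1))" by (intro infdist_le) simp
  moreover have "dist z (of_int (\<lfloor>z\<rfloor> + 1)) = 1 - frac z"
    using frac_lt_1[of z] by (simp add: dist_real_def frac_def)
  ultimately show ?thesis by linarith
qed

text \<open>By compactness the image of \<open>K\<close> keeps a distance from the codimension two
  skeleton: no two coordinates are within \<rho> of integers at the same point. The staircase of
  width \<rho> then leaves at most one coordinate non-integral.\<close>

lemma push_to_grid:
  fixes Y :: "'a::metric_space \<Rightarrow> real^'m"
  assumes K: "compact K" and Y: "continuous_on K Y"
    and avoid: "\<And>y i j. \<lbrakk>y \<in> K; i \<noteq> j; Y y $ i \<in> \<int>\<rbrakk> \<Longrightarrow> Y y $ j \<notin> \<int>"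
  obtains A :: "'a \<Rightarrow> real^'m" where "continuous_on K A" "\<And>x. x \<in> K \<Longrightarrow> \<exists>i. \<forall>j. j \<noteq> i \<longrightarrow> A x $ j \<in> \<int>"
    "\<And>x i. \<bar>(A x - Y x) $ i\<bar> \<le> 1"
proof -
  let ?d = "\<lambda>i j y. infdist (Y y $ i) \<int> + infdist (Y y $ j) \<int>"
  have "\<exists>\<rho>>0. \<forall>y\<in>K. \<rho> \<le> ?d i j y" if ij: "i \<noteq> j" for i j
  proof (cases "K = {}")
    case False
    have "continuous_on K (?d i j)" using Y by (intro continuous_intros)
    then obtain y where y: "y \<in> K" "\<And>z. z \<in> K \<Longrightarrow> ?d i j y \<le> ?d i j z"
      using continuous_attains_inf[OF K False] by blast
    have "infdist (Y y $ l) \<int> = 0 \<longleftrightarrow> Y y $ l \<in> \<int>" for l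
      using in_closed_iff_infdist_zero[of "\<int> :: real set" "Y y $ l"] Ints_0 closed_Ints by blast
    then have "?d i j y \<noteq> 0"
      using avoid[OF y(1) ij] infdist_nonneg[of "Y y $ i" \<int>] infdist_nonneg[of "Y y $ j" \<int>] by (auto simp: add_nonneg_eq_0_iff)
    then have "?d i j y > 0"
      using infdist_nonneg[of "Y y $ i" \<int>] infdist_nonneg[of "Y y $ j" \<int>] by linarith
    then show ?thesis using y by blast
  qed (auto intro: exI[of _ 1])
  then obtain \<rho>f where \<rho>f: "\<And>i j. i \<noteq> j \<Longrightarrow> \<rho>f i j > 0 \<and> (\<forall>y\<in>K. \<rho>f i j \<le> ?d i j y)" by metis
  \<comment> \<open>Halved because \<open>\<rho>f\<close> bounds a sum of two distances. The element
    1 keeps the set non-empty when there is only one coordinate and ensures \<rho> \<le> 1.\<close>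
  define \<rho> where "\<rho> = Min (insert 1 ((\<lambda>(i, j). \<rho>f i j / 2) ` {(i, j). i \<noteq> j}))"
  have fin: "finite (insert 1 ((\<lambda>(i, j). \<rho>f i j / 2) ` {(i :: 'm, j). i \<noteq> j}))" by simp
  have \<rho>: "0 < \<rho>" "\<rho> \<le> 1" unfolding \<rho>_def using fin \<rho>f by (auto simp: Min_gr_iff)
  have \<rho>d: "2 * \<rho> \<le> ?d i j y" if "i \<noteq> j" "y \<in> K" for i j y
  proof -
    have "\<rho> \<le> \<rho>f i j / 2" unfolding \<rho>_def using fin that by (intro Min_le) auto
    then show ?thesis using \<rho>f[OF that(1)] that(2) by force
  qed
  define A where "A x = (\<chi> i. stair \<rho> (Y x $ i))" for x
  show thesis
  proof (rule that)
    show "continuous_on K A"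
      unfolding A_def by (intro continuous_on_vec_lambda continuous_on_compose2[OF continuous_stair[OF \<rho>]] continuous_intros Y) auto
    show "\<bar>(A x - Y x) $ i\<bar> \<le> 1" for x i
      using stair_approx[OF \<rho>] by (simp add: A_def)
    fix x assume x: "x \<in> K"
    show "\<exists>i. \<forall>j. j \<noteq> i \<longrightarrow> A x $ j \<in> \<int>"
    proof (rule ccontr)
      assume n: "\<not> ?thesis"
      then obtain i where i: "A x $ i \<notin> \<int>" by blast
      then obtain j where j: "j \<noteq> i" "A x $ j \<notin> \<int>" using n by blast
      have "infdist (Y x $ i) \<int> < \<rho>" "infdist (Y x $ j) \<int> < \<rho>"
        using stair_not_Ints[OF \<rho>(1)] i j by (auto simp: A_def)
      then show False using \<rho>d[of i j x] j x by auto
    qed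
  qed
qed

section \<open>Approximation\<close>

context tree_net begin

lemma smooth_approx:
  fixes W :: "'e \<Rightarrow> 'b::real_normed_vector"
  assumes W: "\<And>e. e \<in> I \<Longrightarrow> norm (W e) \<le> 1" and C: "compact C"
    and net: "\<And>x. x \<in> C \<Longrightarrow> \<exists>y0\<in>P. dist x y0 < r"
  obtains p where "\<forall>e\<in>I. real_polynomial_function (p e)"
    "\<forall>y\<in>C. \<forall>e\<in>I. \<forall>e'\<in>I. e \<noteq> e' \<longrightarrow> p e y \<in> {0<..<1} \<longrightarrow> p e' y \<notin> {0<..<1}"
    "\<forall>x\<in>C. \<exists>y\<in>K. dist x y < 2 * r \<and>
      norm ((\<Sum>e\<in>I. smooth_step (p e x) *\<^sub>R W e) - (\<Sum>e\<in>I. s e y *\<^sub>R W e)) \<le> 3"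
proof -
  have "\<exists>q. real_polynomial_function q \<and> (\<forall>x\<in>C. \<bar>\<tau> e x - q x\<bar> < 1/10)" for e
  proof -
    have c: "continuous_on C (\<tau> e)" using continuous_on_subset[OF continuous_\<tau> subset_UNIV] .
    show ?thesis by (rule Stone_Weierstrass_real_polynomial_function[OF C c, of "1/10"]) auto
  qed
  then obtain q where q: "\<And>e. real_polynomial_function (q e)" "\<And>e x. x \<in> C \<Longrightarrow> \<bar>\<tau> e x - q e x\<bar> < 1/10"
    by metis
  \<comment> \<open>With an error below 1/10, \<tau> = 0 makes \<open>p\<close> negative and \<tau>
    = 1 makes it larger than 1, while \<open>p\<close> in (0, 1) puts \<open>q\<close> between 1/4
    and 3/4 and so \<tau> strictly between 0 and 1. The exact disjointness of the transitions thus
    survives the polynomial approximation.\<close>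
  define p where "p e x = 2 * q e x + (- 1/2)" for e x
  have p: "real_polynomial_function (p e)" for e
    unfolding p_def[abs_def]
    by (intro real_polynomial_function.intros(2-4) q)
  have part: "0 < \<tau> e y" "\<tau> e y < 1" if "y \<in> C" "p e y \<in> {0<..<1}" for e y
    using q(2)[OF that(1), of e] that(2) unfolding p_def abs_less_iff by (simp_all; linarith)+
  show thesis
  proof (rule that[of p])
    show "\<forall>e\<in>I. real_polynomial_function (p e)" using p by blast
    have "p e' y \<notin> {0<..<1}" if y: "y \<in> C" "e \<in> I" "e' \<in> I" "e \<noteq> e'" "p e y \<in> {0<..<1}" for e e' y
    proof -
      obtain y0 where "y0 \<in> P" "dist y y0 < r" using net[OF y(1)] by blast
      then have "\<tau> e' y = 0 \<or> \<tau> e' y = 1" using \<tau>_disjoint y part[OF y(1,5)] by blast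
      then show ?thesis using part[OF y(1), of e'] by auto
    qed
    then show "\<forall>y\<in>C. \<forall>e\<in>I. \<forall>e'\<in>I. e \<noteq> e' \<longrightarrow> p e y \<in> {0<..<1} \<longrightarrow> p e' y \<notin> {0<..<1}"
      by blast
  next
    show "\<forall>x\<in>C. \<exists>y\<in>K. dist x y < 2 * r \<and>
      norm ((\<Sum>e\<in>I. smooth_step (p e x) *\<^sub>R W e) - (\<Sum>e\<in>I. s e y *\<^sub>R W e)) \<le> 3"
    proof
      fix x assume x: "x \<in> C"
      then obtain y0 where y0: "y0 \<in> P" "dist x y0 < r" using net by blast
      obtain y where y: "y \<in> K" "dist x y < 2 * r" "(\<Sum>e\<in>I. \<bar>s e y - \<tau> e x\<bar>) \<le> 2"
        using \<tau>_sum_approx[OF y0] .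
      \<comment> \<open>The smooth step is exact where \<tau> is 0 or 1, and at most one cut is in
        neither state: this adds 1 to the 2 from \<open>\<tau>_sum_approx\<close>.\<close>
      have step: "\<bar>smooth_step (p e x) - \<tau> e x\<bar> \<le> (if \<tau> e x \<in> {0, 1} then 0 else 1)" for e
      proof -
        have a: "\<bar>\<tau> e x - q e x\<bar> < 1/10" by (rule q(2)[OF x])
        consider "\<tau> e x = 0" | "\<tau> e x = 1" | "\<tau> e x \<notin> {0, 1}" by blast
        then show ?thesis
        proof cases
          case 1
          then have "p e x \<le> 0" using a unfolding p_def by linarith
          then show ?thesis using 1 smooth_step_props(1) by simp
        next
          case 2
          then have "1 \<le> p e x" using a unfolding p_def by linarith
          then show ?thesis using 2 smooth_step_props(2) by simp
        next
          case 3
          then show ?thesis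
            using \<tau>_range[of e x] smooth_step_props(3,4)[of "p e x"] by (simp add: abs_le_iff)
        qed
      qed
      have "(\<Sum>e\<in>I. \<bar>smooth_step (p e x) - \<tau> e x\<bar>) \<le> (\<Sum>e\<in>I. if \<tau> e x \<in> {0, 1} then 0 else 1)"
        by (intro sum_mono step)
      also have "\<dots> = real (card {e \<in> I. \<tau> e x \<notin> {0, 1}})"
        using finite_I by (simp add: sum.If_cases Int_def)
      also have "\<dots> \<le> 1" using card_partial_\<tau>[OF y0] by simp
      finally have 1: "(\<Sum>e\<in>I. \<bar>smooth_step (p e x) - \<tau> e x\<bar>) \<le> 1" .
      have "norm ((\<Sum>e\<in>I. smooth_step (p e x) *\<^sub>R W e) - (\<Sum>e\<in>I. s e y *\<^sub>R W e))
          = norm (\<Sum>e\<in>I. (smooth_step (p e x) - s e y) *\<^sub>R W e)"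
        by (simp add: sum_subtractf scaleR_diff_left)
      also have "\<dots> \<le> (\<Sum>e\<in>I. \<bar>smooth_step (p e x) - \<tau> e x\<bar> + \<bar>s e y - \<tau> e x\<bar>)"
      proof (rule sum_norm_le)
        fix e assume e: "e \<in> I"
        have "norm ((smooth_step (p e x) - s e y) *\<^sub>R W e) \<le> \<bar>smooth_step (p e x) - s e y\<bar> * 1"
          using W[OF e] unfolding norm_scaleR by (intro mult_left_mono) auto
        then show "norm ((smooth_step (p e x) - s e y) *\<^sub>R W e) \<le> \<bar>smooth_step (p e x) - \<tau> e x\<bar> + \<bar>s e y - \<tau> e x\<bar>"
          using abs_triangle_ineq4[of "smooth_step (p e x) - \<tau> e x" "s e y - \<tau> e x"] by simp
      qed
      also have "\<dots> \<le> 3" using 1 y(3) by (simp add: sum.distrib)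
      finally show "\<exists>y\<in>K. dist x y < 2 * r \<and>
        norm ((\<Sum>e\<in>I. smooth_step (p e x) *\<^sub>R W e) - (\<Sum>e\<in>I. s e y *\<^sub>R W e)) \<le> 3"
        using y by blast
    qed
  qed
qed

end

section \<open>Approximation on a single ball\<close>

lemma finite_net_of_ball:
  fixes x0 :: "'a::euclidean_space"
  assumes "R > 0" "r > 0"
  obtains P where "finite P" "P \<subseteq> ball x0 R" "P \<noteq> {}" "\<And>x. x \<in> cball x0 R \<Longrightarrow> \<exists>p\<in>P. dist x p < r"
proof -
  \<comment> \<open>The centres are in the open ball because the triangles must stay inside it, but
    they serve the closed ball because polynomial approximation needs a compact set.\<close>
  have "cball x0 R \<subseteq> (\<Union>p\<in>ball x0 R. ball p r)"
  proof
    fix x assume "x \<in> cball x0 R"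
    then have "x \<in> closure (ball x0 R)" using assms by simp
    then obtain y where "y \<in> ball x0 R" "dist y x < r" using assms(2) unfolding closure_approachable by blast
    then show "x \<in> (\<Union>p\<in>ball x0 R. ball p r)" by auto
  qed
  then obtain P where P: "P \<subseteq> ball x0 R" "finite P" "cball x0 R \<subseteq> (\<Union>p\<in>P. ball p r)"
    using compactE_image[OF compact_cball[of x0 R], of "ball x0 R" "\<lambda>p. ball p r"] by auto
  show thesis
  proof (rule that[OF P(2,1)])
    show "\<exists>p\<in>P. dist x p < r" if x: "x \<in> cball x0 R" for x
    proof -
      obtain p where "p \<in> P" "x \<in> ball p r" using P(3) x by blast
      then show ?thesis by (auto simp: dist_commute)
    qed
    show "P \<noteq> {}" using P(3) assms(1) by fastforce
  qed
qed

text \<open>The common apex makes \<open>K\<close> starlike and hence contractible, as the logarithm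
  requires. A finite union of compact convex sets is an ANR, which yields local connectedness. The
  sides opposite to the apex are the segments along which net points are joined.\<close>

lemma cone_complex:
  fixes a :: "'a::euclidean_space"
  assumes P: "finite P" "P \<noteq> {}"
  defines "K \<equiv> \<Union>(p, q)\<in>P \<times> P. convex hull {a, p, q}"
  shows "compact K" "connected K" "contractible K" "locally connected K"
    "\<And>p q. \<lbrakk>p \<in> P; q \<in> P\<rbrakk> \<Longrightarrow> closed_segment p q \<subseteq> K" "P \<subseteq> K"
proof -
  let ?T = "(\<lambda>(p, q). convex hull {a, p, q}) ` (P \<times> P)"
  have K: "K = \<Union>?T" unfolding K_def by simp
  show cK: "compact K"
    unfolding K_def using P by (intro compact_UN) (auto simp: finite_imp_compact_convex_hull)
  have a: "a \<in> K" using P(2) unfolding K_def by (auto intro: hull_inc)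
  have star: "starlike K"
    unfolding starlike_def
  proof (intro bexI[OF _ a] ballI)
    fix x assume "x \<in> K"
    then obtain p q where pq: "p \<in> P" "q \<in> P" "x \<in> convex hull {a, p, q}" unfolding K_def by blast
    then have "closed_segment a x \<subseteq> convex hull {a, p, q}"
      by (intro closed_segment_subset) (auto intro: hull_inc)
    then show "closed_segment a x \<subseteq> K" using pq unfolding K_def by blast
  qed
  then show "contractible K" by (rule starlike_imp_contractible)
  then show "connected K" by (rule contractible_imp_connected)
  have "ANR K"
    unfolding K
  proof (rule ANR_finite_Union_convex_closed)
    show "finite ?T" using P by simp
  qed (auto intro!: compact_imp_closed simp: finite_imp_compact_convex_hull)
  then show "locally connected K" by (rule ANR_imp_locally_connected)
  show seg: "closed_segment p q \<subseteq> K" if "p \<in> P" "q \<in> P" for p q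
  proof -
    have "closed_segment p q \<subseteq> convex hull {a, p, q}"
      by (intro closed_segment_subset) (auto intro: hull_inc)
    then show ?thesis using that unfolding K_def by blast
  qed
  show "P \<subseteq> K" using seg by (metis ends_in_segment(1) subsetD subsetI)
qed

lemma lipschitz_rank_one_smooth_approx:
  fixes F :: "real^'n \<Rightarrow> real^'m" and \<epsilon> :: real
  assumes lip: "L-lipschitz_on UNIV F" and R: "R > 0" and \<epsilon>: "\<epsilon> > 0"
    and null: "negligible {y \<in> ball x0 R. \<not> (F differentiable (at y) \<and> rank (jacobian F (at y)) \<le> 1)}"
  shows "\<exists>g. smooth_on (ball x0 R) g \<and> (\<forall>y\<in>ball x0 R. rank (jacobian g (at y)) \<le> 1) \<and>
    (\<forall>y\<in>ball x0 R. norm (g y - F y) \<le> \<epsilon> * (4 + 2 * CARD('m)))"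
proof -
  let ?B = "ball x0 R"
  let ?N = "{y \<in> ?B. \<not> (F differentiable (at y) \<and> rank (jacobian F (at y)) \<le> 1)}"
  have L0: "L \<ge> 0" using lip lipschitz_on_nonneg by blast
  \<comment> \<open>Points at distance up to \<open>2 * r\<close> have values of \<open>F\<close>
    that differ by at most \<epsilon>, the mesh of the grid.\<close>
  define r where "r = \<epsilon> / (2 * (L + 1))"
  have r: "r > 0" using \<epsilon> L0 by (simp add: r_def)
  have Lr: "L * (2 * r) \<le> \<epsilon>"
  proof -
    have "L * (2 * r) \<le> (L + 1) * (2 * r)" using r by (intro mult_right_mono) auto
    also have "\<dots> = \<epsilon>" using L0 by (simp add: r_def field_simps)
    finally show ?thesis .
  qed
  obtain P where P: "finite P" "P \<subseteq> ?B" "P \<noteq> {}" "\<And>x. x \<in> cball x0 R \<Longrightarrow> \<exists>p\<in>P. dist x p < r"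
    by (rule finite_net_of_ball[OF R r, of x0]) blast
  obtain p0 where p0: "p0 \<in> P" using P(3) by blast
  \<comment> \<open>Finitely many pairs exclude only a null set of apices, and the ball is not null,
    so a common generic apex can be chosen inside it.\<close>
  have "AE a in lborel. \<forall>(p, q)\<in>P \<times> P. AE z in lborel. cone_point a p q z \<notin> ?N"
    using P(1) AE_apex[OF null] by (subst AE_ball_countable) (auto intro: countable_finite)
  then have "negligible {a. \<not> (\<forall>(p, q)\<in>P \<times> P. AE z in lborel. cone_point a p q z \<notin> ?N)}"
    unfolding AE_lborel_iff_negligible .
  moreover have "\<not> negligible ?B" using R by (intro open_not_negligible) auto
  ultimately have "\<not> ?B \<subseteq> {a. \<not> (\<forall>(p, q)\<in>P \<times> P. AE z in lborel. cone_point a p q z \<notin> ?N)}"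
    using negligible_subset by blast
  then obtain a where a: "a \<in> ?B" and a_pq: "\<forall>(p, q)\<in>P \<times> P. AE z in lborel. cone_point a p q z \<notin> ?N"
    by blast
  have apex: "AE z in lborel. cone_point a p q z \<notin> ?N" if "p \<in> P" "q \<in> P" for p q
    using bspec[OF a_pq, of "(p, q)"] that by simp
  define K where "K = (\<Union>(p, q)\<in>P \<times> P. convex hull {a, p, q})"
  note KP = cone_complex[OF P(1,3), where a = a, folded K_def]
  have tri: "convex hull {a, p, q} \<subseteq> ?B" if "p \<in> P" "q \<in> P" for p q
    using that a P(2) by (intro hull_minimal) auto
  have J: "negligible (coord_pair i j ` F ` K)" for i j
  proof -
    have "coord_pair i j ` F ` K = \<Union>((\<lambda>(p, q). coord_pair i j ` F ` (convex hull {a, p, q})) ` (P \<times> P))"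
      unfolding K_def by (auto simp: image_UN case_prod_unfold)
    also have "negligible \<dots>"
    proof (rule negligible_Union)
      fix T assume "T \<in> (\<lambda>(p, q). coord_pair i j ` F ` (convex hull {a, p, q})) ` (P \<times> P)"
      then obtain p q where "p \<in> P" "q \<in> P" "T = coord_pair i j ` F ` (convex hull {a, p, q})" by auto
      then show "negligible T" using negligible_coord_pair_triangle[OF lip apex tri] by simp
    qed (use P(1) in simp)
    finally show ?thesis .
  qed
  obtain t where t: "\<And>y i j. \<lbrakk>y \<in> K; i \<noteq> j; (F y $ i - t $ i) / \<epsilon> \<in> \<int>\<rbrakk> \<Longrightarrow> (F y $ j - t $ j) / \<epsilon> \<notin> \<int>"
    using generic_grid[OF J \<epsilon>] by metis
  \<comment> \<open>The rescaling turns the generic grid with origin \<open>t\<close> and mesh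
    \<epsilon> into the integer grid.\<close>
  define Y where "Y y = (1 / \<epsilon>) *\<^sub>R (F y - t)" for y
  have FY: "F y = t + \<epsilon> *\<^sub>R Y y" for y using \<epsilon> by (simp add: Y_def)
  have cF: "continuous_on UNIV F" using lip lipschitz_on_continuous_on by blast
  have cY: "continuous_on K Y" unfolding Y_def by (intro continuous_intros continuous_on_subset[OF cF]) auto
  obtain A where A: "continuous_on K A" "\<And>x. x \<in> K \<Longrightarrow> \<exists>i. \<forall>j. j \<noteq> i \<longrightarrow> A x $ j \<in> \<int>"
    "\<And>x i. \<bar>(A x - Y x) $ i\<bar> \<le> 1"
    using push_to_grid[OF KP(1) cY] t by (auto simp: Y_def)
  have p0K: "p0 \<in> K" using KP(6) p0 by blast
  obtain I :: "(real^'n) set set" and s W c where tree: "tree_cuts K I s p0" and W: "\<forall>e\<in>I. norm (W e) \<le> 1"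
    and As: "\<forall>y\<in>K. \<forall>i. \<bar>(A y - (c + (\<Sum>e\<in>I. s e y *\<^sub>R W e))) $ i\<bar> \<le> 1/2"
    by (rule grid_tree[OF KP(1-4) A(1,2) p0K])
  interpret tree_net K I s p0 P r
    by (intro tree_net.intro tree tree_net_axioms.intro P(1) p0 r) (rule KP(5))
  obtain p where p: "\<forall>e\<in>I. real_polynomial_function (p e)"
    "\<forall>y\<in>cball x0 R. \<forall>e\<in>I. \<forall>e'\<in>I. e \<noteq> e' \<longrightarrow> p e y \<in> {0<..<1} \<longrightarrow> p e' y \<notin> {0<..<1}"
    "\<forall>x\<in>cball x0 R. \<exists>y\<in>K. dist x y < 2 * r \<and>
      norm ((\<Sum>e\<in>I. smooth_step (p e x) *\<^sub>R W e) - (\<Sum>e\<in>I. s e y *\<^sub>R W e)) \<le> 3"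
    by (rule smooth_approx[OF bspec[OF W] compact_cball P(4)])
  define g where "g y = (t + \<epsilon> *\<^sub>R c) + (\<Sum>e\<in>I. smooth_step (p e y) *\<^sub>R (\<epsilon> *\<^sub>R W e))" for y
  have disj: "\<And>e e' y. \<lbrakk>y \<in> ?B; e \<in> I; e' \<in> I; e \<noteq> e'; p e y \<in> {0<..<1}\<rbrakk> \<Longrightarrow> p e' y \<notin> {0<..<1}"
    using p(2) ball_subset_cball by blast
  have g1: "smooth_on ?B g"
    unfolding g_def[abs_def]
    by (rule smooth_rank_one_sum(1)[OF open_ball finite_I]) (use p(1) disj in blast)+
  have g2: "rank (jacobian g (at y)) \<le> 1" if "y \<in> ?B" for y
    unfolding g_def[abs_def]
    by (rule smooth_rank_one_sum(2)[OF open_ball finite_I _ _ that]) (use p(1) disj in blast)+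
  have "norm (g x - F x) \<le> \<epsilon> * (4 + 2 * CARD('m))" if x: "x \<in> ?B" for x
  proof -
    let ?S = "\<Sum>e\<in>I. smooth_step (p e x) *\<^sub>R W e"
    have "x \<in> cball x0 R" using x by simp
    then obtain y where y: "y \<in> K" "dist x y < 2 * r" "norm (?S - (\<Sum>e\<in>I. s e y *\<^sub>R W e)) \<le> 3"
      using p(3) by blast
    let ?D = "A y - (c + (\<Sum>e\<in>I. s e y *\<^sub>R W e))"
    have D: "norm ?D \<le> CARD('m) / 2"
    proof -
      have "norm ?D \<le> (\<Sum>i\<in>UNIV. \<bar>?D $ i\<bar>)" by (rule norm_le_l1_cart)
      also have "\<dots> \<le> (\<Sum>i\<in>(UNIV :: 'm set). 1/2)" using As y(1) by (intro sum_mono) blast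
      finally show ?thesis by simp
    qed
    have AY: "norm (A y - Y y) \<le> CARD('m)"
    proof -
      have "norm (A y - Y y) \<le> (\<Sum>i\<in>UNIV. \<bar>(A y - Y y) $ i\<bar>)" by (rule norm_le_l1_cart)
      also have "\<dots> \<le> (\<Sum>i\<in>(UNIV :: 'm set). 1)" using A(3) by (intro sum_mono)
      finally show ?thesis by simp
    qed
    have YY: "norm (Y y - Y x) \<le> 1"
    proof -
      have "norm (F y - F x) \<le> L * norm (y - x)" using lipschitz_on_normD[OF lip] by simp
      also have "\<dots> \<le> L * (2 * r)" using y(2) L0 by (intro mult_left_mono) (auto simp: dist_norm norm_minus_commute)
      also have "\<dots> \<le> \<epsilon>" by (rule Lr)
      finally have "norm (F y - F x) \<le> \<epsilon>" .
      moreover have "Y y - Y x = (1 / \<epsilon>) *\<^sub>R (F y - F x)" by (simp add: Y_def scaleR_diff_right)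
      ultimately show ?thesis using \<epsilon> by (simp add: divide_le_eq)
    qed
    \<comment> \<open>Four errors in units of \<epsilon>: the smoothed cuts at \<open>x\<close>
      against the cuts at \<open>y\<close> (3), the tree against the grid map
      (\<open>CARD('m) / 2\<close>), pushing to the grid (\<open>CARD('m)\<close>), and moving from
      \<open>y\<close> to \<open>x\<close> (1).\<close>
    have "g x - F x = \<epsilon> *\<^sub>R ((?S - (\<Sum>e\<in>I. s e y *\<^sub>R W e)) - ?D + (A y - Y y) + (Y y - Y x))"
      by (simp add: g_def FY scaleR_sum_right algebra_simps)
    then have "norm (g x - F x) = \<epsilon> * norm ((?S - (\<Sum>e\<in>I. s e y *\<^sub>R W e)) - ?D + (A y - Y y) + (Y y - Y x))"
      using \<epsilon> by simp
    also have "\<dots> \<le> \<epsilon> * (3 + CARD('m) / 2 + CARD('m) + 1)"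
    proof (intro mult_left_mono)
      show "norm ((?S - (\<Sum>e\<in>I. s e y *\<^sub>R W e)) - ?D + (A y - Y y) + (Y y - Y x)) \<le> 3 + CARD('m) / 2 + CARD('m) + 1"
        by (intro norm_triangle_le add_mono norm_triangle_le_diff y(3) D AY YY)
    qed (use \<epsilon> in simp)
    also have "\<dots> \<le> \<epsilon> * (4 + 2 * CARD('m))" using \<epsilon> by (intro mult_left_mono) auto
    finally show ?thesis .
  qed
  then show ?thesis using g1 g2 by blast
qed

theorem corollary1p8:
  fixes f :: "real ^ 'n \<Rightarrow> real ^ 'm" and \<Omega> :: "(real ^ 'n) set"
  assumes "open \<Omega>"
    and "locally_lipschitz_on \<Omega> f"
    and "AE x in lebesgue_on \<Omega>.
           f differentiable (at x) \<longrightarrow> rank (jacobian f (at x)) \<le> 1"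
  shows "\<forall>x\<in>\<Omega>. \<exists>\<epsilon>>0. ball x \<epsilon> \<subseteq> \<Omega> \<and>
           (\<exists>g :: nat \<Rightarrow> real ^ 'n \<Rightarrow> real ^ 'm.
              (\<forall>i. smooth_on (ball x \<epsilon>) (g i) \<and>
                   (\<forall>y\<in>ball x \<epsilon>. rank (jacobian (g i) (at y)) \<le> 1)) \<and>
              uniform_limit (ball x \<epsilon>) g f sequentially)"
proof
  fix x assume "x \<in> \<Omega>"
  then obtain r L where r: "r > 0" "ball x r \<subseteq> \<Omega>" and lipf: "L-lipschitz_on (ball x r) f"
    using assms(2) unfolding locally_lipschitz_on_def by blast
  \<comment> \<open>Half the radius keeps the closed ball inside the region where \<open>f\<close>
    is Lipschitz. Composition with the nearest point projection to it extends \<open>f\<close> to a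
    Lipschitz map of the whole space, unchanged near each point of the open ball.\<close>
  define R where "R = r / 2"
  have R: "R > 0" "cball x R \<subseteq> ball x r" using r by (auto simp: R_def)
  let ?\<pi> = "closest_point (cball x R)"
  define F where "F y = f (?\<pi> y)" for y
  have \<pi>in: "?\<pi> y \<in> cball x R" for y using R by (intro closest_point_in_set) auto
  have lipF: "L-lipschitz_on UNIV F"
  proof (rule lipschitz_onI)
    fix y z :: "real^'n"
    have "dist (F y) (F z) \<le> L * dist (?\<pi> y) (?\<pi> z)"
      unfolding F_def using lipschitz_onD[OF lipf] \<pi>in R(2) by blast
    also have "\<dots> \<le> L * dist y z"
      using R(1) lipschitz_on_nonneg[OF lipf] by (intro mult_left_mono closest_point_lipschitz) auto
    finally show "dist (F y) (F z) \<le> L * dist y z" .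
  qed (rule lipschitz_on_nonneg[OF lipf])
  have Ff: "F y = f y" if "y \<in> ball x R" for y
    using that closest_point_self[of y "cball x R"] by (simp add: F_def)
  have der: "(F has_derivative D) (at y) \<longleftrightarrow> (f has_derivative D) (at y)" if "y \<in> ball x R" for y D
    using has_derivative_transform_within_open[OF _ open_ball that, of F D UNIV f]
      has_derivative_transform_within_open[OF _ open_ball that, of f D UNIV F] Ff by auto
  have "AE y in lebesgue. y \<in> \<Omega> \<longrightarrow> f differentiable (at y) \<longrightarrow> rank (jacobian f (at y)) \<le> 1"
    using assms(1,3) by (subst (asm) AE_restrict_space_iff) auto
  then have "AE y in lborel. y \<in> \<Omega> \<longrightarrow> f differentiable (at y) \<longrightarrow> rank (jacobian f (at y)) \<le> 1"
    by (simp add: AE_completion_iff)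
  \<comment> \<open>The rank condition says nothing where \<open>f\<close> is not differentiable;
    Rademacher's theorem for \<open>F\<close> supplies differentiability almost everywhere.\<close>
  then have "AE y in lborel. y \<in> ball x R \<longrightarrow> F differentiable (at y) \<and> rank (jacobian F (at y)) \<le> 1"
    using Rademacher[OF lipF]
  proof eventually_elim
    case (elim y)
    show ?case
    proof
      assume y: "y \<in> ball x R"
      then have "y \<in> \<Omega>" using R(2) r(2) ball_subset_cball by blast
      moreover have "f differentiable (at y)" using elim(2) der[OF y] unfolding differentiable_def by simp
      moreover have "jacobian F (at y) = jacobian f (at y)"
        unfolding jacobian_def frechet_derivative_def using der[OF y] by simp
      ultimately show "F differentiable (at y) \<and> rank (jacobian F (at y)) \<le> 1" using elim by simp
    qed
  qed
  then have null: "negligible {y \<in> ball x R. \<not> (F differentiable (at y) \<and> rank (jacobian F (at y)) \<le> 1)}"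
    by (simp add: AE_lborel_iff_negligible)
  let ?C = "4 + 2 * real CARD('m)"
  \<comment> \<open>Dividing by \<open>?C\<close> cancels the constant of the approximation, so the
    error of the map with index \<open>i\<close> is at most \<open>1 / (i + 1)\<close>.\<close>
  have "\<exists>g. smooth_on (ball x R) g \<and> (\<forall>y\<in>ball x R. rank (jacobian g (at y)) \<le> 1) \<and>
    (\<forall>y\<in>ball x R. norm (g y - F y) \<le> inverse (real (Suc i)) / ?C * ?C)" for i
    using lipschitz_rank_one_smooth_approx[OF lipF R(1) _ null, of "inverse (real (Suc i)) / ?C"] by simp
  then obtain g where g: "\<And>i. smooth_on (ball x R) (g i)" "\<And>i y. y \<in> ball x R \<Longrightarrow> rank (jacobian (g i) (at y)) \<le> 1"
    "\<And>i y. y \<in> ball x R \<Longrightarrow> norm (g i y - F y) \<le> inverse (real (Suc i)) / ?C * ?C"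
    by metis
  have "uniform_limit (ball x R) g f sequentially"
    unfolding uniform_limit_sequentially_iff
  proof (intro allI impI)
    fix e :: real assume "e > 0"
    then obtain N where N: "inverse (real (Suc N)) < e" using reals_Archimedean by blast
    show "\<exists>N. \<forall>n\<ge>N. \<forall>y\<in>ball x R. dist (g n y) (f y) < e"
    proof (intro exI[of _ N] allI impI ballI)
      fix n y assume n: "N \<le> n" and y: "y \<in> ball x R"
      have "?C \<noteq> 0" by (smt (verit) of_nat_0_le_iff)
      then have "norm (g n y - F y) \<le> inverse (real (Suc n))" using g(3)[OF y, of n] by simp
      also have "\<dots> \<le> inverse (real (Suc N))" using n by simp
      finally show "dist (g n y) (f y) < e" using N Ff[OF y] by (simp add: dist_norm)
    qed
  qed
  moreover have "ball x R \<subseteq> \<Omega>" using R(2) r(2) ball_subset_cball by blast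
  ultimately show "\<exists>\<epsilon>>0. ball x \<epsilon> \<subseteq> \<Omega> \<and>
           (\<exists>g :: nat \<Rightarrow> real ^ 'n \<Rightarrow> real ^ 'm.
              (\<forall>i. smooth_on (ball x \<epsilon>) (g i) \<and>
                   (\<forall>y\<in>ball x \<epsilon>. rank (jacobian (g i) (at y)) \<le> 1)) \<and>
              uniform_limit (ball x \<epsilon>) g f sequentially)"
    using g(1,2) R(1) by blast
qed

end
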